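(* Let $(B_i)_{i\in\mathbb{N}}$ be a uniformly computable enumeration of all (partial) computable normed linear spaces over $\mathbb{Q}$ (all countable $\mathbb{Q}$-vector spaces with computable operations together with all partial computable norms on them), and let $\overline{B_i}$ denote the completion of $B_i$. Then the index set $\{i\in\mathbb{N} : \overline{B_i}$ is linearly isometrically isomorphic to $(C[0,1],\|\cdot\|_{\sup})\}$ is arithmetical.
   Context: $C[0,1]$ is the Banach space of continuous real-valued functions on $[0,1]$ with the supremum norm and pointwise addition and scalar multiplication. *)

theory Defs
  imports "HOL-Analysis.Analysis"
begin

text \<open>
  Kleene's partial recursive functions of arity \<open>k\<close>, with \<^const>\<open>None\<close> for ``undefined''.
  Only the values on lists of length \<open>k\<close> are meaningful.
\<close>

inductive partrec :: "nat \<Rightarrow> (nat list \<Rightarrow> nat option) \<Rightarrow> bool" where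
  zero: "partrec k (\<lambda>xs. Some 0)"
| succ: "partrec 1 (\<lambda>xs. Some (Suc (hd xs)))"
| proj: "i < k \<Longrightarrow> partrec k (\<lambda>xs. Some (xs ! i))"
| comp: "partrec (length gs) f \<Longrightarrow> \<forall>g\<in>set gs. partrec k g \<Longrightarrow>
    partrec k (\<lambda>xs. Option.bind (those (map (\<lambda>g. g xs) gs)) f)"
| prim_rec: "partrec k f \<Longrightarrow> partrec (k + 2) g \<Longrightarrow>
    partrec (k + 1) (\<lambda>xs. rec_nat (f (tl xs))
      (\<lambda>n r. Option.bind r (\<lambda>v. g (n # v # tl xs))) (hd xs))"
| minim: "partrec (k + 1) f \<Longrightarrow>
    partrec k (\<lambda>xs.
      if \<exists>n. f (n # xs) = Some 0 \<and> (\<forall>m<n. f (m # xs) \<noteq> None)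
      then Some (LEAST n. f (n # xs) = Some 0)
      else None)"

definition partrec1 :: "(nat \<Rightarrow> nat option) \<Rightarrow> bool" where
  "partrec1 f \<longleftrightarrow> (\<exists>F. partrec 1 F \<and> (\<forall>x. F [x] = f x))"

definition partrec2 :: "(nat \<Rightarrow> nat \<Rightarrow> nat option) \<Rightarrow> bool" where
  "partrec2 f \<longleftrightarrow> (\<exists>F. partrec 2 F \<and> (\<forall>x y. F [x, y] = f x y))"

definition partrec3 :: "(nat \<Rightarrow> nat \<Rightarrow> nat \<Rightarrow> nat option) \<Rightarrow> bool" where
  "partrec3 f \<longleftrightarrow> (\<exists>F. partrec 3 F \<and> (\<forall>x y z. F [x, y, z] = f x y z))"

definition computable_rel :: "nat \<Rightarrow> (nat list \<Rightarrow> bool) \<Rightarrow> bool" where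
  "computable_rel k R \<longleftrightarrow>
    (\<exists>F. partrec k F \<and> (\<forall>xs. length xs = k \<longrightarrow> F xs = Some (if R xs then 1 else 0)))"

text \<open>
  \<open>alternating b n R xs\<close> prefixes \<open>R\<close> with \<open>n\<close> alternating number quantifiers, the outermost
  being existential iff \<open>b\<close>.
\<close>

fun alternating :: "bool \<Rightarrow> nat \<Rightarrow> (nat list \<Rightarrow> bool) \<Rightarrow> nat list \<Rightarrow> bool" where
  "alternating b 0 R xs = R xs"
| "alternating True (Suc n) R xs = (\<exists>y. alternating False n R (xs @ [y]))"
| "alternating False (Suc n) R xs = (\<forall>y. alternating True n R (xs @ [y]))"

definition Sigma_set :: "nat \<Rightarrow> nat set \<Rightarrow> bool" where
  "Sigma_set n A \<longleftrightarrow>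
    (\<exists>R. computable_rel (Suc n) R \<and> (\<forall>x. x \<in> A \<longleftrightarrow> alternating True n R [x]))"

definition Pi_set :: "nat \<Rightarrow> nat set \<Rightarrow> bool" where
  "Pi_set n A \<longleftrightarrow>
    (\<exists>R. computable_rel (Suc n) R \<and> (\<forall>x. x \<in> A \<longleftrightarrow> alternating False n R [x]))"

definition arithmetical :: "nat set \<Rightarrow> bool" where
  "arithmetical A \<longleftrightarrow> (\<exists>n. Sigma_set n A \<or> Pi_set n A)"

locale rat_vector_space =
  fixes V :: "'a set"
    and add :: "'a \<Rightarrow> 'a \<Rightarrow> 'a"
    and scale :: "rat \<Rightarrow> 'a \<Rightarrow> 'a"
    and zero :: 'a
  assumes zero_closed: "zero \<in> V"
    and add_closed: "x \<in> V \<Longrightarrow> y \<in> V \<Longrightarrow> add x y \<in> V"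
    and scale_closed: "x \<in> V \<Longrightarrow> scale q x \<in> V"
    and add_assoc: "x \<in> V \<Longrightarrow> y \<in> V \<Longrightarrow> z \<in> V \<Longrightarrow> add (add x y) z = add x (add y z)"
    and add_commute: "x \<in> V \<Longrightarrow> y \<in> V \<Longrightarrow> add x y = add y x"
    and add_zero: "x \<in> V \<Longrightarrow> add x zero = x"
    and add_inverse: "x \<in> V \<Longrightarrow> \<exists>y\<in>V. add x y = zero"
    and scale_add_right: "x \<in> V \<Longrightarrow> y \<in> V \<Longrightarrow> scale q (add x y) = add (scale q x) (scale q y)"
    and scale_add_left: "x \<in> V \<Longrightarrow> scale (p + q) x = add (scale p x) (scale q x)"
    and scale_scale: "x \<in> V \<Longrightarrow> scale p (scale q x) = scale (p * q) x"
    and scale_one: "x \<in> V \<Longrightarrow> scale 1 x = x"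

locale rat_normed_space = rat_vector_space V add scale zero
  for V :: "'a set"
    and add :: "'a \<Rightarrow> 'a \<Rightarrow> 'a"
    and scale :: "rat \<Rightarrow> 'a \<Rightarrow> 'a"
    and zero :: 'a +
  fixes nrm :: "'a \<Rightarrow> real"
  assumes norm_nonneg: "x \<in> V \<Longrightarrow> 0 \<le> nrm x"
    and norm_eq_zero: "x \<in> V \<Longrightarrow> nrm x = 0 \<longleftrightarrow> x = zero"
    and norm_scale: "x \<in> V \<Longrightarrow> nrm (scale q x) = \<bar>real_of_rat q\<bar> * nrm x"
    and norm_triangle: "x \<in> V \<Longrightarrow> y \<in> V \<Longrightarrow> nrm (add x y) \<le> nrm x + nrm y"

text \<open>
  The data of a (possibly partial) presentation with domain a subset of the natural numbers:
  a 0/1-valued characteristic function of the domain, addition, multiplication of a vector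
  (second argument) by the rational with code given by the first argument, and a function
  taking a vector \<open>x\<close> and a precision \<open>n\<close> to the code of a rational approximating the norm
  of \<open>x\<close> up to \<open>2\<^sup>-\<^sup>n\<close>.  Rationals are coded by the (effective, non-injective) library
  numbering \<^const>\<open>nat_to_rat_surj\<close>.
\<close>

record presentation =
  dom_char :: "nat \<Rightarrow> nat option"
  add_fun :: "nat \<Rightarrow> nat \<Rightarrow> nat option"
  scale_fun :: "nat \<Rightarrow> nat \<Rightarrow> nat option"
  norm_fun :: "nat \<Rightarrow> nat \<Rightarrow> nat option"

definition points :: "presentation \<Rightarrow> nat set" where
  "points P = {x. dom_char P x = Some 1}"

definition padd :: "presentation \<Rightarrow> nat \<Rightarrow> nat \<Rightarrow> nat" where
  "padd P x y = the (add_fun P x y)"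

definition pscale :: "presentation \<Rightarrow> rat \<Rightarrow> nat \<Rightarrow> nat" where
  "pscale P q x = the (scale_fun P (inv nat_to_rat_surj q) x)"

definition pnorm :: "presentation \<Rightarrow> nat \<Rightarrow> real" where
  "pnorm P x = lim (\<lambda>n. real_of_rat (nat_to_rat_surj (the (norm_fun P x n))))"

definition pdist :: "presentation \<Rightarrow> nat \<Rightarrow> nat \<Rightarrow> real" where
  "pdist P x y = pnorm P (padd P x (pscale P (-1) y))"

definition ops_total :: "presentation \<Rightarrow> bool" where
  "ops_total P \<longleftrightarrow>
    (\<forall>x. dom_char P x \<in> {Some 0, Some 1}) \<and>
    (\<forall>x\<in>points P. \<forall>y\<in>points P. add_fun P x y \<noteq> None) \<and>
    (\<forall>c. \<forall>x\<in>points P. scale_fun P c x = Some (pscale P (nat_to_rat_surj c) x))"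

definition norm_total :: "presentation \<Rightarrow> bool" where
  "norm_total P \<longleftrightarrow>
    (\<forall>x\<in>points P. \<forall>n. \<exists>c. norm_fun P x n = Some c \<and>
      \<bar>real_of_rat (nat_to_rat_surj c) - pnorm P x\<bar> \<le> 1 / 2 ^ n)"

definition presents_vector_space :: "presentation \<Rightarrow> bool" where
  "presents_vector_space P \<longleftrightarrow>
    ops_total P \<and> (\<exists>z. rat_vector_space (points P) (padd P) (pscale P) z)"

definition presents_normed_space :: "presentation \<Rightarrow> bool" where
  "presents_normed_space P \<longleftrightarrow>
    ops_total P \<and> norm_total P \<and>
    (\<exists>z. rat_normed_space (points P) (padd P) (pscale P) z (pnorm P))"

definition same_space :: "presentation \<Rightarrow> presentation \<Rightarrow> bool" where
  "same_space P Q \<longleftrightarrow>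
    dom_char P = dom_char Q \<and>
    (\<forall>x\<in>points P. \<forall>y\<in>points P. add_fun P x y = add_fun Q x y) \<and>
    (\<forall>c. \<forall>x\<in>points P. scale_fun P c x = scale_fun Q c x) \<and>
    (\<forall>x\<in>points P. \<forall>n. norm_fun P x n = norm_fun Q x n)"

definition partial_computable :: "presentation \<Rightarrow> bool" where
  "partial_computable P \<longleftrightarrow>
    partrec1 (dom_char P) \<and> partrec2 (add_fun P) \<and>
    partrec2 (scale_fun P) \<and> partrec2 (norm_fun P)"

definition uniformly_computable :: "(nat \<Rightarrow> presentation) \<Rightarrow> bool" where
  "uniformly_computable B \<longleftrightarrow>
    partrec2 (\<lambda>i. dom_char (B i)) \<and> partrec3 (\<lambda>i. add_fun (B i)) \<and>
    partrec3 (\<lambda>i. scale_fun (B i)) \<and> partrec3 (\<lambda>i. norm_fun (B i))"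

text \<open>
  Every computable rational vector space equipped with every partial computable function in
  the role of the norm is listed.  The members of the list themselves may be partial or
  violate the axioms: by diagonalisation no uniformly computable list consists of exactly
  the presentations satisfying \<^const>\<open>presents_vector_space\<close>.
\<close>

definition enumerates_all :: "(nat \<Rightarrow> presentation) \<Rightarrow> bool" where
  "enumerates_all B \<longleftrightarrow>
    (\<forall>P. partial_computable P \<and> presents_vector_space P \<longrightarrow> (\<exists>i. same_space P (B i)))"

record 'a nspace =
  ncarrier :: "'a set"
  nadd :: "'a \<Rightarrow> 'a \<Rightarrow> 'a"
  nscale :: "real \<Rightarrow> 'a \<Rightarrow> 'a"
  nnorm :: "'a \<Rightarrow> real"

definition isometrically_isomorphic :: "'a nspace \<Rightarrow> 'b nspace \<Rightarrow> bool" where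
  "isometrically_isomorphic X Y \<longleftrightarrow>
    (\<exists>T. bij_betw T (ncarrier X) (ncarrier Y) \<and>
      (\<forall>x\<in>ncarrier X. \<forall>y\<in>ncarrier X. T (nadd X x y) = nadd Y (T x) (T y)) \<and>
      (\<forall>r. \<forall>x\<in>ncarrier X. T (nscale X r x) = nscale Y r (T x)) \<and>
      (\<forall>x\<in>ncarrier X. nnorm Y (T x) = nnorm X x))"

definition cauchy_seqs :: "presentation \<Rightarrow> (nat \<Rightarrow> nat) set" where
  "cauchy_seqs P = {s. range s \<subseteq> points P \<and>
    (\<forall>e>0. \<exists>M. \<forall>m\<ge>M. \<forall>n\<ge>M. pdist P (s m) (s n) < e)}"

definition null_rel :: "presentation \<Rightarrow> ((nat \<Rightarrow> nat) \<times> (nat \<Rightarrow> nat)) set" where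
  "null_rel P = {(s, t). s \<in> cauchy_seqs P \<and> t \<in> cauchy_seqs P \<and>
    (\<lambda>n. pdist P (s n) (t n)) \<longlonglongrightarrow> 0}"

text \<open>
  The completion as the space of Cauchy sequences modulo null sequences.  A real multiple
  \<open>r [s]\<close> is the class of the sequences \<open>q\<^sub>n s\<^sub>n\<close> for rationals \<open>q\<^sub>n\<close> converging to \<open>r\<close>.
\<close>

definition banach_completion :: "presentation \<Rightarrow> (nat \<Rightarrow> nat) set nspace" where
  "banach_completion P = \<lparr>
    ncarrier = cauchy_seqs P // null_rel P,
    nadd = (\<lambda>X Y. \<Union>s\<in>X. \<Union>t\<in>Y. null_rel P `` {\<lambda>n. padd P (s n) (t n)}),
    nscale = (\<lambda>r X. \<Union>s\<in>X. \<Union>q\<in>{q. (\<lambda>n. real_of_rat (q n)) \<longlonglongrightarrow> r}.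
      null_rel P `` {\<lambda>n. pscale P (q n) (s n)}),
    nnorm = (\<lambda>X. lim (\<lambda>n. pnorm P ((SOME s. s \<in> X) n)))\<rparr>"

definition C01 :: "(real \<Rightarrow> real) nspace" where
  "C01 = \<lparr>
    ncarrier = {f \<in> extensional {0..1}. continuous_on {0..1} f},
    nadd = (\<lambda>f g. \<lambda>x\<in>{0..1}. f x + g x),
    nscale = (\<lambda>r f. \<lambda>x\<in>{0..1}. r * f x),
    nnorm = (\<lambda>f. SUP x\<in>{0..1}. \<bar>f x\<bar>)\<rparr>"

end

theory Submission
  imports Defs "HOL-Number_Theory.Cong"
begin

text \<open>
  The completion is isometric to C[0,1] iff the space embeds rationally linearly, isometrically and
  densely into C[0,1].  Quantifying over such embeddings is not arithmetical; the point is that one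
  of them is definable, by number quantifiers only, from three parameters.

  Write \<open>{u > 0}\<close> for the set where a function is positive.  The norm sees where functions vanish:
  \<open>\<bar>f\<bar> \<ge> \<delta>\<close> everywhere iff \<open>max \<parallel>f + y\<parallel> \<parallel>f - y\<parallel> \<ge> \<delta> + \<parallel>y\<parallel>\<close> for all \<open>y\<close> (test with high narrow
  bumps \<open>y\<close>).  Relative to a positive parameter \<open>e\<close> this defines \<open>f > 0\<close>, hence whether \<open>{u > 0}\<close> and
  \<open>{v > 0}\<close> meet, hence betweenness: a point of \<open>{u > 0}\<close> lies between points of \<open>{v > 0}\<close> and
  \<open>{w > 0}\<close> iff some \<open>k\<close> is positive at the one, negative at the other, and vanishes only inside
  \<open>{u > 0}\<close>.  Two parameters \<open>l\<close>, \<open>r\<close> with \<open>{l > 0}\<close> to the left of \<open>{r > 0}\<close> orient the interval.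
  Now each \<open>u\<close> with \<open>{u > 0}\<close> nonempty names the point \<open>sup {u > 0}\<close>; these points are dense, and the
  value of \<open>f / e\<close> at such a point is definable.

  Conversely, evaluations indexed by a linear order that satisfy the evident first-order properties
  of this family come from an embedding: a weighted sum of the running maxima of all vectors maps the
  index set monotonically onto a dense subset of an interval, the evaluations extend continuously to
  it, their span is dense by Stone--Weierstrass, and dividing by the supremum over the unit ball
  restores the norm.
\<close>

section \<open>Computable functions\<close>

definition computable_fun :: "nat \<Rightarrow> (nat list \<Rightarrow> nat) \<Rightarrow> bool" where
  "computable_fun k f \<longleftrightarrow> (\<exists>F. partrec k F \<and> (\<forall>xs. length xs = k \<longrightarrow> F xs = Some (f xs)))"

lemma computable_rel_iff:
  "computable_rel k R \<longleftrightarrow> computable_fun k (\<lambda>xs. if R xs then 1 else 0)"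
  by (simp add: computable_rel_def computable_fun_def)

lemma computable_fun_cong:
  "computable_fun k f \<Longrightarrow> (\<And>xs. length xs = k \<Longrightarrow> f xs = g xs) \<Longrightarrow> computable_fun k g"
  unfolding computable_fun_def by metis

lemma those_map_Some:
  "(\<And>x. x \<in> set xs \<Longrightarrow> h x = Some (h' x)) \<Longrightarrow> those (map h xs) = Some (map h' xs)"
  by (induction xs) auto

lemma computable_fun_comp:
  assumes f: "computable_fun (length gs) f" and gs: "\<forall>g\<in>set gs. computable_fun k g"
  shows "computable_fun k (\<lambda>xs. f (map (\<lambda>g. g xs) gs))"
proof -
  obtain F where F: "partrec (length gs) F" "\<And>xs. length xs = length gs \<Longrightarrow> F xs = Some (f xs)"
    using f by (auto simp: computable_fun_def)
  obtain H where H: "\<And>g. g \<in> set gs \<Longrightarrow> partrec k (H g)"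
    "\<And>g xs. g \<in> set gs \<Longrightarrow> length xs = k \<Longrightarrow> H g xs = Some (g xs)"
    using gs unfolding computable_fun_def by metis
  have "partrec k (\<lambda>xs. Option.bind (those (map (\<lambda>g. g xs) (map H gs))) F)"
    using F(1) H(1) by (intro partrec.comp) auto
  moreover have "Option.bind (those (map (\<lambda>g. g xs) (map H gs))) F = Some (f (map (\<lambda>g. g xs) gs))"
    if "length xs = k" for xs
    using those_map_Some[of gs "\<lambda>g. H g xs" "\<lambda>g. g xs"] H(2) F(2) that by (simp add: comp_def)
  ultimately show ?thesis unfolding computable_fun_def by blast
qed

lemma computable_fun_nth: "i < k \<Longrightarrow> computable_fun k (\<lambda>xs. xs ! i)"
  unfolding computable_fun_def using partrec.proj by blast

lemma computable_fun_prim_rec: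
  assumes "computable_fun k f" and "computable_fun (k + 2) g"
  shows "computable_fun (k + 1) (\<lambda>xs. rec_nat (f (tl xs)) (\<lambda>n v. g (n # v # tl xs)) (hd xs))"
proof -
  obtain F where F: "partrec k F" "\<And>xs. length xs = k \<Longrightarrow> F xs = Some (f xs)"
    using assms(1) by (auto simp: computable_fun_def)
  obtain H where H: "partrec (k + 2) H" "\<And>xs. length xs = k + 2 \<Longrightarrow> H xs = Some (g xs)"
    using assms(2) by (auto simp: computable_fun_def)
  have "rec_nat (F ys) (\<lambda>n r. Option.bind r (\<lambda>v. H (n # v # ys))) m
      = Some (rec_nat (f ys) (\<lambda>n v. g (n # v # ys)) m)" if "length ys = k" for m ys
    using F(2) H(2) that by (induction m) auto
  then have "length xs = k + 1 \<Longrightarrow>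
      rec_nat (F (tl xs)) (\<lambda>n r. Option.bind r (\<lambda>v. H (n # v # tl xs))) (hd xs)
      = Some (rec_nat (f (tl xs)) (\<lambda>n v. g (n # v # tl xs)) (hd xs))" for xs
    by simp
  with partrec.prim_rec[OF F(1) H(1)] show ?thesis unfolding computable_fun_def by blast
qed

lemma computable_fun_comp1:
  assumes "computable_fun 1 (\<lambda>xs. f (xs ! 0))" "computable_fun k g"
  shows "computable_fun k (\<lambda>xs. f (g xs))"
  using computable_fun_comp[of "[g]" "\<lambda>xs. f (xs ! 0)" k] assms by simp

lemma computable_fun_comp2:
  assumes "computable_fun 2 (\<lambda>xs. f (xs ! 0) (xs ! 1))" "computable_fun k g" "computable_fun k h"
  shows "computable_fun k (\<lambda>xs. f (g xs) (h xs))"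
  using computable_fun_comp[of "[g, h]" "\<lambda>xs. f (xs ! 0) (xs ! 1)" k] assms
  by (auto simp: numeral_2_eq_2)

lemma computable_fun_Suc:
  assumes "computable_fun k f"
  shows "computable_fun k (\<lambda>xs. Suc (f xs))"
proof (rule computable_fun_comp1[OF _ assms])
  have "computable_fun 1 (\<lambda>xs. Suc (hd xs))"
    unfolding computable_fun_def using partrec.succ by blast
  then show "computable_fun 1 (\<lambda>xs. Suc (xs ! 0))"
    by (rule computable_fun_cong) (auto simp: length_Suc_conv)
qed

lemma computable_fun_const: "computable_fun k (\<lambda>xs. c)"
proof (induction c)
  case 0
  show ?case unfolding computable_fun_def using partrec.zero by blast
qed (rule computable_fun_Suc)

lemma computable_fun_rec_nat:
  assumes f: "computable_fun 1 (\<lambda>xs. f (xs ! 0))"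
    and g: "computable_fun 3 (\<lambda>xs. g (xs ! 0) (xs ! 1) (xs ! 2))"
    and h: "computable_fun k h" and h': "computable_fun k h'"
  shows "computable_fun k (\<lambda>xs. rec_nat (f (h' xs)) (\<lambda>n v. g n v (h' xs)) (h xs))"
proof -
  have "computable_fun (1 + 1)
      (\<lambda>xs. rec_nat (f (tl xs ! 0))
        (\<lambda>n v. g ((n # v # tl xs) ! 0) ((n # v # tl xs) ! 1) ((n # v # tl xs) ! 2)) (hd xs))"
    using computable_fun_prim_rec[OF f, of "\<lambda>xs. g (xs ! 0) (xs ! 1) (xs ! 2)"] g
    by (simp add: numeral_3_eq_3)
  then have "computable_fun 2 (\<lambda>xs. rec_nat (f (xs ! 1)) (\<lambda>n v. g n v (xs ! 1)) (xs ! 0))"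
    unfolding one_add_one
    by (rule computable_fun_cong) (auto simp: numeral_2_eq_2 length_Suc_conv)
  from computable_fun_comp2[OF this h h'] show ?thesis .
qed

lemma computable_fun_add:
  assumes "computable_fun k f" "computable_fun k g"
  shows "computable_fun k (\<lambda>xs. f xs + g xs)"
proof -
  have "rec_nat y (\<lambda>n v. Suc v) x = x + y" for x y :: nat by (induction x) auto
  then show ?thesis
    using computable_fun_rec_nat[of "\<lambda>y. y" "\<lambda>n v y. Suc v" k f g] assms
    by (simp add: computable_fun_nth computable_fun_Suc)
qed

lemma computable_fun_mult:
  assumes "computable_fun k f" "computable_fun k g"
  shows "computable_fun k (\<lambda>xs. f xs * g xs)"
proof -
  have "rec_nat 0 (\<lambda>n v. v + y) x = x * y" for x y :: nat by (induction x) auto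
  then show ?thesis
    using computable_fun_rec_nat[of "\<lambda>y. 0" "\<lambda>n v y. v + y" k f g] assms
    by (simp add: computable_fun_nth computable_fun_add computable_fun_const)
qed

lemma computable_fun_pred:
  assumes "computable_fun k f"
  shows "computable_fun k (\<lambda>xs. f xs - 1)"
proof -
  have "rec_nat 0 (\<lambda>n v. n) x = x - 1" for x :: nat by (cases x) auto
  then show ?thesis
    using computable_fun_rec_nat[of "\<lambda>y. 0" "\<lambda>n v y. n" k f f] assms
    by (simp add: computable_fun_nth computable_fun_const)
qed

lemma computable_fun_diff:
  assumes "computable_fun k f" "computable_fun k g"
  shows "computable_fun k (\<lambda>xs. f xs - g xs)"
proof -
  have "rec_nat x (\<lambda>n v. v - 1) y = x - y" for x y :: nat by (induction y) auto
  then show ?thesis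
    using computable_fun_rec_nat[of "\<lambda>y. y" "\<lambda>n v y. v - 1" k g f] assms computable_fun_pred
    by (simp add: computable_fun_nth del: One_nat_def)
qed

lemma computable_fun_power2:
  assumes "computable_fun k f"
  shows "computable_fun k (\<lambda>xs. 2 ^ f xs)"
proof -
  have "rec_nat (Suc 0) (\<lambda>n v. v + v) x = (2::nat) ^ x" for x :: nat by (induction x) auto
  then show ?thesis
    using computable_fun_rec_nat[of "\<lambda>y. Suc 0" "\<lambda>n v y. v + v" k f f] assms
    by (simp add: computable_fun_nth computable_fun_const computable_fun_add)
qed

lemma computable_fun_triangle:
  assumes "computable_fun k f"
  shows "computable_fun k (\<lambda>xs. triangle (f xs))"
proof -
  have "rec_nat 0 (\<lambda>n v. Suc (v + n)) x = triangle x" for x :: nat by (induction x) auto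
  then show ?thesis
    using computable_fun_rec_nat[of "\<lambda>y. 0" "\<lambda>n v y. Suc (v + n)" k f f] assms
    by (simp add: computable_fun_nth computable_fun_const computable_fun_add computable_fun_Suc)
qed

lemma computable_rel_cong:
  "computable_rel k R \<Longrightarrow> (\<And>xs. length xs = k \<Longrightarrow> R xs = S xs) \<Longrightarrow> computable_rel k S"
  unfolding computable_rel_def by metis

lemma computable_rel_eq:
  assumes "computable_fun k f" "computable_fun k g"
  shows "computable_rel k (\<lambda>xs. f xs = g xs)"
proof -
  have "computable_fun k (\<lambda>xs. 1 - ((f xs - g xs) + (g xs - f xs)))"
    using assms by (intro computable_fun_diff computable_fun_add computable_fun_const)
  then show ?thesis unfolding computable_rel_iff
    by (rule computable_fun_cong) auto
qed

lemma computable_rel_not: "computable_rel k R \<Longrightarrow> computable_rel k (\<lambda>xs. \<not> R xs)"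
  unfolding computable_rel_iff
  by (rule computable_fun_cong[OF computable_fun_diff[OF computable_fun_const[of k 1]]]) auto

lemma computable_rel_conj:
  "computable_rel k R \<Longrightarrow> computable_rel k S \<Longrightarrow> computable_rel k (\<lambda>xs. R xs \<and> S xs)"
  unfolding computable_rel_iff
  by (drule (1) computable_fun_mult, erule computable_fun_cong) simp

lemma computable_fun_reindex:
  assumes "computable_fun (length js) f" "\<forall>j\<in>set js. j < k"
  shows "computable_fun k (\<lambda>xs. f (map ((!) xs) js))"
  using computable_fun_comp[of "map (\<lambda>j xs. xs ! j) js" f k] assms
  by (auto simp: comp_def intro: computable_fun_nth)

lemma computable_rel_reindex:
  "computable_rel (length js) R \<Longrightarrow> \<forall>j\<in>set js. j < k \<Longrightarrow> computable_rel k (\<lambda>xs. R (map ((!) xs) js))"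
  unfolding computable_rel_iff by (rule computable_fun_reindex)

section \<open>Arithmetical relations\<close>

lemma alternating_cong:
  assumes "\<And>zs. length zs = n \<Longrightarrow> S (xs @ zs) = S' (xs' @ zs)"
  shows "alternating b n S xs = alternating b n S' xs'"
  using assms
proof (induction n arbitrary: b xs xs')
  case 0
  then show ?case using "0"[of "[]"] by simp
next
  case (Suc n)
  have "alternating c n S (xs @ [y]) = alternating c n S' (xs' @ [y])" for c y
    by (rule Suc.IH) (use Suc.prems in auto)
  then show ?case by (cases b) auto
qed

lemma alternating_not: "alternating (\<not> b) n (\<lambda>xs. \<not> S xs) xs \<longleftrightarrow> \<not> alternating b n S xs"
proof (induction n arbitrary: b xs)
  case (Suc n)
  then show ?case using Suc[of "\<not> b"] by (cases b) auto
qed simp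

lemma alternating_conj_left: "alternating b n (\<lambda>xs. c \<and> S xs) xs \<longleftrightarrow> c \<and> alternating b n S xs"
proof (induction n arbitrary: b xs)
  case (Suc n)
  then show ?case by (cases b) auto
qed simp

definition arith_rel :: "nat \<Rightarrow> (nat list \<Rightarrow> bool) \<Rightarrow> bool" where
  "arith_rel k R \<longleftrightarrow> (\<exists>b n S. computable_rel (k + n) S \<and>
     (\<forall>xs. length xs = k \<longrightarrow> (R xs \<longleftrightarrow> alternating b n S xs)))"

lemma arith_relE:
  assumes "arith_rel k R"
  obtains b n S where "computable_rel (k + n) S"
    "\<And>xs. length xs = k \<Longrightarrow> R xs \<longleftrightarrow> alternating b n S xs"
  using assms by (auto simp: arith_rel_def)

lemma arith_rel_cong:
  "arith_rel k R \<Longrightarrow> (\<And>xs. length xs = k \<Longrightarrow> R xs = R' xs) \<Longrightarrow> arith_rel k R'"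
  unfolding arith_rel_def by metis

lemma arith_rel_computable: "computable_rel k R \<Longrightarrow> arith_rel k R"
  unfolding arith_rel_def by (rule exI[of _ True], rule exI[of _ 0]) auto

lemma arith_rel_not: "arith_rel k R \<Longrightarrow> arith_rel k (\<lambda>xs. \<not> R xs)"
  unfolding arith_rel_def by (metis alternating_not computable_rel_not)

lemma arith_rel_reindex:
  assumes "arith_rel (length js) R" and js: "\<forall>j\<in>set js. j < k"
  shows "arith_rel k (\<lambda>xs. R (map ((!) xs) js))"
proof -
  obtain b n S where S: "computable_rel (length js + n) S"
    and RS: "\<And>xs. length xs = length js \<Longrightarrow> R xs \<longleftrightarrow> alternating b n S xs"
    using assms(1) by (rule arith_relE) blast
  define S' where "S' = (\<lambda>ys. S (map ((!) ys) (js @ [k..<k + n])))"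
  have "computable_rel (k + n) S'"
    unfolding S'_def using S js by (intro computable_rel_reindex) auto
  moreover have "R (map ((!) xs) js) \<longleftrightarrow> alternating b n S' xs" if xs: "length xs = k" for xs
  proof -
    have "map ((!) (xs @ zs)) (js @ [k..<k + n]) = map ((!) xs) js @ zs" if "length zs = n" for zs
      using js xs that by (auto simp: nth_append intro!: nth_equalityI)
    then show ?thesis unfolding RS[of "map ((!) xs) js", simplified] S'_def
      by (intro alternating_cong) (simp only:)
  qed
  ultimately show ?thesis unfolding arith_rel_def by blast
qed

lemma butlast_eq_map_nth: "length xs = Suc k \<Longrightarrow> butlast xs = map ((!) xs) [0..<k]"
  by (auto intro!: nth_equalityI simp: nth_butlast)

lemma arith_rel_butlast: "arith_rel k R \<Longrightarrow> arith_rel (Suc k) (\<lambda>xs. R (butlast xs))"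
  by (rule arith_rel_cong[OF arith_rel_reindex[of "[0..<k]"]]) (auto simp: butlast_eq_map_nth)

text \<open>A dummy quantifier lets the prefix begin with either quantifier.\<close>

lemma arith_rel_outer_quantifier:
  assumes "arith_rel k R"
  obtains n S where "computable_rel (k + n) S"
    "\<And>xs. length xs = k \<Longrightarrow> R xs \<longleftrightarrow> alternating b n S xs"
proof -
  obtain c n S where S: "computable_rel (k + n) S"
    and RS: "\<And>xs. length xs = k \<Longrightarrow> R xs \<longleftrightarrow> alternating c n S xs"
    using assms by (rule arith_relE) blast
  show ?thesis
  proof (cases "c = b")
    case True
    with S RS that show ?thesis by blast
  next
    case False
    define S' where "S' = (\<lambda>ys. S (map ((!) ys) ([0..<k] @ [Suc k..<Suc k + n])))"
    have len: "length ([0..<k] @ [Suc k..<Suc k + n]) = k + n" by simp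
    have "computable_rel (k + Suc n) S'"
      unfolding S'_def by (rule computable_rel_reindex) (use S in \<open>simp only: len\<close>, auto)
    moreover have "R xs \<longleftrightarrow> alternating b (Suc n) S' xs" if xs: "length xs = k" for xs
    proof -
      have "map ((!) ((xs @ [y]) @ zs)) ([0..<k] @ [Suc k..<Suc k + n]) = xs @ zs"
        if "length zs = n" for y zs
        using xs that by (auto simp: nth_append simp del: upt_Suc intro!: nth_equalityI)
      then have "alternating c n S' (xs @ [y]) = alternating c n S xs" for y
        unfolding S'_def by (intro alternating_cong) presburger
      then show ?thesis using RS[OF xs] False by (cases b) auto
    qed
    ultimately show ?thesis using that by blast
  qed
qed

lemma arith_rel_ex:
  assumes "arith_rel (Suc k) R"
  shows "arith_rel k (\<lambda>xs. \<exists>y. R (xs @ [y]))"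
proof -
  obtain n S where "computable_rel (Suc k + n) S"
    "\<And>xs. length xs = Suc k \<Longrightarrow> R xs \<longleftrightarrow> alternating False n S xs"
    using arith_rel_outer_quantifier[OF assms] by blast
  then show ?thesis unfolding arith_rel_def
    by (intro exI[of _ True] exI[of _ "Suc n"] exI[of _ S]) auto
qed

lemma arith_rel_all: "arith_rel (Suc k) R \<Longrightarrow> arith_rel k (\<lambda>xs. \<forall>y. R (xs @ [y]))"
  using arith_rel_not[OF arith_rel_ex[OF arith_rel_not]] by simp

lemma arith_rel_conj_computable:
  assumes R: "computable_rel k R" and R': "arith_rel k R'"
  shows "arith_rel k (\<lambda>xs. R xs \<and> R' xs)"
proof -
  obtain b n S where S: "computable_rel (k + n) S"
    and RS: "\<And>xs. length xs = k \<Longrightarrow> R' xs \<longleftrightarrow> alternating b n S xs"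
    using R' by (rule arith_relE) blast
  have "computable_rel (k + n) (\<lambda>ys. R (map ((!) ys) [0..<k]) \<and> S ys)"
    using R S by (intro computable_rel_conj computable_rel_reindex) auto
  moreover have "R xs \<and> R' xs \<longleftrightarrow> alternating b n (\<lambda>ys. R (map ((!) ys) [0..<k]) \<and> S ys) xs"
    if xs: "length xs = k" for xs
  proof -
    have "map ((!) (xs @ zs)) [0..<k] = xs" for zs
      using xs by (auto simp: nth_append intro!: nth_equalityI)
    then show ?thesis
      unfolding RS[OF xs] alternating_conj_left[symmetric] by (intro alternating_cong) simp
  qed
  ultimately show ?thesis unfolding arith_rel_def by blast
qed

lemma arith_rel_alternating_conj:
  assumes "computable_rel (k + n) S" "arith_rel k R"
  shows "arith_rel k (\<lambda>xs. alternating b n S xs \<and> R xs)"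
  using assms
proof (induction n arbitrary: b k R)
  case 0
  then show ?case using arith_rel_conj_computable by simp
next
  case (Suc n)
  have "arith_rel (Suc k) (\<lambda>xs. alternating (\<not> b) n S xs \<and> R (butlast xs))"
    using Suc.prems arith_rel_butlast by (intro Suc.IH) auto
  from arith_rel_ex[OF this] arith_rel_all[OF this] show ?case by (cases b) auto
qed

lemma arith_rel_conj:
  assumes "arith_rel k R" "arith_rel k R'"
  shows "arith_rel k (\<lambda>xs. R xs \<and> R' xs)"
proof -
  obtain b n S where S: "computable_rel (k + n) S"
    and RS: "\<And>xs. length xs = k \<Longrightarrow> R xs \<longleftrightarrow> alternating b n S xs"
    using assms(1) by (rule arith_relE) blast
  from arith_rel_alternating_conj[OF S assms(2)] show ?thesis
    by (rule arith_rel_cong) (simp add: RS)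
qed

definition arith_map :: "nat \<Rightarrow> (nat list \<Rightarrow> nat) \<Rightarrow> bool" where
  "arith_map k f \<longleftrightarrow> arith_rel (Suc k) (\<lambda>xs. f (butlast xs) = last xs)"

lemma arith_map_cong:
  "arith_map k f \<Longrightarrow> (\<And>xs. length xs = k \<Longrightarrow> f xs = g xs) \<Longrightarrow> arith_map k g"
  unfolding arith_map_def by (erule arith_rel_cong) simp

lemma arith_map_computable:
  assumes "computable_fun k f"
  shows "arith_map k f"
proof -
  have "computable_rel (Suc k) (\<lambda>xs. f (map ((!) xs) [0..<k]) = xs ! k)"
    using assms by (intro computable_rel_eq computable_fun_reindex computable_fun_nth) auto
  then show ?thesis unfolding arith_map_def
    by (intro arith_rel_computable, elim computable_rel_cong)
      (auto simp: butlast_eq_map_nth last_conv_nth simp flip: length_greater_0_conv)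
qed

lemma arith_map_butlast:
  assumes "arith_map k f"
  shows "arith_map (Suc k) (\<lambda>xs. f (butlast xs))"
proof -
  have "arith_rel (Suc (Suc k)) (\<lambda>xs. f (butlast (map ((!) xs) ([0..<k] @ [Suc k])))
      = last (map ((!) xs) ([0..<k] @ [Suc k])))"
    using assms unfolding arith_map_def by (intro arith_rel_reindex) auto
  then show ?thesis unfolding arith_map_def
  proof (rule arith_rel_cong)
    fix xs :: "nat list" assume len: "length xs = Suc (Suc k)"
    then have "butlast (butlast xs) = map ((!) xs) [0..<k]"
      by (auto intro!: nth_equalityI simp: nth_butlast)
    moreover have "last xs = xs ! Suc k" using len by (subst last_conv_nth) auto
    ultimately show "(f (butlast (map ((!) xs) ([0..<k] @ [Suc k])))
        = last (map ((!) xs) ([0..<k] @ [Suc k]))) = (f (butlast (butlast xs)) = last xs)"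
      by simp
  qed
qed

lemma arith_rel_append_subst:
  assumes "arith_rel (k + length fs) R" "\<forall>f\<in>set fs. arith_map k f"
  shows "arith_rel k (\<lambda>xs. R (xs @ map (\<lambda>f. f xs) fs))"
  using assms
proof (induction fs arbitrary: R rule: rev_induct)
  case Nil
  then show ?case by simp
next
  case (snoc f fs)
  let ?k = "k + length fs"
  have "arith_rel (Suc ?k) (\<lambda>xs.
      f (butlast (map ((!) xs) ([0..<k] @ [?k]))) = last (map ((!) xs) ([0..<k] @ [?k])))"
    using snoc.prems unfolding arith_map_def by (intro arith_rel_reindex) auto
  then have "arith_rel ?k (\<lambda>xs. \<exists>y. f (butlast (map ((!) (xs @ [y])) ([0..<k] @ [?k])))
      = last (map ((!) (xs @ [y])) ([0..<k] @ [?k])) \<and> R (xs @ [y]))"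
    using snoc.prems by (intro arith_rel_ex arith_rel_conj) auto
  then have "arith_rel ?k (\<lambda>xs. R (xs @ [f (take k xs)]))"
  proof (rule arith_rel_cong)
    fix xs :: "nat list" assume len: "length xs = ?k"
    then have "map ((!) (xs @ [y])) ([0..<k] @ [?k]) = take k xs @ [y]" for y
      by (auto intro!: nth_equalityI simp: nth_append)
    then show "(\<exists>y. f (butlast (map ((!) (xs @ [y])) ([0..<k] @ [?k])))
      = last (map ((!) (xs @ [y])) ([0..<k] @ [?k])) \<and> R (xs @ [y])) = R (xs @ [f (take k xs)])"
      by simp
  qed
  then have "arith_rel k (\<lambda>xs.
      R ((xs @ map (\<lambda>f. f xs) fs) @ [f (take k (xs @ map (\<lambda>f. f xs) fs))]))"
    using snoc.prems by (intro snoc.IH) auto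
  then show ?case by (rule arith_rel_cong) simp
qed

lemma arith_rel_subst:
  assumes R: "arith_rel (length fs) R" and fs: "\<forall>f\<in>set fs. arith_map k f"
  shows "arith_rel k (\<lambda>xs. R (map (\<lambda>f. f xs) fs))"
proof -
  have "arith_rel (k + length fs) (\<lambda>xs. R (map ((!) xs) [k..<k + length fs]))"
    using R by (intro arith_rel_reindex) auto
  from arith_rel_append_subst[OF this fs] show ?thesis
    by (rule arith_rel_cong) (auto intro!: arg_cong[of _ _ R] nth_equalityI simp: nth_append)
qed

lemma arith_map_subst:
  assumes "arith_map (length fs) h" "\<forall>f\<in>set fs. arith_map k f"
  shows "arith_map k (\<lambda>xs. h (map (\<lambda>f. f xs) fs))"
proof -
  have "arith_map (Suc k) last"
    by (rule arith_map_cong[OF arith_map_computable[OF computable_fun_nth[of k]]])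
      (auto simp: last_conv_nth simp flip: length_greater_0_conv)
  moreover have "\<forall>f\<in>set (map (\<lambda>f xs. f (butlast xs)) fs). arith_map (Suc k) f"
    using assms(2) arith_map_butlast by auto
  ultimately show ?thesis
    using arith_rel_subst[of "map (\<lambda>f xs. f (butlast xs)) fs @ [last]"
      "\<lambda>xs. h (butlast xs) = last xs" "Suc k"]
      assms(1) by (auto simp: arith_map_def comp_def)
qed

subsection \<open>Unary predicates and functions\<close>

definition npair :: "nat \<Rightarrow> nat \<Rightarrow> nat" where "npair x y = prod_encode (x, y)"
definition nfst :: "nat \<Rightarrow> nat" where "nfst z = fst (prod_decode z)"
definition nsnd :: "nat \<Rightarrow> nat" where "nsnd z = snd (prod_decode z)"

lemma nfst_npair [simp]: "nfst (npair x y) = x" and nsnd_npair [simp]: "nsnd (npair x y) = y"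
  and npair_nfst_nsnd [simp]: "npair (nfst z) (nsnd z) = z"
  by (simp_all add: nfst_def nsnd_def npair_def)

definition arith_pred :: "(nat \<Rightarrow> bool) \<Rightarrow> bool" where
  "arith_pred P \<longleftrightarrow> arith_rel 1 (\<lambda>xs. P (xs ! 0))"

definition arith_fun :: "(nat \<Rightarrow> nat) \<Rightarrow> bool" where
  "arith_fun f \<longleftrightarrow> arith_map 1 (\<lambda>xs. f (xs ! 0))"

lemma arithmetical_if_arith_pred:
  assumes "arith_pred (\<lambda>i. i \<in> A)"
  shows "arithmetical A"
proof -
  obtain b n S where "computable_rel (1 + n) S"
    "\<And>xs. length xs = 1 \<Longrightarrow> xs ! 0 \<in> A \<longleftrightarrow> alternating b n S xs"
    using assms unfolding arith_pred_def by (rule arith_relE) blast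
  then have "computable_rel (Suc n) S" "\<And>x. x \<in> A \<longleftrightarrow> alternating b n S [x]"
    by (auto dest: meta_spec[of _ "[_]"])
  then show ?thesis
    unfolding arithmetical_def Sigma_set_def Pi_set_def
    by (intro exI[of _ n]) (cases b; auto)
qed

lemma arith_pred_subst_list:
  assumes "arith_rel (length fs) R" "\<forall>f\<in>set fs. arith_fun f"
  shows "arith_pred (\<lambda>z. R (map (\<lambda>f. f z) fs))"
  using arith_rel_subst[of "map (\<lambda>f xs. f (xs ! 0)) fs" R 1] assms
  by (simp add: arith_pred_def arith_fun_def comp_def)

lemma arith_fun_subst_list:
  assumes "arith_map (length fs) h" "\<forall>f\<in>set fs. arith_fun f"
  shows "arith_fun (\<lambda>z. h (map (\<lambda>f. f z) fs))"
  using arith_map_subst[of "map (\<lambda>f xs. f (xs ! 0)) fs" h 1] assms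
  by (simp add: arith_fun_def comp_def)

lemma arith_pred_comp: "arith_pred P \<Longrightarrow> arith_fun f \<Longrightarrow> arith_pred (\<lambda>z. P (f z))"
  using arith_pred_subst_list[of "[f]" "\<lambda>xs. P (xs ! 0)"] by (simp add: arith_pred_def)

lemma arith_fun_comp: "arith_fun f \<Longrightarrow> arith_fun g \<Longrightarrow> arith_fun (\<lambda>z. f (g z))"
  using arith_fun_subst_list[of "[g]" "\<lambda>xs. f (xs ! 0)"] by (simp add: arith_fun_def)

lemma arith_fun_computable1:
  "computable_fun 1 (\<lambda>xs. h (xs ! 0)) \<Longrightarrow> arith_fun f \<Longrightarrow> arith_fun (\<lambda>z. h (f z))"
  using arith_fun_subst_list[of "[f]" "\<lambda>xs. h (xs ! 0)"] arith_map_computable by simp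

lemma arith_fun_computable2:
  "computable_fun 2 (\<lambda>xs. h (xs ! 0) (xs ! 1)) \<Longrightarrow> arith_fun f \<Longrightarrow> arith_fun g \<Longrightarrow>
    arith_fun (\<lambda>z. h (f z) (g z))"
  using arith_fun_subst_list[of "[f, g]" "\<lambda>xs. h (xs ! 0) (xs ! 1)"] arith_map_computable
  by (simp add: numeral_2_eq_2)

named_theorems arith_intros

lemma arith_fun_id [arith_intros]: "arith_fun (\<lambda>z. z)"
  unfolding arith_fun_def by (intro arith_map_computable computable_fun_nth) simp

lemma arith_fun_const [arith_intros]: "arith_fun (\<lambda>z. c)"
  unfolding arith_fun_def by (intro arith_map_computable computable_fun_const)

lemma arith_fun_Suc [arith_intros]: "arith_fun f \<Longrightarrow> arith_fun (\<lambda>z. Suc (f z))"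
  by (rule arith_fun_computable1) (simp_all add: computable_fun_Suc computable_fun_nth)

lemma arith_fun_power2 [arith_intros]: "arith_fun f \<Longrightarrow> arith_fun (\<lambda>z. 2 ^ f z)"
  by (rule arith_fun_computable1) (simp_all add: computable_fun_power2 computable_fun_nth)

lemma arith_fun_add [arith_intros]: "arith_fun f \<Longrightarrow> arith_fun g \<Longrightarrow> arith_fun (\<lambda>z. f z + g z)"
  by (rule arith_fun_computable2) (simp_all add: computable_fun_add computable_fun_nth)

lemma arith_fun_mult [arith_intros]: "arith_fun f \<Longrightarrow> arith_fun g \<Longrightarrow> arith_fun (\<lambda>z. f z * g z)"
  by (rule arith_fun_computable2) (simp_all add: computable_fun_mult computable_fun_nth)

lemma arith_fun_diff [arith_intros]: "arith_fun f \<Longrightarrow> arith_fun g \<Longrightarrow> arith_fun (\<lambda>z. f z - g z)"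
  by (rule arith_fun_computable2) (simp_all add: computable_fun_diff computable_fun_nth)

lemma computable_fun_npair:
  "computable_fun k f \<Longrightarrow> computable_fun k g \<Longrightarrow> computable_fun k (\<lambda>xs. npair (f xs) (g xs))"
  by (simp add: npair_def prod_encode_def computable_fun_add computable_fun_triangle)

lemma arith_fun_npair [arith_intros]:
  "arith_fun f \<Longrightarrow> arith_fun g \<Longrightarrow> arith_fun (\<lambda>z. npair (f z) (g z))"
  by (rule arith_fun_computable2) (simp_all add: computable_fun_npair computable_fun_nth)

lemma arith_pred_eq [arith_intros]:
  assumes "arith_fun f" "arith_fun g"
  shows "arith_pred (\<lambda>z. f z = g z)"
proof -
  have "arith_rel 2 (\<lambda>xs. xs ! 0 = xs ! 1)"
    by (intro arith_rel_computable computable_rel_eq computable_fun_nth) simp_all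
  with arith_pred_subst_list[of "[f, g]" "\<lambda>xs. xs ! 0 = xs ! 1"] assms show ?thesis
    by (simp add: numeral_2_eq_2)
qed

lemma arith_pred_not [arith_intros]: "arith_pred P \<Longrightarrow> arith_pred (\<lambda>z. \<not> P z)"
  unfolding arith_pred_def by (rule arith_rel_not)

lemma arith_pred_conj [arith_intros]: "arith_pred P \<Longrightarrow> arith_pred Q \<Longrightarrow> arith_pred (\<lambda>z. P z \<and> Q z)"
  unfolding arith_pred_def by (rule arith_rel_conj)

lemma arith_pred_disj [arith_intros]: "arith_pred P \<Longrightarrow> arith_pred Q \<Longrightarrow> arith_pred (\<lambda>z. P z \<or> Q z)"
  using arith_pred_not[OF arith_pred_conj[OF arith_pred_not arith_pred_not], of P Q] by simp

lemma arith_pred_imp [arith_intros]: "arith_pred P \<Longrightarrow> arith_pred Q \<Longrightarrow> arith_pred (\<lambda>z. P z \<longrightarrow> Q z)"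
  unfolding imp_conv_disj by (intro arith_intros)

lemma arith_pred_iff [arith_intros]: "arith_pred P \<Longrightarrow> arith_pred Q \<Longrightarrow> arith_pred (\<lambda>z. P z \<longleftrightarrow> Q z)"
  unfolding iff_conv_conj_imp by (intro arith_intros)

lemma arith_rel2_npair:
  assumes "arith_pred (\<lambda>z. P (nfst z) (nsnd z))"
  shows "arith_rel 2 (\<lambda>xs. P (xs ! 0) (xs ! 1))"
  using arith_rel_subst[of "[\<lambda>xs. npair (xs ! 0) (xs ! 1)]"
    "\<lambda>xs. P (nfst (xs ! 0)) (nsnd (xs ! 0))" 2] assms
  by (simp add: arith_pred_def arith_map_computable computable_fun_npair computable_fun_nth)

lemma arith_fun_graphI:
  assumes "arith_pred (\<lambda>w. f (nfst w) = nsnd w)"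
  shows "arith_fun f"
proof -
  have "arith_rel (Suc 1) (\<lambda>xs. f (xs ! 0) = xs ! 1)"
    using arith_rel2_npair[OF assms] by (simp add: numeral_2_eq_2)
  then show ?thesis
    unfolding arith_fun_def arith_map_def by (rule arith_rel_cong) (auto simp: length_Suc_conv)
qed

lemma arith_pred_ex [arith_intros]:
  assumes "arith_pred (\<lambda>z. P (nfst z) (nsnd z))"
  shows "arith_pred (\<lambda>x. \<exists>y. P x y)"
proof -
  have "arith_rel (Suc 1) (\<lambda>xs. P (xs ! 0) (xs ! 1))"
    using arith_rel2_npair[OF assms] by (simp add: numeral_2_eq_2)
  from arith_rel_ex[OF this] show ?thesis
    unfolding arith_pred_def by (rule arith_rel_cong) (auto simp: length_Suc_conv)
qed

lemma arith_pred_all [arith_intros]: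
  "arith_pred (\<lambda>z. P (nfst z) (nsnd z)) \<Longrightarrow> arith_pred (\<lambda>x. \<forall>y. P x y)"
  using arith_pred_not[OF arith_pred_ex[OF arith_pred_not], of P] by simp

lemma arith_pred_ball [arith_intros]:
  "arith_pred (\<lambda>z. nsnd z \<in> S (nfst z)) \<Longrightarrow> arith_pred (\<lambda>z. P (nfst z) (nsnd z)) \<Longrightarrow>
    arith_pred (\<lambda>x. \<forall>y\<in>S x. P x y)"
  unfolding Ball_def by (intro arith_intros)

lemma arith_pred_bex [arith_intros]:
  "arith_pred (\<lambda>z. nsnd z \<in> S (nfst z)) \<Longrightarrow> arith_pred (\<lambda>z. P (nfst z) (nsnd z)) \<Longrightarrow>
    arith_pred (\<lambda>x. \<exists>y\<in>S x. P x y)"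
  unfolding Bex_def by (intro arith_intros)

lemma nfst_eq_iff: "nfst z = x \<longleftrightarrow> (\<exists>y. z = npair x y)"
  and nsnd_eq_iff: "nsnd z = y \<longleftrightarrow> (\<exists>x. z = npair x y)"
  by (metis nfst_npair nsnd_npair npair_nfst_nsnd)+

lemma arith_nfst: "arith_fun nfst" and arith_nsnd: "arith_fun nsnd"
proof -
  have "arith_rel (Suc 2) (\<lambda>xs. xs ! 0 = npair (xs ! 1) (xs ! 2))"
    and "arith_rel (Suc 2) (\<lambda>xs. xs ! 0 = npair (xs ! 2) (xs ! 1))"
    by (intro arith_rel_computable computable_rel_eq computable_fun_npair computable_fun_nth; simp)+
  note graphs = this[THEN arith_rel_ex, unfolded numeral_2_eq_2]
  show "arith_fun nfst" unfolding arith_fun_def arith_map_def One_nat_def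
    by (rule arith_rel_cong[OF graphs(1)]) (auto simp: length_Suc_conv nfst_eq_iff)
  show "arith_fun nsnd" unfolding arith_fun_def arith_map_def One_nat_def
    by (rule arith_rel_cong[OF graphs(2)]) (auto simp: length_Suc_conv nsnd_eq_iff)
qed

lemmas arith_fun_nfst [arith_intros] = arith_fun_comp[OF arith_nfst]
  and arith_fun_nsnd [arith_intros] = arith_fun_comp[OF arith_nsnd]

lemma arith_pred_le [arith_intros]:
  assumes "arith_fun f" "arith_fun g"
  shows "arith_pred (\<lambda>z. f z \<le> g z)"
proof -
  have "arith_pred (\<lambda>z. f z - g z = 0)" using assms by (intro arith_intros)
  then show ?thesis by simp
qed

lemma arith_pred_less [arith_intros]: "arith_fun f \<Longrightarrow> arith_fun g \<Longrightarrow> arith_pred (\<lambda>z. f z < g z)"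
  unfolding Suc_le_eq[symmetric] by (intro arith_intros)

lemma mod_eq_iff_ex_quotient: "a mod b = v \<longleftrightarrow> (\<exists>q. a = b * q + v) \<and> (v < b \<or> b = 0)"
  for a b v :: nat
proof
  assume "a mod b = v"
  then show "(\<exists>q. a = b * q + v) \<and> (v < b \<or> b = 0)"
    using mult_div_mod_eq[of b a] by (intro conjI exI[of _ "a div b"]) auto
qed auto

lemma arith_fun_mod [arith_intros]:
  assumes "arith_fun f" "arith_fun g"
  shows "arith_fun (\<lambda>z. f z mod g z)"
  by (rule arith_fun_graphI, unfold mod_eq_iff_ex_quotient)
    (intro arith_intros assms[THEN arith_fun_comp])

lemma div_eq_iff_bounds: "a div b = v \<longleftrightarrow> (if b = 0 then v = 0 else b * v \<le> a \<and> a < b * Suc v)"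
  for a b v :: nat
  by (auto intro: div_nat_eqI dividend_less_times_div)

lemma arith_fun_div [arith_intros]:
  assumes "arith_fun f" "arith_fun g"
  shows "arith_fun (\<lambda>z. f z div g z)"
  by (rule arith_fun_graphI, unfold div_eq_iff_bounds if_bool_eq_conj)
    (intro arith_intros assms[THEN arith_fun_comp])

lemma arith_pred_comp2:
  "arith_pred (\<lambda>w. P (nfst w) (nsnd w)) \<Longrightarrow> arith_fun f \<Longrightarrow> arith_fun g \<Longrightarrow>
    arith_pred (\<lambda>z. P (f z) (g z))"
  using arith_pred_comp[of "\<lambda>w. P (nfst w) (nsnd w)" "\<lambda>z. npair (f z) (g z)"]
  by (simp add: arith_fun_npair)

lemma arith_fun_Least:
  assumes "arith_pred (\<lambda>w. P (nfst w) (nsnd w))" and exists: "\<And>z. \<exists>n. P z n"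
  shows "arith_fun (\<lambda>z. LEAST n. P z n)"
proof (rule arith_fun_graphI)
  have Least_eq_iff: "(LEAST n. P z n) = v \<longleftrightarrow> P z v \<and> (\<forall>m. m < v \<longrightarrow> \<not> P z m)" for z v
    using exists[of z] LeastI_ex[of "P z"] not_less_Least[of _ "P z"] Least_equality[of "P z" v]
    by (metis not_le)
  show "arith_pred (\<lambda>w. (LEAST n. P (nfst w) n) = nsnd w)"
    unfolding Least_eq_iff by (intro arith_intros arith_pred_comp2[OF assms(1)])
qed

lemma arith_fun_the:
  assumes "arith_pred (\<lambda>w. F (nfst w) = Some (nsnd w))"
  shows "arith_fun (\<lambda>z. the (F z))"
proof (rule arith_fun_graphI)
  have the_eq_iff: "the x = v \<longleftrightarrow> x = Some v \<or> (\<forall>u. x \<noteq> Some u) \<and> v = the None" for x and v :: nat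
    by (cases x) auto
  show "arith_pred (\<lambda>w. the (F (nfst w)) = nsnd w)"
    unfolding the_eq_iff by (intro arith_intros arith_pred_comp2[OF assms])
qed

lemma arith_pred_all_less:
  fixes n :: nat
  assumes "\<And>i. i < n \<Longrightarrow> arith_pred (P i)"
  shows "arith_pred (\<lambda>z. \<forall>i<n. P i z)"
  using assms
proof (induction n)
  case 0
  have "arith_pred (\<lambda>z. z = z)" by (intro arith_intros)
  then show ?case by simp
next
  case (Suc n)
  then have "arith_pred (\<lambda>z. P n z \<and> (\<forall>i<n. P i z))" by (intro arith_pred_conj) auto
  then show ?case by (simp add: All_less_Suc)
qed

subsection \<open>Partial recursive functions have arithmetical graphs\<close>

definition goedel_beta :: "nat \<Rightarrow> nat \<Rightarrow> nat" where
  "goedel_beta w i = nfst w mod (1 + Suc i * nsnd w)"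

lemma arith_fun_goedel_beta [arith_intros]:
  "arith_fun f \<Longrightarrow> arith_fun g \<Longrightarrow> arith_fun (\<lambda>z. goedel_beta (f z) (g z))"
  unfolding goedel_beta_def by (intro arith_intros)

lemma coprime_goedel_moduli:
  fixes d :: nat
  assumes "i < j" "(j - i) dvd d"
  shows "coprime (1 + Suc i * d) (1 + Suc j * d)"
proof -
  have "gcd d (Suc i * d + 1) = gcd d 1" by (rule gcd_add_mult)
  then have "coprime (1 + Suc i * d) d"
    by (simp only: coprime_iff_gcd_eq_1 add.commute gcd.commute gcd_1_nat One_nat_def gcd_Suc_0)
  moreover from this have "coprime (1 + Suc i * d) (j - i)"
    using assms(2) by (meson coprime_divisors dvd_refl)
  ultimately have "coprime (1 + Suc i * d) ((j - i) * d)"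
    by simp
  moreover have "1 + Suc j * d = (1 + Suc i * d) + (j - i) * d"
    using assms(1) by (auto simp: algebra_simps diff_mult_distrib2)
  ultimately show ?thesis by (metis coprime_iff_gcd_eq_1 gcd_add2)
qed

lemma goedel_beta_exists: "\<exists>w. \<forall>i\<le>n. goedel_beta w i = s i"
proof -
  define M where "M = Suc n + (\<Sum>i\<le>n. s i)"
  define m where "m = (\<lambda>i. 1 + Suc i * fact M)"
  have coprime: "coprime (m i) (m j)" if "i < j" "j \<le> n" for i j
    unfolding m_def using that by (intro coprime_goedel_moduli dvd_fact) (auto simp: M_def)
  have "\<exists>x. \<forall>i\<in>{..n}. [x = s i] (mod m i)"
  proof (rule chinese_remainder_nat)
    show "\<forall>i\<in>{..n}. \<forall>j\<in>{..n}. i \<noteq> j \<longrightarrow> coprime (m i) (m j)"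
      using coprime by (metis atMost_iff coprime_commute linorder_neqE_nat)
  qed simp
  then obtain x where x: "\<And>i. i \<le> n \<Longrightarrow> [x = s i] (mod m i)" by auto
  have "goedel_beta (npair x (fact M)) i = s i" if "i \<le> n" for i
  proof -
    have "s i \<le> (\<Sum>i\<le>n. s i)" using that by (intro member_le_sum) auto
    then have "s i < M" by (simp add: M_def)
    also have "M \<le> fact M" by (rule fact_ge_self)
    also have "fact M \<le> m i" by (simp add: m_def)
    finally have "s i < m i" .
    with x[OF that] show ?thesis by (simp add: goedel_beta_def m_def cong_def)
  qed
  then show ?thesis by blast
qed

definition arith_graph :: "nat \<Rightarrow> (nat list \<Rightarrow> nat option) \<Rightarrow> bool" where
  "arith_graph k F \<longleftrightarrow> (\<forall>hs v. length hs = k \<longrightarrow> (\<forall>h\<in>set hs. arith_fun h) \<longrightarrow> arith_fun v \<longrightarrow>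
    arith_pred (\<lambda>z. F (map (\<lambda>h. h z) hs) = Some (v z)))"

lemma arith_graphD:
  assumes "arith_graph k F" "length gs + length hs = k"
    and gs: "\<forall>g\<in>set gs. arith_fun g" and hs: "\<forall>h\<in>set hs. arith_fun h"
    and "arith_fun p" "arith_fun v"
  shows "arith_pred (\<lambda>z. F (map (\<lambda>g. g z) gs @ map (\<lambda>h. h (p z)) hs) = Some (v z))"
proof -
  have "\<forall>h\<in>set (gs @ map (\<lambda>h z. h (p z)) hs). arith_fun h"
    using gs hs arith_fun_comp[OF _ \<open>arith_fun p\<close>] by auto
  then have "arith_pred (\<lambda>z. F (map (\<lambda>h. h z) (gs @ map (\<lambda>h z. h (p z)) hs)) = Some (v z))"
    using assms(1,2,6) unfolding arith_graph_def by (simp del: map_append)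
  then show ?thesis by (simp add: comp_def)
qed

lemma those_eq_Some_iff:
  "those xs = Some ys \<longleftrightarrow> length ys = length xs \<and> (\<forall>i<length xs. xs ! i = Some (ys ! i))"
proof (induction xs arbitrary: ys)
  case (Cons x xs)
  show ?case
  proof (cases ys)
    case (Cons y zs)
    then show ?thesis using Cons.IH[of zs]
      by (auto split: option.splits simp: All_less_Suc2)
  qed (auto split: option.splits)
qed auto

lemma bind_those_eq_Some_iff_goedel_beta:
  "Option.bind (those xs) f = Some y \<longleftrightarrow> (\<exists>w. (\<forall>i<length xs. xs ! i = Some (goedel_beta w i)) \<and>
    f (map (goedel_beta w) [0..<length xs]) = Some y)" (is "?L \<longleftrightarrow> (\<exists>w. ?R w)")
proof
  assume ?L
  then obtain ys where ys: "length ys = length xs" "\<forall>i<length xs. xs ! i = Some (ys ! i)"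
    "f ys = Some y"
    by (auto simp: bind_eq_Some_conv those_eq_Some_iff)
  obtain w where w: "\<forall>i\<le>length xs. goedel_beta w i = ys ! i" using goedel_beta_exists by metis
  then have "map (goedel_beta w) [0..<length xs] = ys"
    using ys(1) by (auto intro!: nth_equalityI)
  with w ys have "?R w" by simp
  then show "\<exists>w. ?R w" ..
next
  assume "\<exists>w. ?R w"
  then obtain w where w: "?R w" ..
  then have "those xs = Some (map (goedel_beta w) [0..<length xs])"
    by (simp add: those_eq_Some_iff)
  with w show ?L by simp
qed

lemma rec_nat_bind_eq_Some_iff_goedel_beta:
  "rec_nat r0 (\<lambda>n r. Option.bind r (step n)) m = Some y \<longleftrightarrow> (\<exists>w. r0 = Some (goedel_beta w 0) \<and>
    (\<forall>n<m. step n (goedel_beta w n) = Some (goedel_beta w (Suc n))) \<and> goedel_beta w m = y)"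
  (is "?r m = Some y \<longleftrightarrow> (\<exists>w. ?R w)")
proof
  assume y: "?r m = Some y"
  have defined: "?r n \<noteq> None" if "n \<le> m" for n
    using that
  proof (induction n rule: inc_induct)
    case base
    show ?case using y by simp
  next
    case (step n)
    then show ?case by (cases "?r n") auto
  qed
  obtain w where "\<And>n. n \<le> m \<Longrightarrow> goedel_beta w n = the (?r n)"
    using goedel_beta_exists[of m "\<lambda>n. the (?r n)"] by blast
  with defined have r: "?r n = Some (goedel_beta w n)" if "n \<le> m" for n using that by simp
  have "step n (goedel_beta w n) = Some (goedel_beta w (Suc n))" if "n < m" for n
    using r[of n] r[of "Suc n"] that by simp
  with r[of 0] r[of m] y have "?R w" by simp
  then show "\<exists>w. ?R w" ..
next
  assume "\<exists>w. ?R w"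
  then obtain w where w: "?R w" ..
  have "n \<le> m \<Longrightarrow> ?r n = Some (goedel_beta w n)" for n
    by (induction n) (simp_all add: w)
  with w show "?r m = Some y" by simp
qed

lemma minimization_eq_Some_iff:
  fixes f :: "nat \<Rightarrow> nat option"
  shows "(if \<exists>n. f n = Some 0 \<and> (\<forall>m<n. f m \<noteq> None)
      then Some (LEAST n. f n = Some 0) else None) = Some y
    \<longleftrightarrow> f y = Some 0 \<and> (\<forall>m<y. \<exists>u. f m = Some u \<and> u \<noteq> 0)" (is "?L \<longleftrightarrow> ?R")
proof
  assume ?L
  then obtain n where n: "f n = Some 0" "\<forall>m<n. f m \<noteq> None"
    and y: "y = (LEAST n. f n = Some 0)" by (auto split: if_splits)
  have "y \<le> n" unfolding y using n(1) by (rule Least_le)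
  moreover have "f y = Some 0" unfolding y using n(1) by (rule LeastI)
  moreover have "f m \<noteq> Some 0" if "m < y" for m using that not_less_Least unfolding y by blast
  ultimately show ?R using n(2) by (metis less_le_trans option.exhaust)
next
  assume R: ?R
  then have "(LEAST n. f n = Some 0) = y"
    by (intro Least_equality) (blast, metis linorder_not_less option.inject)
  moreover have "\<exists>n. f n = Some 0 \<and> (\<forall>m<n. f m \<noteq> None)"
    using R by (intro exI[of _ y]) auto
  ultimately show ?L by simp
qed

lemma arith_graph_comp:
  assumes f: "arith_graph (length gs) f" and gs: "\<forall>g\<in>set gs. arith_graph k g"
  shows "arith_graph k (\<lambda>xs. Option.bind (those (map (\<lambda>g. g xs) gs)) f)"
  unfolding arith_graph_def
proof (intro allI impI)
  fix hs v assume hs: "length hs = k" "\<forall>h\<in>set hs. arith_fun h" and v: "arith_fun v"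
  have "arith_pred (\<lambda>z. (gs ! i) (map (\<lambda>h. h (nfst z)) hs) = Some (goedel_beta (nsnd z) i))"
    if "i < length gs" for i
    using arith_graphD[of k "gs ! i" "[]" hs nfst "\<lambda>z. goedel_beta (nsnd z) i"] gs hs that
    by (simp add: arith_intros arith_nfst arith_nsnd)
  moreover have "arith_pred (\<lambda>z.
      f (map (goedel_beta (nsnd z)) [0..<length gs]) = Some (v (nfst z)))"
    using arith_graphD[OF f, of "map (\<lambda>i z. goedel_beta (nsnd z) i) [0..<length gs]" "[]" nfst
      "\<lambda>z. v (nfst z)"]
      v[THEN arith_fun_comp, OF arith_nfst]
    by (auto simp: comp_def arith_intros arith_nfst arith_nsnd)
  ultimately show "arith_pred (\<lambda>z.
      Option.bind (those (map (\<lambda>g. g (map (\<lambda>h. h z) hs)) gs)) f = Some (v z))"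
    unfolding bind_those_eq_Some_iff_goedel_beta
    by (intro arith_pred_ex arith_pred_conj) (auto intro: arith_pred_all_less)
qed

lemma arith_graph_prim_rec:
  assumes f: "arith_graph k f" and g: "arith_graph (k + 2) g"
  shows "arith_graph (k + 1) (\<lambda>xs. rec_nat (f (tl xs))
    (\<lambda>n r. Option.bind r (\<lambda>v. g (n # v # tl xs))) (hd xs))"
  unfolding arith_graph_def
proof (intro allI impI)
  fix hs v assume len: "length hs = k + 1" and arith: "\<forall>h\<in>set hs. arith_fun h" and v: "arith_fun v"
  obtain h0 hs' where hs: "hs = h0 # hs'" "length hs' = k" using len by (cases hs) auto
  have h0: "arith_fun h0" and hs': "\<forall>h\<in>set hs'. arith_fun h" using arith hs by auto
  have "arith_pred (\<lambda>z. f (map (\<lambda>h. h (nfst z)) hs') = Some (goedel_beta (nsnd z) 0))"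
    using arith_graphD[OF f, of "[]" hs' nfst "\<lambda>z. goedel_beta (nsnd z) 0"] hs(2) hs'
    by (simp add: arith_intros arith_nfst arith_nsnd)
  moreover have "arith_pred (\<lambda>z. g (nsnd z # goedel_beta (nsnd (nfst z)) (nsnd z) #
      map (\<lambda>h. h (nfst (nfst z))) hs') = Some (goedel_beta (nsnd (nfst z)) (Suc (nsnd z))))"
    using arith_graphD[OF g, of "[nsnd, \<lambda>z. goedel_beta (nsnd (nfst z)) (nsnd z)]" hs'
      "\<lambda>z. nfst (nfst z)"
        "\<lambda>z. goedel_beta (nsnd (nfst z)) (Suc (nsnd z))"] hs(2) hs'
    by (simp add: arith_intros arith_nfst arith_nsnd)
  ultimately show "arith_pred (\<lambda>z. rec_nat (f (tl (map (\<lambda>h. h z) hs)))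
      (\<lambda>n r. Option.bind r (\<lambda>v. g (n # v # tl (map (\<lambda>h. h z) hs))))
        (hd (map (\<lambda>h. h z) hs)) = Some (v z))"
    unfolding hs list.map list.sel rec_nat_bind_eq_Some_iff_goedel_beta
    by (intro arith_intros h0[THEN arith_fun_comp] v[THEN arith_fun_comp])
qed

lemma arith_graph_minimization:
  assumes f: "arith_graph (k + 1) f"
  shows "arith_graph k (\<lambda>xs. if \<exists>n. f (n # xs) = Some 0 \<and> (\<forall>m<n. f (m # xs) \<noteq> None)
    then Some (LEAST n. f (n # xs) = Some 0) else None)"
  unfolding arith_graph_def
proof (intro allI impI)
  fix hs v assume hs: "length hs = k" "\<forall>h\<in>set hs. arith_fun h" and v: "arith_fun v"
  have "arith_pred (\<lambda>z. f (v z # map (\<lambda>h. h z) hs) = Some 0)"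
    using arith_graphD[OF f, of "[v]" hs "\<lambda>z. z" "\<lambda>z. 0"] hs v by (simp add: arith_intros)
  moreover have "arith_pred (\<lambda>z.
      f (nsnd (nfst z) # map (\<lambda>h. h (nfst (nfst z))) hs) = Some (nsnd z))"
    using arith_graphD[OF f, of "[\<lambda>z. nsnd (nfst z)]" hs "\<lambda>z. nfst (nfst z)" nsnd] hs
    by (simp add: arith_intros arith_nfst arith_nsnd)
  ultimately show "arith_pred (\<lambda>z. (if \<exists>n. f (n # map (\<lambda>h. h z) hs) = Some 0 \<and>
      (\<forall>m<n. f (m # map (\<lambda>h. h z) hs) \<noteq> None)
      then Some (LEAST n. f (n # map (\<lambda>h. h z) hs) = Some 0) else None) = Some (v z))"
    unfolding minimization_eq_Some_iff by (intro arith_intros v[THEN arith_fun_comp])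
qed

theorem arith_graph_partrec: "partrec k F \<Longrightarrow> arith_graph k F"
proof (induction rule: partrec.induct)
  case (zero k)
  show ?case unfolding arith_graph_def by (auto intro: arith_intros)
next
  case succ
  show ?case unfolding arith_graph_def by (auto simp: length_Suc_conv intro!: arith_intros)
next
  case (proj i k)
  then show ?case unfolding arith_graph_def by (auto intro!: arith_intros)
next
  case (comp gs f k)
  then show ?case by (intro arith_graph_comp) auto
qed (rule arith_graph_prim_rec arith_graph_minimization; assumption)+

section \<open>Arithmetical functions with rational and real values\<close>

abbreviation rat_of_code :: "nat \<Rightarrow> rat" where "rat_of_code \<equiv> nat_to_rat_surj"

lemma ex_rat_of_code: "\<exists>c. rat_of_code c = q"
  using surj_nat_to_rat_surj by (metis surjD)

definition arith_rat :: "(nat \<Rightarrow> rat) \<Rightarrow> bool" where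
  "arith_rat q \<longleftrightarrow> (\<exists>f g h. arith_fun f \<and> arith_fun g \<and> arith_fun h \<and>
     (\<forall>z. q z = (of_nat (f z) - of_nat (g z)) / of_nat (Suc (h z))))"

lemma arith_ratI:
  assumes "arith_fun f" "arith_fun g" "arith_fun h"
    "\<And>z. q z = (of_nat (f z) - of_nat (g z)) / of_nat (Suc (h z))"
  shows "arith_rat q"
  using assms unfolding arith_rat_def by blast

lemma arith_ratE:
  assumes "arith_rat q"
  obtains f g h where "arith_fun f" "arith_fun g" "arith_fun h"
    "\<And>z. q z = (of_nat (f z) - of_nat (g z)) / of_nat (Suc (h z))"
  using assms unfolding arith_rat_def by blast

lemma arith_rat_comp: "arith_rat q \<Longrightarrow> arith_fun f \<Longrightarrow> arith_rat (\<lambda>z. q (f z))"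
  by (elim arith_ratE, rule arith_ratI, (erule (1) arith_fun_comp)+) simp

lemma of_nat_Suc_mult: "(of_nat (Suc (m * n + m + n)) :: rat) = of_nat (Suc m) * of_nat (Suc n)"
  by (simp add: algebra_simps)

lemma arith_rat_add [arith_intros]:
  assumes "arith_rat q" "arith_rat r"
  shows "arith_rat (\<lambda>z. q z + r z)"
proof -
  obtain f g h where q: "arith_fun f" "arith_fun g" "arith_fun h"
    "\<And>z. q z = (of_nat (f z) - of_nat (g z)) / of_nat (Suc (h z))"
    using arith_ratE[OF assms(1)] by blast
  obtain f' g' h' where r: "arith_fun f'" "arith_fun g'" "arith_fun h'"
    "\<And>z. r z = (of_nat (f' z) - of_nat (g' z)) / of_nat (Suc (h' z))"
    using arith_ratE[OF assms(2)] by blast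
  show ?thesis
  proof (rule arith_ratI)
    show "q z + r z = (of_nat (f z * Suc (h' z) + f' z * Suc (h z))
        - of_nat (g z * Suc (h' z) + g' z * Suc (h z)))
        / of_nat (Suc (h z * h' z + h z + h' z))" for z
      unfolding q r of_nat_Suc_mult of_nat_add of_nat_mult
      by (simp add: divide_simps del: of_nat_Suc) (simp add: algebra_simps)
  qed (intro arith_intros q r)+
qed

lemma arith_rat_mult [arith_intros]:
  assumes "arith_rat q" "arith_rat r"
  shows "arith_rat (\<lambda>z. q z * r z)"
proof -
  obtain f g h where q: "arith_fun f" "arith_fun g" "arith_fun h"
    "\<And>z. q z = (of_nat (f z) - of_nat (g z)) / of_nat (Suc (h z))"
    using arith_ratE[OF assms(1)] by blast
  obtain f' g' h' where r: "arith_fun f'" "arith_fun g'" "arith_fun h'"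
    "\<And>z. r z = (of_nat (f' z) - of_nat (g' z)) / of_nat (Suc (h' z))"
    using arith_ratE[OF assms(2)] by blast
  show ?thesis
  proof (rule arith_ratI)
    show "q z * r z = (of_nat (f z * f' z + g z * g' z) - of_nat (f z * g' z + g z * f' z))
        / of_nat (Suc (h z * h' z + h z + h' z))" for z
      unfolding q r of_nat_Suc_mult of_nat_add of_nat_mult
      by (simp add: divide_simps del: of_nat_Suc) (simp add: algebra_simps)
  qed (intro arith_intros q r)+
qed

lemma arith_rat_uminus [arith_intros]: "arith_rat q \<Longrightarrow> arith_rat (\<lambda>z. - q z)"
  by (erule arith_ratE, rule arith_ratI, assumption, assumption, assumption)
    (simp add: minus_divide_left)

lemma arith_rat_diff [arith_intros]: "arith_rat q \<Longrightarrow> arith_rat r \<Longrightarrow> arith_rat (\<lambda>z. q z - r z)"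
  using arith_rat_add[OF _ arith_rat_uminus, of q r] by simp

lemma arith_rat_of_nat [arith_intros]: "arith_fun f \<Longrightarrow> arith_rat (\<lambda>z. of_nat (f z))"
  by (rule arith_ratI[of f "\<lambda>z. 0" "\<lambda>z. 0"]) (auto intro: arith_intros)

lemma arith_rat_inverse [arith_intros]:
  assumes "arith_rat q"
  shows "arith_rat (\<lambda>z. inverse (q z))"
proof -
  obtain f g h where q: "arith_fun f" "arith_fun g" "arith_fun h"
    "\<And>z. q z = (of_nat (f z) - of_nat (g z)) / of_nat (Suc (h z))"
    using arith_ratE[OF assms] by blast
  define d where "d = (\<lambda>z. (f z - g z) + (g z - f z))"
  have arith_d: "arith_fun d" unfolding d_def by (intro arith_intros q)
  show ?thesis
  proof (rule arith_ratI)
    show "inverse (q z) = (of_nat (Suc (h z) * f z)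
        - of_nat (Suc (h z) * g z)) / of_nat (Suc (d z * d z - 1))" for z
    proof (cases "f z = g z")
      case False
      then have "d z \<noteq> 0" by (auto simp: d_def)
      then have "Suc (d z * d z - 1) = d z * d z" by simp
      moreover have "(of_nat (d z) * of_nat (d z) :: rat)
          = (of_nat (f z) - of_nat (g z)) * (of_nat (f z) - of_nat (g z))"
        by (cases "f z \<le> g z") (auto simp: d_def of_nat_diff algebra_simps)
      ultimately have "(of_nat (Suc (d z * d z - 1)) :: rat)
          = (of_nat (f z) - of_nat (g z)) * (of_nat (f z) - of_nat (g z))"
        by (simp only: of_nat_mult)
      moreover have "(of_nat (f z) - of_nat (g z) :: rat) \<noteq> 0" using False by simp
      ultimately show ?thesis
        unfolding q of_nat_mult
        by (simp add: divide_simps del: of_nat_Suc) (simp add: algebra_simps)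
    qed (simp add: q)
  qed (intro arith_intros q arith_d)+
qed

lemma arith_rat_divide [arith_intros]: "arith_rat q \<Longrightarrow> arith_rat r \<Longrightarrow> arith_rat (\<lambda>z. q z / r z)"
  unfolding divide_inverse by (intro arith_intros)

lemma of_int_int_decode:
  "(of_int (int_decode a) :: 'a :: ring_1)
    = of_nat ((1 - a mod 2) * (a div 2)) - of_nat (a mod 2 * Suc (a div 2))"
proof (cases "even a")
  case False
  then have "a mod 2 = 1" by presburger
  with False show ?thesis by (simp add: int_decode_def sum_decode_def)
qed (simp add: int_decode_def sum_decode_def)

lemma arith_rat_rat_of_code [arith_intros]:
  assumes "arith_fun c"
  shows "arith_rat (\<lambda>z. rat_of_code (c z))"
proof -
  have "rat_of_code (c z) = of_int (int_decode (nfst (c z))) / of_int (int_decode (nsnd (c z)))"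
    for z
    by (simp add: nat_to_rat_surj_def nfst_def nsnd_def case_prod_unfold
      Fract_of_int_quotient Let_def)
  then show ?thesis unfolding of_int_int_decode by (simp only:) (intro arith_intros assms)
qed

lemma arith_rat_const [arith_intros]: "arith_rat (\<lambda>z. q)"
proof -
  obtain c where "rat_of_code c = q" using ex_rat_of_code by blast
  with arith_rat_rat_of_code[OF arith_fun_const[of c]] show ?thesis by simp
qed

lemma arith_rat_power2 [arith_intros]: "arith_fun f \<Longrightarrow> arith_rat (\<lambda>z. 2 ^ f z)"
  using arith_rat_of_nat[OF arith_fun_power2] by simp

lemma arith_pred_rat_le [arith_intros]:
  assumes "arith_rat q" "arith_rat r"
  shows "arith_pred (\<lambda>z. q z \<le> r z)"
proof -
  obtain f g h where fgh: "arith_fun f" "arith_fun g" "arith_fun h"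
    "\<And>z. r z - q z = (of_nat (f z) - of_nat (g z)) / of_nat (Suc (h z))"
    using arith_ratE[OF arith_rat_diff[OF assms(2,1)]] by blast
  have "q z \<le> r z \<longleftrightarrow> g z \<le> f z" for z
  proof -
    have "q z \<le> r z \<longleftrightarrow> 0 \<le> r z - q z" by simp
    also have "\<dots> \<longleftrightarrow> g z \<le> f z" unfolding fgh by (simp add: zero_le_divide_iff del: of_nat_Suc)
    finally show ?thesis .
  qed
  then show ?thesis by (simp only:) (intro arith_intros fgh)
qed

lemma arith_pred_rat_less [arith_intros]:
  "arith_rat q \<Longrightarrow> arith_rat r \<Longrightarrow> arith_pred (\<lambda>z. q z < r z)"
  unfolding not_le[symmetric] by (intro arith_intros)

lemma arith_pred_rat_eq [arith_intros]:
  "arith_rat q \<Longrightarrow> arith_rat r \<Longrightarrow> arith_pred (\<lambda>z. q z = r z)"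
  unfolding order.eq_iff by (intro arith_intros)

lemma arith_pred_all_rat [arith_intros]:
  assumes "arith_pred (\<lambda>w. P (nfst w) (rat_of_code (nsnd w)))"
  shows "arith_pred (\<lambda>z. \<forall>q. P z q)"
proof -
  have "(\<forall>q. P z q) \<longleftrightarrow> (\<forall>c. P z (rat_of_code c))" for z by (metis ex_rat_of_code)
  then show ?thesis by (simp only:) (intro arith_pred_all assms)
qed

lemma arith_pred_ex_rat [arith_intros]:
  "arith_pred (\<lambda>w. P (nfst w) (rat_of_code (nsnd w))) \<Longrightarrow> arith_pred (\<lambda>z. \<exists>q. P z q)"
  using arith_pred_not[OF arith_pred_all_rat[OF arith_pred_not], of P] by simp

definition arith_real :: "(nat \<Rightarrow> real) \<Rightarrow> bool" where
  "arith_real x \<longleftrightarrow> arith_pred (\<lambda>w. x (nfst w) < of_rat (rat_of_code (nsnd w)))"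

lemma arith_realI: "arith_pred (\<lambda>w. x (nfst w) < of_rat (rat_of_code (nsnd w))) \<Longrightarrow> arith_real x"
  by (simp add: arith_real_def)

lemma arith_pred_real_less_code:
  "arith_real x \<Longrightarrow> arith_fun f \<Longrightarrow> arith_fun c \<Longrightarrow> arith_pred (\<lambda>z. x (f z) < of_rat (rat_of_code (c z)))"
  unfolding arith_real_def
  by (rule arith_pred_comp2[where P = "\<lambda>y c. x y < of_rat (rat_of_code c)"])

lemma arith_real_comp:
  assumes "arith_real x" "arith_fun f"
  shows "arith_real (\<lambda>z. x (f z))"
  by (intro arith_realI arith_pred_real_less_code[OF assms(1)] arith_fun_comp[OF assms(2)]
      arith_nfst arith_nsnd)

lemma arith_pred_real_less_rat [arith_intros]:
  assumes "arith_real x" "arith_rat q"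
  shows "arith_pred (\<lambda>z. x z < of_rat (q z))"
proof -
  have "x z < of_rat (q z) \<longleftrightarrow> (\<exists>c. rat_of_code c = q z \<and> x z < of_rat (rat_of_code c))" for z
    by (metis ex_rat_of_code)
  then show ?thesis
    by (simp only:)
      (intro arith_intros arith_pred_real_less_code[OF assms(1)] arith_rat_comp[OF assms(2)])
qed

lemma arith_pred_real_less [arith_intros]:
  assumes x: "arith_real x" and y: "arith_real y"
  shows "arith_pred (\<lambda>z. x z < y z)"
proof -
  have "x z < y z \<longleftrightarrow> (\<exists>q. x z < of_rat q \<and> \<not> y z < of_rat q)" for z
    by (metis less_le_not_le not_less of_rat_dense less_le_trans)
  then show ?thesis
    by (simp only:) (intro arith_intros x[THEN arith_real_comp] y[THEN arith_real_comp])
qed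

lemma arith_pred_real_le [arith_intros]:
  "arith_real x \<Longrightarrow> arith_real y \<Longrightarrow> arith_pred (\<lambda>z. x z \<le> y z)"
  unfolding not_less[symmetric] by (intro arith_intros)

lemma arith_pred_real_eq [arith_intros]:
  "arith_real x \<Longrightarrow> arith_real y \<Longrightarrow> arith_pred (\<lambda>z. x z = y z)"
  unfolding order.eq_iff by (intro arith_intros)

lemma arith_real_of_rat [arith_intros]:
  assumes "arith_rat q"
  shows "arith_real (\<lambda>z. of_rat (q z))"
  by (rule arith_realI, unfold of_rat_less) (intro arith_intros assms[THEN arith_rat_comp])

lemma arith_real_0 [arith_intros]: "arith_real (\<lambda>z. 0)"
  and arith_real_1 [arith_intros]: "arith_real (\<lambda>z. 1)"
  and arith_real_numeral [arith_intros]: "arith_real (\<lambda>z. numeral n)"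
  using arith_real_of_rat[OF arith_rat_const[of 0]] arith_real_of_rat[OF arith_rat_const[of 1]]
    arith_real_of_rat[OF arith_rat_const[of "numeral n"]] by simp_all

lemma arith_real_add [arith_intros]:
  assumes x: "arith_real x" and y: "arith_real y"
  shows "arith_real (\<lambda>z. x z + y z)"
proof -
  have less_iff: "a + b < real_of_rat q \<longleftrightarrow> (\<exists>p. a < of_rat p \<and> b < of_rat (q - p))" for a b q
  proof
    assume "a + b < real_of_rat q"
    then obtain p where "a < of_rat p" "of_rat p < of_rat q - b"
      using of_rat_dense[of a "of_rat q - b"] by auto
    then show "\<exists>p. a < of_rat p \<and> b < of_rat (q - p)" by (intro exI[of _ p]) (simp add: of_rat_diff)
  qed (auto simp: of_rat_diff)
  show ?thesis
    by (rule arith_realI, unfold less_iff)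
      (intro arith_intros x[THEN arith_real_comp] y[THEN arith_real_comp])
qed

lemma arith_real_uminus [arith_intros]:
  assumes x: "arith_real x"
  shows "arith_real (\<lambda>z. - x z)"
proof -
  have less_iff: "- a < of_rat q \<longleftrightarrow> of_rat (- q) < a" for a :: real and q
    by (auto simp: of_rat_minus)
  show ?thesis
    by (rule arith_realI, unfold less_iff) (intro arith_intros x[THEN arith_real_comp])
qed

lemma arith_real_diff [arith_intros]: "arith_real x \<Longrightarrow> arith_real y \<Longrightarrow> arith_real (\<lambda>z. x z - y z)"
  using arith_real_add[OF _ arith_real_uminus, of x y] by simp

lemma arith_real_max [arith_intros]:
  assumes x: "arith_real x" and y: "arith_real y"
  shows "arith_real (\<lambda>z. max (x z) (y z))"
  by (rule arith_realI, unfold max_less_iff_conj)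
    (intro arith_intros x[THEN arith_real_comp] y[THEN arith_real_comp])

lemma abs_eq_max_uminus: "\<bar>a\<bar> = max a (- a)" for a :: real
  by simp

lemma arith_real_abs [arith_intros]: "arith_real x \<Longrightarrow> arith_real (\<lambda>z. \<bar>x z\<bar>)"
  unfolding abs_eq_max_uminus by (intro arith_intros)

lemma arith_real_square:
  assumes x: "arith_real x"
  shows "arith_real (\<lambda>z. (x z)\<^sup>2)"
proof -
  have less_iff: "a\<^sup>2 < of_rat q \<longleftrightarrow> (\<exists>p. \<bar>a\<bar> < of_rat p \<and> p * p \<le> q)" for a :: real and q
  proof
    assume "a\<^sup>2 < of_rat q"
    then have "\<bar>a\<bar> < sqrt (of_rat q)" by (simp add: real_less_rsqrt)
    then obtain p where p: "\<bar>a\<bar> < of_rat p" "real_of_rat p < sqrt (of_rat q)"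
      using of_rat_dense by blast
    have "0 \<le> real_of_rat p" using p(1) by linarith
    then have "(real_of_rat p)\<^sup>2 \<le> of_rat q"
      using p(2) by (metis less_eq_real_def real_sqrt_le_iff real_sqrt_unique)
    with p(1) show "\<exists>p. \<bar>a\<bar> < of_rat p \<and> p * p \<le> q"
      by (intro exI[of _ p]) (simp add: power2_eq_square of_rat_less_eq flip: of_rat_mult)
  next
    assume "\<exists>p. \<bar>a\<bar> < of_rat p \<and> p * p \<le> q"
    then obtain p where p: "\<bar>a\<bar> < of_rat p" "p * p \<le> q" by blast
    have "a\<^sup>2 = \<bar>a\<bar> * \<bar>a\<bar>" by (simp add: power2_eq_square)
    also have "\<dots> < of_rat p * of_rat p" using p(1) by (intro mult_strict_mono') auto
    also have "\<dots> \<le> of_rat q" using p(2) by (simp add: of_rat_less_eq flip: of_rat_mult)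
    finally show "a\<^sup>2 < of_rat q" .
  qed
  show ?thesis
    by (rule arith_realI, unfold less_iff) (intro arith_intros x[THEN arith_real_comp])
qed

lemma arith_real_mult [arith_intros]:
  assumes x: "arith_real x" and y: "arith_real y"
  shows "arith_real (\<lambda>z. x z * y z)"
proof -
  have less_iff: "a * b < real_of_rat q \<longleftrightarrow> (a + b)\<^sup>2 - (a - b)\<^sup>2 < of_rat (4 * q)" for a b q
    by (simp add: power2_eq_square algebra_simps of_rat_mult)
  show ?thesis
    by (rule arith_realI, unfold less_iff)
      (intro arith_intros arith_real_square x[THEN arith_real_comp] y[THEN arith_real_comp])
qed

definition rat_sup :: "rat set \<Rightarrow> real" where
  "rat_sup A = (if A \<noteq> {} \<and> (\<exists>b. \<forall>q\<in>A. q \<le> b) then Sup (of_rat ` A) else 0)"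

lemma rat_sup_eqI:
  assumes lower: "\<And>q. of_rat q < x \<Longrightarrow> q \<in> A" and upper: "\<And>q. q \<in> A \<Longrightarrow> of_rat q \<le> x"
  shows "rat_sup A = x"
proof -
  obtain q where "of_rat q < x" using of_rat_dense[of "x - 1" x] by auto
  with lower have nonempty: "A \<noteq> {}" by blast
  obtain b where "x < of_rat b" using of_rat_dense[of x "x + 1"] by auto
  with upper have "\<forall>q\<in>A. q \<le> b"
    by (metis less_le_not_le of_rat_less_eq order.strict_trans1 less_imp_le)
  moreover have "Sup (of_rat ` A) = x"
  proof (rule cSup_eq_non_empty)
    show "x \<le> y" if y: "\<And>a. a \<in> of_rat ` A \<Longrightarrow> a \<le> y" for y
      using lower y by (metis imageI not_le of_rat_dense)
  qed (use nonempty upper in auto)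
  ultimately show ?thesis using nonempty by (auto simp: rat_sup_def)
qed

lemma rat_sup_less_iff:
  "rat_sup A < of_rat r \<longleftrightarrow> (if A \<noteq> {} \<and> (\<exists>b. \<forall>q\<in>A. q \<le> b) then \<exists>b<r. \<forall>q\<in>A. q \<le> b else 0 < r)"
proof (cases "A \<noteq> {} \<and> (\<exists>b. \<forall>q\<in>A. q \<le> b)")
  case True
  then obtain b where "A \<noteq> {}" "\<forall>q\<in>A. q \<le> b" by blast
  then have nonempty: "real_of_rat ` A \<noteq> {}" and bdd: "bdd_above (real_of_rat ` A)"
    by (auto simp: of_rat_less_eq intro!: bdd_aboveI2[of _ _ "of_rat b"])
  have "Sup (real_of_rat ` A) < of_rat r \<longleftrightarrow> (\<exists>b<r. \<forall>q\<in>A. q \<le> b)"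
  proof
    assume "Sup (real_of_rat ` A) < of_rat r"
    then obtain b where b_bounds: "Sup (real_of_rat ` A) < of_rat b" "real_of_rat b < of_rat r"
      using of_rat_dense by blast
    have "q \<le> b" if "q \<in> A" for q
    proof -
      have "real_of_rat q \<le> of_rat b" using cSUP_upper[OF that bdd] b_bounds(1) by linarith
      then show ?thesis by (simp only: of_rat_less_eq)
    qed
    with b_bounds(2) show "\<exists>b<r. \<forall>q\<in>A. q \<le> b" by (auto simp: of_rat_less)
  next
    assume "\<exists>b<r. \<forall>q\<in>A. q \<le> b"
    then obtain b where b_bounds: "b < r" "\<forall>q\<in>A. q \<le> b" by blast
    have "Sup (real_of_rat ` A) \<le> of_rat b"
      using nonempty b_bounds(2) by (auto intro!: cSup_least simp: of_rat_less_eq)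
    with b_bounds(1) show "Sup (real_of_rat ` A) < of_rat r"
      by (meson of_rat_less order.strict_trans1)
  qed
  with True show ?thesis by (simp add: rat_sup_def)
next
  case False
  then show ?thesis unfolding rat_sup_def by (simp only: if_False zero_less_of_rat_iff)
qed

lemma arith_real_rat_sup [arith_intros]:
  assumes "arith_pred (\<lambda>w. P (nfst w) (rat_of_code (nsnd w)))"
  shows "arith_real (\<lambda>z. rat_sup {q. P z q})"
proof (rule arith_realI)
  have P: "arith_pred (\<lambda>z. P (f z) (rat_of_code (c z)))" if "arith_fun f" "arith_fun c" for f c
    using that by (rule arith_pred_comp2[OF assms])
  show "arith_pred (\<lambda>w. rat_sup {q. P (nfst w) q} < of_rat (rat_of_code (nsnd w)))"
    unfolding rat_sup_less_iff if_bool_eq_conj Ball_def mem_Collect_eq Collect_empty_eq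
    by (intro arith_intros P)
qed

section \<open>Rational normed spaces, dense embeddings and completions\<close>

context rat_normed_space
begin

abbreviation distance :: "'a \<Rightarrow> 'a \<Rightarrow> real" where
  "distance x y \<equiv> nrm (add x (scale (-1) y))"

lemmas closed [simp, intro] = zero_closed add_closed scale_closed

lemma norm_zero: "nrm zero = 0"
  using norm_eq_zero by simp

lemma scale_zero: "x \<in> V \<Longrightarrow> scale 0 x = zero"
  using norm_scale[of x 0] norm_eq_zero[of "scale 0 x"] by simp

lemma scale_right_zero: "scale q zero = zero"
  using norm_scale[of zero q] norm_eq_zero[of "scale q zero"] norm_zero by simp

lemma add_neg: "x \<in> V \<Longrightarrow> add x (scale (-1) x) = zero"
  using scale_add_left[of x 1 "-1"] by (simp add: scale_one scale_zero)

lemma neg_neg: "x \<in> V \<Longrightarrow> scale (-1) (scale (-1) x) = x"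
  by (simp add: scale_scale scale_one)

lemma add_add_add_commute:
  assumes "a \<in> V" "b \<in> V" "c \<in> V" "d \<in> V"
  shows "add (add a b) (add c d) = add (add a c) (add b d)"
proof -
  have "add b (add c d) = add c (add b d)"
    using assms by (metis add_assoc add_commute)
  with assms show ?thesis by (simp add: add_assoc)
qed

lemma distance_self: "x \<in> V \<Longrightarrow> distance x x = 0"
  by (simp add: add_neg norm_zero)

lemma distance_zero: "x \<in> V \<Longrightarrow> distance x zero = nrm x"
  by (simp add: scale_right_zero add_zero)

lemma distance_nonneg: "x \<in> V \<Longrightarrow> y \<in> V \<Longrightarrow> 0 \<le> distance x y"
  by (simp add: norm_nonneg)

lemma distance_scale:
  assumes "x \<in> V" "y \<in> V"
  shows "distance (scale q x) (scale q y) = \<bar>of_rat q\<bar> * distance x y"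
proof -
  have "add (scale q x) (scale (-1) (scale q y)) = scale q (add x (scale (-1) y))"
    using assms by (simp add: scale_add_right scale_scale)
  with assms show ?thesis by (simp add: norm_scale)
qed

lemma distance_scale_scalar:
  assumes "x \<in> V"
  shows "distance (scale p x) (scale q x) = \<bar>of_rat p - of_rat q\<bar> * nrm x"
proof -
  have "add (scale p x) (scale (-1) (scale q x)) = scale (p - q) x"
    using assms scale_add_left[of x p "-q"] by (simp add: scale_scale)
  with assms show ?thesis by (simp add: norm_scale of_rat_diff)
qed

lemma distance_commute:
  assumes "x \<in> V" "y \<in> V"
  shows "distance x y = distance y x"
proof -
  have "distance x y = distance (scale (-1) y) (scale (-1) x)"
    using assms by (simp add: neg_neg add_commute)
  also have "\<dots> = distance y x" using distance_scale[OF assms(2,1), of "-1"] by simp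
  finally show ?thesis .
qed

lemma distance_triangle:
  assumes "x \<in> V" "y \<in> V" "w \<in> V"
  shows "distance x w \<le> distance x y + distance y w"
proof -
  have "add (add x (scale (-1) y)) (add y (scale (-1) w))
      = add (add x (scale (-1) w)) (add (scale (-1) y) y)"
    using assms add_add_add_commute[of x "scale (-1) y" "scale (-1) w" y] by (simp add: add_commute)
  also have "\<dots> = add x (scale (-1) w)"
    using assms by (simp add: add_commute[of "scale (-1) y" y] add_neg add_zero)
  finally show ?thesis
    using norm_triangle[of "add x (scale (-1) y)" "add y (scale (-1) w)"] assms by simp
qed

lemma distance_add:
  assumes "x \<in> V" "y \<in> V" "x' \<in> V" "y' \<in> V"
  shows "distance (add x y) (add x' y') \<le> distance x x' + distance y y'"
proof -
  have "add (add x y) (scale (-1) (add x' y'))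
      = add (add x (scale (-1) x')) (add y (scale (-1) y'))"
    using assms by (simp add: scale_add_right add_add_add_commute)
  with assms show ?thesis by (simp add: norm_triangle)
qed

lemma abs_norm_diff_le_distance:
  assumes "x \<in> V" "y \<in> V"
  shows "\<bar>nrm x - nrm y\<bar> \<le> distance x y"
  using distance_triangle[of x y zero] distance_triangle[of y x zero] distance_commute[of x y] assms
  by (simp add: distance_zero abs_le_iff)

lemma tendsto_distance_add:
  assumes V: "\<And>n. s n \<in> V" "\<And>n. t n \<in> V" "\<And>n. s' n \<in> V" "\<And>n. t' n \<in> V"
    and lim: "((\<lambda>n. distance (s n) (s' n)) \<longlongrightarrow> 0) F" "((\<lambda>n. distance (t n) (t' n)) \<longlongrightarrow> 0) F"
  shows "((\<lambda>n. distance (add (s n) (t n)) (add (s' n) (t' n))) \<longlongrightarrow> 0) F"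
  by (rule Lim_null_comparison[OF always_eventually tendsto_add_zero[OF lim]])
    (use V in \<open>simp add: distance_add norm_nonneg\<close>)

lemma tendsto_distance_scale:
  assumes V: "\<And>n. s n \<in> V" "\<And>n. t n \<in> V"
    and lim: "((\<lambda>n. distance (s n) (t n)) \<longlongrightarrow> 0) F" "((\<lambda>n. nrm (t n)) \<longlongrightarrow> c) F"
    and pq: "((\<lambda>n. real_of_rat (p n)) \<longlongrightarrow> r) F" "((\<lambda>n. real_of_rat (q n)) \<longlongrightarrow> r) F"
  shows "((\<lambda>n. distance (scale (p n) (s n)) (scale (q n) (t n))) \<longlongrightarrow> 0) F"
proof (rule Lim_null_comparison[OF always_eventually])
  let ?b = "\<lambda>n. \<bar>real_of_rat (p n)\<bar> * distance (s n) (t n)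
    + \<bar>real_of_rat (p n) - of_rat (q n)\<bar> * nrm (t n)"
  have "(?b \<longlongrightarrow> \<bar>r\<bar> * 0 + \<bar>r - r\<bar> * c) F" by (intro tendsto_intros lim pq)
  then show "(?b \<longlongrightarrow> 0) F" by simp
  show "\<forall>n. norm (distance (scale (p n) (s n)) (scale (q n) (t n))) \<le> ?b n"
  proof
    fix n
    show "norm (distance (scale (p n) (s n)) (scale (q n) (t n))) \<le> ?b n"
      using V[of n] distance_triangle[of "scale (p n) (s n)" "scale (p n) (t n)"
        "scale (q n) (t n)"]
      by (simp add: norm_nonneg distance_scale distance_scale_scalar del: abs_of_rat)
  qed
qed

end

locale dense_embedding = rat_normed_space V add scale zero nrm
  for V :: "'a set" and add scale zero nrm +
  fixes K :: "'k::topological_space set"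
    and J :: "'a \<Rightarrow> 'k \<Rightarrow> real"
  assumes embed_continuous: "x \<in> V \<Longrightarrow> continuous_on K (J x)"
    and embed_add: "x \<in> V \<Longrightarrow> y \<in> V \<Longrightarrow> t \<in> K \<Longrightarrow> J (add x y) t = J x t + J y t"
    and embed_scale: "x \<in> V \<Longrightarrow> t \<in> K \<Longrightarrow> J (scale q x) t = of_rat q * J x t"
    and norm_le_iff: "x \<in> V \<Longrightarrow> nrm x \<le> c \<longleftrightarrow> (\<forall>t\<in>K. \<bar>J x t\<bar> \<le> c)"
    and embed_dense: "continuous_on K F \<Longrightarrow> 0 < \<epsilon> \<Longrightarrow> \<exists>x\<in>V. \<forall>t\<in>K. \<bar>J x t - F t\<bar> < \<epsilon>"
begin

lemma embed_diff: "x \<in> V \<Longrightarrow> y \<in> V \<Longrightarrow> t \<in> K \<Longrightarrow> J (add x (scale (-1) y)) t = J x t - J y t"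
  by (simp add: embed_add embed_scale)

lemma distance_le_iff:
  "x \<in> V \<Longrightarrow> y \<in> V \<Longrightarrow> distance x y \<le> c \<longleftrightarrow> (\<forall>t\<in>K. \<bar>J x t - J y t\<bar> \<le> c)"
  by (simp add: norm_le_iff embed_diff)

lemma abs_embed_diff_le_distance:
  "x \<in> V \<Longrightarrow> y \<in> V \<Longrightarrow> t \<in> K \<Longrightarrow> \<bar>J x t - J y t\<bar> \<le> distance x y"
  using distance_le_iff[of x y "distance x y"] by blast

end

lemma (in rat_normed_space) rat_normed_space_cong:
  assumes "\<And>q x. x \<in> V \<Longrightarrow> scale' q x = scale q x" "\<And>x. x \<in> V \<Longrightarrow> nrm' x = nrm x"
  shows "rat_normed_space V add scale' zero nrm'"
  by unfold_locales
    (erule (1) add_commute |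
      simp add: assms add_assoc add_zero add_inverse scale_add_right scale_add_left scale_scale
        scale_one norm_nonneg norm_eq_zero norm_scale norm_triangle)+

lemma (in dense_embedding) dense_embedding_cong:
  assumes "\<And>q x. x \<in> V \<Longrightarrow> scale' q x = scale q x" "\<And>x. x \<in> V \<Longrightarrow> nrm' x = nrm x"
  shows "dense_embedding V add scale' zero nrm' K J"
proof -
  interpret scaled: rat_normed_space V add scale' zero nrm'
    by (rule rat_normed_space_cong) (simp_all add: assms)
  show ?thesis
    by unfold_locales
      (simp_all add: assms embed_continuous embed_add embed_scale norm_le_iff embed_dense)
qed

lemma (in dense_embedding) dense_embedding_homeomorphic:
  fixes K' :: "'l::topological_space set"
  assumes "K' homeomorphic K"
  obtains J' where "dense_embedding V add scale zero nrm K' J'"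
proof -
  obtain h h' where "homeomorphism K' K h h'" using assms unfolding homeomorphic_def by blast
  then have h: "continuous_on K' h" "continuous_on K h'" "h ` K' = K" "h' ` K = K'"
    "\<And>t. t \<in> K' \<Longrightarrow> h' (h t) = t" "\<And>s. s \<in> K \<Longrightarrow> h (h' s) = s"
    by (auto simp: homeomorphism_def)
  have "dense_embedding V add scale zero nrm K' (\<lambda>x t. J x (h t))"
  proof unfold_locales
    show "continuous_on K' (\<lambda>t. J x (h t))" if "x \<in> V" for x
      by (rule continuous_on_compose2[OF embed_continuous[OF that] h(1)]) (simp add: h(3))
    show "nrm x \<le> c \<longleftrightarrow> (\<forall>t\<in>K'. \<bar>J x (h t)\<bar> \<le> c)" if "x \<in> V" for x c
      using norm_le_iff[OF that, of c] h(3) by auto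
    show "\<exists>x\<in>V. \<forall>t\<in>K'. \<bar>J x (h t) - F t\<bar> < \<epsilon>" if "continuous_on K' F" "0 < \<epsilon>" for F \<epsilon>
    proof -
      have "continuous_on K (\<lambda>s. F (h' s))"
        by (rule continuous_on_compose2[OF that(1) h(2)]) (simp add: h(4))
      from embed_dense[OF this that(2)] show ?thesis using h(3,5) by fastforce
    qed
  qed (use h(3) in \<open>auto simp: embed_add embed_scale\<close>)
  then show ?thesis by (rule that)
qed

subsection \<open>The completion of a presented space\<close>

locale presented_space = rat_normed_space "points P" "padd P" "pscale P" zero "pnorm P"
  for P :: presentation and zero :: nat
begin

abbreviation limit_class :: "(nat \<Rightarrow> nat) \<Rightarrow> (nat \<Rightarrow> nat) set" where
  "limit_class s \<equiv> null_rel P `` {s}"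

lemma cauchy_seqs_points: "s \<in> cauchy_seqs P \<Longrightarrow> s n \<in> points P"
  by (auto simp: cauchy_seqs_def)

lemma cauchy_seqs_iff:
  "s \<in> cauchy_seqs P \<longleftrightarrow> (\<forall>n. s n \<in> points P) \<and>
    ((\<lambda>p. pdist P (s (fst p)) (s (snd p))) \<longlongrightarrow> 0) (sequentially \<times>\<^sub>F sequentially)"
proof -
  have "(\<forall>e>0. \<exists>M. \<forall>m\<ge>M. \<forall>n\<ge>M. pdist P (s m) (s n) < e) \<longleftrightarrow>
      ((\<lambda>p. pdist P (s (fst p)) (s (snd p))) \<longlongrightarrow> 0) (sequentially \<times>\<^sub>F sequentially)"
    if "\<forall>n. s n \<in> points P"
    using that by (auto simp: tendsto_iff eventually_prod_sequentially pdist_def norm_nonneg) blast+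
  then show ?thesis unfolding cauchy_seqs_def by auto
qed

lemma null_rel_iff:
  "(s, t) \<in> null_rel P \<longleftrightarrow>
    s \<in> cauchy_seqs P \<and> t \<in> cauchy_seqs P \<and> (\<lambda>n. distance (s n) (t n)) \<longlonglongrightarrow> 0"
  by (simp add: null_rel_def pdist_def)

lemma cauchy_seqs_const: "x \<in> points P \<Longrightarrow> (\<lambda>n. x) \<in> cauchy_seqs P"
  by (simp add: cauchy_seqs_iff pdist_def distance_self)

lemma tendsto_norm_cauchy_seqs:
  assumes s: "s \<in> cauchy_seqs P"
  shows "(\<lambda>n. pnorm P (s n)) \<longlonglongrightarrow> lim (\<lambda>n. pnorm P (s n))"
proof -
  have "Cauchy (\<lambda>n. pnorm P (s n))"
  proof (rule metric_CauchyI)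
    fix \<epsilon> :: real assume "\<epsilon> > 0"
    then obtain M where "\<forall>m\<ge>M. \<forall>n\<ge>M. pdist P (s m) (s n) < \<epsilon>"
      using s by (auto simp: cauchy_seqs_def)
    then have "\<forall>m\<ge>M. \<forall>n\<ge>M. dist (pnorm P (s m)) (pnorm P (s n)) < \<epsilon>"
      using abs_norm_diff_le_distance cauchy_seqs_points[OF s]
      by (metis dist_real_def le_less_trans pdist_def)
    then show "\<exists>M. \<forall>m\<ge>M. \<forall>n\<ge>M. dist (pnorm P (s m)) (pnorm P (s n)) < \<epsilon>" ..
  qed
  then show ?thesis by (simp add: Cauchy_convergent_iff convergent_LIMSEQ_iff)
qed

lemma equiv_null_rel: "equiv (cauchy_seqs P) (null_rel P)"
proof (rule equivI)
  show "null_rel P \<subseteq> cauchy_seqs P \<times> cauchy_seqs P" by (auto simp: null_rel_def)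
  show "refl_on (cauchy_seqs P) (null_rel P)"
    by (rule refl_onI) (simp add: null_rel_iff distance_self cauchy_seqs_points)
  show "sym (null_rel P)"
    by (rule symI) (simp add: null_rel_iff distance_commute cauchy_seqs_points)
  show "trans (null_rel P)"
  proof (rule transI)
    fix s t u assume st: "(s, t) \<in> null_rel P" and tu: "(t, u) \<in> null_rel P"
    have "(\<lambda>n. distance (s n) (t n) + distance (t n) (u n)) \<longlonglongrightarrow> 0"
      using st tu by (intro tendsto_add_zero) (simp_all add: null_rel_iff)
    then have "(\<lambda>n. distance (s n) (u n)) \<longlonglongrightarrow> 0"
      by (rule Lim_null_comparison[rotated])
        (use st tu in \<open>auto intro!: always_eventually distance_triangle simp: norm_nonneg
          null_rel_iff cauchy_seqs_points\<close>)
    with st tu show "(s, u) \<in> null_rel P" by (simp add: null_rel_iff)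
  qed
qed

lemma cauchy_seqs_add:
  assumes "s \<in> cauchy_seqs P" "t \<in> cauchy_seqs P"
  shows "(\<lambda>n. padd P (s n) (t n)) \<in> cauchy_seqs P"
  using assms unfolding cauchy_seqs_iff pdist_def by (auto intro!: tendsto_distance_add)

lemma null_rel_add:
  assumes "(s, s') \<in> null_rel P" "(t, t') \<in> null_rel P"
  shows "(\<lambda>n. padd P (s n) (t n), \<lambda>n. padd P (s' n) (t' n)) \<in> null_rel P"
  using assms unfolding null_rel_iff
  by (auto intro!: tendsto_distance_add cauchy_seqs_add simp: cauchy_seqs_points)

lemma cauchy_seqs_scale:
  assumes s: "s \<in> cauchy_seqs P" and q: "(\<lambda>n. real_of_rat (q n)) \<longlonglongrightarrow> r"
  shows "(\<lambda>n. pscale P (q n) (s n)) \<in> cauchy_seqs P"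
proof -
  have fst: "filterlim fst sequentially (sequentially \<times>\<^sub>F sequentially)"
    and snd: "filterlim snd sequentially (sequentially \<times>\<^sub>F sequentially)"
    by (rule filterlim_fst filterlim_snd)+
  have "((\<lambda>p. distance (pscale P (q (fst p)) (s (fst p))) (pscale P (q (snd p)) (s (snd p)))) \<longlongrightarrow> 0)
      (sequentially \<times>\<^sub>F sequentially)"
    using s cauchy_seqs_points[OF s] filterlim_compose[OF q fst] filterlim_compose[OF q snd]
      filterlim_compose[OF tendsto_norm_cauchy_seqs[OF s] snd]
    by (intro tendsto_distance_scale) (auto simp: cauchy_seqs_iff pdist_def)
  then show ?thesis using cauchy_seqs_points[OF s] by (simp add: cauchy_seqs_iff pdist_def)
qed

lemma null_rel_scale:
  assumes st: "(s, t) \<in> null_rel P"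
    and q: "(\<lambda>n. real_of_rat (q n)) \<longlonglongrightarrow> r" and p: "(\<lambda>n. real_of_rat (p n)) \<longlonglongrightarrow> r"
  shows "(\<lambda>n. pscale P (q n) (s n), \<lambda>n. pscale P (p n) (t n)) \<in> null_rel P"
  using st q p unfolding null_rel_iff
  by (auto intro!: tendsto_distance_scale[OF _ _ _ tendsto_norm_cauchy_seqs q p] cauchy_seqs_scale
      simp: cauchy_seqs_points)

lemma limit_class_eqI: "(s, t) \<in> null_rel P \<Longrightarrow> limit_class s = limit_class t"
  using equiv_class_eq[OF equiv_null_rel] .

lemma limit_class_self: "s \<in> cauchy_seqs P \<Longrightarrow> s \<in> limit_class s"
  using equiv_class_self[OF equiv_null_rel] .

lemma someI_limit_class:
  assumes "s \<in> cauchy_seqs P"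
  shows "(s, SOME t. t \<in> limit_class s) \<in> null_rel P"
  using someI[of "\<lambda>t. t \<in> limit_class s", OF limit_class_self[OF assms]] by simp

lemma limit_class_in_completion:
  "s \<in> cauchy_seqs P \<Longrightarrow> limit_class s \<in> ncarrier (banach_completion P)"
  by (simp add: banach_completion_def quotientI)

lemma completionE:
  assumes "X \<in> ncarrier (banach_completion P)"
  obtains s where "s \<in> cauchy_seqs P" "X = limit_class s"
  using assms by (auto simp: banach_completion_def elim: quotientE)

lemma nadd_limit_class:
  assumes "s \<in> cauchy_seqs P" "t \<in> cauchy_seqs P"
  shows "nadd (banach_completion P) (limit_class s) (limit_class t)
    = limit_class (\<lambda>n. padd P (s n) (t n))"
proof -
  have "congruent2 (null_rel P) (null_rel P) (\<lambda>s t. limit_class (\<lambda>n. padd P (s n) (t n)))"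
    by (intro congruent2I' limit_class_eqI null_rel_add)
  from UN_equiv_class2[OF equiv_null_rel equiv_null_rel this assms]
  show ?thesis by (simp add: banach_completion_def)
qed

lemma nscale_limit_class:
  assumes s: "s \<in> cauchy_seqs P" and q: "(\<lambda>n. real_of_rat (q n)) \<longlonglongrightarrow> r"
  shows "nscale (banach_completion P) r (limit_class s) = limit_class (\<lambda>n. pscale P (q n) (s n))"
proof -
  have "limit_class (\<lambda>n. pscale P (q' n) (s' n)) = limit_class (\<lambda>n. pscale P (q n) (s n))"
    if "s' \<in> limit_class s" "(\<lambda>n. real_of_rat (q' n)) \<longlonglongrightarrow> r" for s' q'
    using that q by (intro limit_class_eqI[symmetric] null_rel_scale) auto
  then have "(\<Union>s'\<in>limit_class s. \<Union>q'\<in>{q. (\<lambda>n. real_of_rat (q n)) \<longlonglongrightarrow> r}.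
      limit_class (\<lambda>n. pscale P (q' n) (s' n))) = limit_class (\<lambda>n. pscale P (q n) (s n))"
    using limit_class_self[OF s] q by blast
  then show ?thesis by (simp add: banach_completion_def)
qed

lemma nnorm_limit_class:
  assumes s: "s \<in> cauchy_seqs P"
  shows "nnorm (banach_completion P) (limit_class s) = lim (\<lambda>n. pnorm P (s n))"
proof -
  define t where "t = (SOME t. t \<in> limit_class s)"
  have st: "(s, t) \<in> null_rel P" unfolding t_def by (rule someI_limit_class[OF s])
  have "(\<lambda>n. distance (s n) (t n)) \<longlonglongrightarrow> 0" using st by (simp add: null_rel_iff)
  then have "(\<lambda>n. pnorm P (s n) - pnorm P (t n)) \<longlonglongrightarrow> 0"
    by (rule Lim_null_comparison[rotated])
      (use st in \<open>auto simp: null_rel_iff cauchy_seqs_points abs_norm_diff_le_distance\<close>)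
  from tendsto_diff[OF tendsto_norm_cauchy_seqs[OF s] this]
  have "lim (\<lambda>n. pnorm P (t n)) = lim (\<lambda>n. pnorm P (s n))" by (simp add: limI)
  then show ?thesis by (simp add: banach_completion_def t_def)
qed

end

lemma SUP_abs_le_iff:
  fixes f :: "real \<Rightarrow> real"
  assumes "continuous_on {0..1} f"
  shows "(SUP t\<in>{0..1}. \<bar>f t\<bar>) \<le> c \<longleftrightarrow> (\<forall>t\<in>{0..1}. \<bar>f t\<bar> \<le> c)"
proof -
  have "compact ((\<lambda>t. \<bar>f t\<bar>) ` {0..1})"
    using assms by (intro compact_continuous_image continuous_intros) auto
  then have "bdd_above ((\<lambda>t. \<bar>f t\<bar>) ` {0..1})" by (intro bounded_imp_bdd_above compact_imp_bounded)
  then show ?thesis by (subst cSUP_le_iff) auto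
qed

lemma ex_rat_seq_tendsto: "\<exists>q. (\<lambda>n. real_of_rat (q n)) \<longlonglongrightarrow> r"
proof -
  have "r \<in> closure (range real_of_rat)"
    unfolding closure_approachable dist_real_def
  proof (intro allI impI)
    fix e :: real assume "e > 0"
    then obtain q where "r < of_rat q" "of_rat q < r + e" using of_rat_dense[of r "r + e"] by auto
    then show "\<exists>y\<in>range of_rat. \<bar>y - r\<bar> < e" by (intro bexI[of _ "of_rat q"]) auto
  qed
  then obtain x where x: "\<And>n. x n \<in> range real_of_rat" "x \<longlonglongrightarrow> r" by (auto simp: closure_sequential)
  then have "\<forall>n. \<exists>q. x n = of_rat q" by auto
  then obtain q where "\<forall>n. x n = of_rat (q n)"
    using choice[of "\<lambda>n q. x n = real_of_rat q"] by blast
  then have "x = (\<lambda>n. of_rat (q n))" by auto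
  with x(2) show ?thesis by auto
qed

context presented_space
begin

lemma nadd_in_completion:
  assumes "X \<in> ncarrier (banach_completion P)" "Y \<in> ncarrier (banach_completion P)"
  shows "nadd (banach_completion P) X Y \<in> ncarrier (banach_completion P)"
proof -
  obtain s t where "s \<in> cauchy_seqs P" "X = limit_class s" "t \<in> cauchy_seqs P" "Y = limit_class t"
    using assms by (meson completionE)
  then show ?thesis by (simp add: nadd_limit_class limit_class_in_completion cauchy_seqs_add)
qed

lemma constants_dense_in_completion:
  assumes "X \<in> ncarrier (banach_completion P)" and \<epsilon>: "0 < \<epsilon>"
  shows "\<exists>x\<in>points P. nnorm (banach_completion P)
    (nadd (banach_completion P) X (nscale (banach_completion P) (-1) (limit_class (\<lambda>n. x)))) \<le> \<epsilon>"
proof -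
  obtain s where s: "s \<in> cauchy_seqs P" "X = limit_class s" using assms(1) by (rule completionE)
  obtain M where tail: "\<forall>m\<ge>M. \<forall>n\<ge>M. pdist P (s m) (s n) < \<epsilon>"
    using s(1) \<epsilon> by (auto simp: cauchy_seqs_def)
  have x: "s M \<in> points P" using s(1) by (rule cauchy_seqs_points)
  define u where "u = (\<lambda>n. padd P (s n) (pscale P (-1) (s M)))"
  have u: "u \<in> cauchy_seqs P"
    unfolding u_def using x by (intro cauchy_seqs_add s(1) cauchy_seqs_const) simp
  have "lim (\<lambda>n. pnorm P (u n)) \<le> \<epsilon>"
    by (rule LIMSEQ_le_const2[OF tendsto_norm_cauchy_seqs[OF u]])
      (use tail in \<open>auto simp: u_def pdist_def intro: less_imp_le\<close>)
  moreover have "nscale (banach_completion P) (-1) (limit_class (\<lambda>n. s M))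
      = limit_class (\<lambda>n. pscale P (-1) (s M))"
    using nscale_limit_class[OF cauchy_seqs_const[OF x], of "\<lambda>n. -1" "-1"]
    by (simp add: of_rat_minus)
  then have "nadd (banach_completion P) X
      (nscale (banach_completion P) (-1) (limit_class (\<lambda>n. s M))) = limit_class u"
    using s x by (simp add: nadd_limit_class cauchy_seqs_const u_def)
  ultimately show ?thesis using x
    by (intro bexI[of _ "s M"]) (simp_all only: nnorm_limit_class[OF u])
qed

end

locale completion_isometry = presented_space P zero for P zero +
  fixes T :: "(nat \<Rightarrow> nat) set \<Rightarrow> real \<Rightarrow> real"
  assumes bij: "bij_betw T (ncarrier (banach_completion P)) (ncarrier C01)"
    and T_nadd: "X \<in> ncarrier (banach_completion P) \<Longrightarrow> Y \<in> ncarrier (banach_completion P) \<Longrightarrow>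
      T (nadd (banach_completion P) X Y) = nadd C01 (T X) (T Y)"
    and T_nscale: "X \<in> ncarrier (banach_completion P) \<Longrightarrow>
      T (nscale (banach_completion P) c X) = nscale C01 c (T X)"
    and T_nnorm: "X \<in> ncarrier (banach_completion P) \<Longrightarrow>
      nnorm C01 (T X) = nnorm (banach_completion P) X"
begin

abbreviation completion :: "(nat \<Rightarrow> nat) set nspace" where
  "completion \<equiv> banach_completion P"

lemma continuous_on_T: "X \<in> ncarrier completion \<Longrightarrow> continuous_on {0..1} (T X)"
  using bij_betw_apply[OF bij] by (simp add: C01_def)

lemma nnorm_le_iff:
  assumes "X \<in> ncarrier completion"
  shows "nnorm completion X \<le> c \<longleftrightarrow> (\<forall>t\<in>{0..1}. \<bar>T X t\<bar> \<le> c)"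
  using T_nnorm[OF assms] SUP_abs_le_iff[OF continuous_on_T[OF assms]] by (simp add: C01_def)

definition constant_class :: "nat \<Rightarrow> (nat \<Rightarrow> nat) set" where
  "constant_class x = limit_class (\<lambda>n. x)"

lemma
  assumes "x \<in> points P"
  shows constant_class_in_completion: "constant_class x \<in> ncarrier completion"
    and nnorm_constant_class: "nnorm completion (constant_class x) = pnorm P x"
    and nscale_constant_class:
      "nscale completion (of_rat q) (constant_class x) = constant_class (pscale P q x)"
  unfolding constant_class_def using cauchy_seqs_const[OF assms]
  by (simp_all add: limit_class_in_completion nnorm_limit_class
    nscale_limit_class[OF _ tendsto_const])

lemma nadd_constant_class:
  "x \<in> points P \<Longrightarrow> y \<in> points P \<Longrightarrow>
    nadd completion (constant_class x) (constant_class y) = constant_class (padd P x y)"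
  unfolding constant_class_def by (intro nadd_limit_class cauchy_seqs_const)

lemma T_constant_class_dense:
  assumes F: "continuous_on {0..1} F" and \<epsilon>: "0 < \<epsilon>"
  shows "\<exists>x\<in>points P. \<forall>t\<in>{0..1}. \<bar>T (constant_class x) t - F t\<bar> < \<epsilon>"
proof -
  have "restrict F {0..1} \<in> ncarrier C01"
    using F continuous_on_cong[of "{0..1}" "{0..1}" "restrict F {0..1}" F] by (simp add: C01_def)
  then obtain X where X: "restrict F {0..1} = T X" "X \<in> ncarrier completion"
    using bij_betw_imp_surj_on[OF bij] by (auto elim: imageE)
  obtain x where x: "x \<in> points P"
    and near: "nnorm completion (nadd completion X (nscale completion (-1) (constant_class x)))
        \<le> \<epsilon> / 2"
    using constants_dense_in_completion[OF X(2), of "\<epsilon> / 2"] \<epsilon> unfolding constant_class_def by auto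
  let ?Y = "nscale completion (-1) (constant_class x)"
  have Y: "?Y \<in> ncarrier completion"
    using nscale_constant_class[OF x, of "-1"] constant_class_in_completion[of "pscale P (-1) x"] x
    by (simp add: of_rat_minus)
  have "nadd C01 (T X) (nscale C01 (-1) (T (constant_class x))) = T (nadd completion X ?Y)"
    unfolding T_nadd[OF X(2) Y] T_nscale[OF constant_class_in_completion[OF x]] ..
  moreover have "nadd completion X ?Y \<in> ncarrier completion"
    using X(2) Y by (rule nadd_in_completion)
  ultimately have "\<forall>t\<in>{0..1}. \<bar>nadd C01 (T X) (nscale C01 (-1) (T (constant_class x))) t\<bar> \<le> \<epsilon> / 2"
    using nnorm_le_iff near by metis
  then have close: "\<forall>t\<in>{0..1}. \<bar>F t - T (constant_class x) t\<bar> \<le> \<epsilon> / 2"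
    by (simp add: C01_def X(1)[symmetric])
  have "\<bar>T (constant_class x) t - F t\<bar> < \<epsilon>" if "t \<in> {0..1}" for t
    using bspec[OF close that] \<epsilon> by linarith
  with x show ?thesis by blast
qed

lemma dense_embedding_T_constant_class:
  "dense_embedding (points P) (padd P) (pscale P) zero (pnorm P) {0..1} (\<lambda>x. T (constant_class x))"
proof unfold_locales
  show "continuous_on {0..1} (T (constant_class x))" if "x \<in> points P" for x
    by (intro continuous_on_T constant_class_in_completion that)
  show "T (constant_class (padd P x y)) t = T (constant_class x) t + T (constant_class y) t"
    if "x \<in> points P" "y \<in> points P" "t \<in> {0..1}" for x y t
    using T_nadd[of "constant_class x" "constant_class y"] that
    by (simp add: constant_class_in_completion nadd_constant_class C01_def)
  show "T (constant_class (pscale P q x)) t = of_rat q * T (constant_class x) t"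
    if "x \<in> points P" "t \<in> {0..1}" for x q t
    using T_nscale[of "constant_class x" "of_rat q"] that
    by (simp add: constant_class_in_completion nscale_constant_class C01_def)
  show "pnorm P x \<le> c \<longleftrightarrow> (\<forall>t\<in>{0..1}. \<bar>T (constant_class x) t\<bar> \<le> c)" if "x \<in> points P" for x c
    using nnorm_le_iff[of "constant_class x" c] that
    by (simp add: constant_class_in_completion nnorm_constant_class)
qed (rule T_constant_class_dense)

end

lemma (in presented_space) dense_embedding_if_completion_iso:
  assumes "isometrically_isomorphic (banach_completion P) C01"
  shows "\<exists>J. dense_embedding (points P) (padd P) (pscale P) zero (pnorm P) {0..1::real} J"
proof -
  obtain T where "completion_isometry P zero T"
    using assms presented_space_axioms
    unfolding isometrically_isomorphic_def completion_isometry_def completion_isometry_axioms_def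
    by blast
  then show ?thesis using completion_isometry.dense_embedding_T_constant_class by blast
qed

locale presented_embedding =
  dense_embedding "points P" "padd P" "pscale P" zero "pnorm P" "{0..1::real}" J
  for P :: presentation and zero J
begin

sublocale presented_space P zero ..

lemma cauchy_seqs_iff_uniformly_Cauchy:
  "s \<in> cauchy_seqs P \<longleftrightarrow> (\<forall>n. s n \<in> points P) \<and> uniformly_Cauchy_on {0..1} (\<lambda>n. J (s n))"
proof (cases "\<forall>n. s n \<in> points P")
  case s: True
  have "(\<forall>e>0. \<exists>M. \<forall>m\<ge>M. \<forall>n\<ge>M. pdist P (s m) (s n) < e) \<longleftrightarrow> uniformly_Cauchy_on {0..1} (\<lambda>n. J (s n))"
  proof
    assume cauchy: "\<forall>e>0. \<exists>M. \<forall>m\<ge>M. \<forall>n\<ge>M. pdist P (s m) (s n) < e"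
    have dist_le: "dist (J (s m) t) (J (s n) t) \<le> pdist P (s m) (s n)" if "t \<in> {0..1}" for m n t
      using s that by (simp add: dist_real_def pdist_def abs_embed_diff_le_distance)
    show "uniformly_Cauchy_on {0..1} (\<lambda>n. J (s n))"
      unfolding uniformly_Cauchy_on_def using cauchy dist_le by (meson le_less_trans)
  next
    assume uniformly_Cauchy: "uniformly_Cauchy_on {0..1} (\<lambda>n. J (s n))"
    show "\<forall>e>0. \<exists>M. \<forall>m\<ge>M. \<forall>n\<ge>M. pdist P (s m) (s n) < e"
    proof (intro allI impI)
      fix e :: real assume "e > 0"
      then obtain M where "\<forall>t\<in>{0..1}. \<forall>m\<ge>M. \<forall>n\<ge>M. \<bar>J (s m) t - J (s n) t\<bar> < e / 2"
        using uniformly_Cauchy unfolding uniformly_Cauchy_on_def dist_real_def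
        by (meson half_gt_zero)
      then have "pdist P (s m) (s n) \<le> e / 2" if "m \<ge> M" "n \<ge> M" for m n
        unfolding pdist_def using s that by (subst distance_le_iff) (auto intro: less_imp_le)
      with \<open>e > 0\<close> show "\<exists>M. \<forall>m\<ge>M. \<forall>n\<ge>M. pdist P (s m) (s n) < e"
        by (intro exI[of _ M]) fastforce
    qed
  qed
  with s show ?thesis unfolding cauchy_seqs_def by auto
qed (auto simp: cauchy_seqs_def)

definition limit_fun :: "(nat \<Rightarrow> nat) \<Rightarrow> real \<Rightarrow> real" where
  "limit_fun s = (\<lambda>t\<in>{0..1}. lim (\<lambda>n. J (s n) t))"

lemma limit_fun_extensional [simp]: "limit_fun s \<in> extensional {0..1}"
  by (simp add: limit_fun_def)

lemma uniform_limit_limit_fun: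
  assumes s: "s \<in> cauchy_seqs P"
  shows "uniform_limit {0..1} (\<lambda>n. J (s n)) (limit_fun s) sequentially"
proof -
  obtain l where l: "uniform_limit {0..1} (\<lambda>n. J (s n)) l sequentially"
    using s Cauchy_uniformly_convergent
    unfolding cauchy_seqs_iff_uniformly_Cauchy uniformly_convergent_on_def
    by blast
  have "limit_fun s t = l t" if "t \<in> {0..1}" for t
    using limI[OF tendsto_uniform_limitI[OF l that]] that by (simp add: limit_fun_def)
  with l show ?thesis by (subst uniform_limit_cong') auto
qed

lemma tendsto_limit_fun: "s \<in> cauchy_seqs P \<Longrightarrow> t \<in> {0..1} \<Longrightarrow> (\<lambda>n. J (s n) t) \<longlonglongrightarrow> limit_fun s t"
  using tendsto_uniform_limitI[OF uniform_limit_limit_fun] .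

lemma continuous_on_limit_fun: "s \<in> cauchy_seqs P \<Longrightarrow> continuous_on {0..1} (limit_fun s)"
  by (rule uniform_limit_theorem[OF _ uniform_limit_limit_fun])
    (auto intro!: always_eventually embed_continuous simp: cauchy_seqs_points)

lemma limit_fun_eqI:
  assumes "s \<in> cauchy_seqs P" "f \<in> extensional {0..1}" "\<And>t. t \<in> {0..1} \<Longrightarrow> (\<lambda>n. J (s n) t) \<longlonglongrightarrow> f t"
  shows "limit_fun s = f"
  by (rule extensionalityI[of _ "{0..1}"])
    (use assms LIMSEQ_unique[OF tendsto_limit_fun] in auto)

lemma limit_fun_eq_iff:
  assumes s: "s \<in> cauchy_seqs P" and t: "t \<in> cauchy_seqs P"
  shows "limit_fun s = limit_fun t \<longleftrightarrow> (s, t) \<in> null_rel P"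
proof
  assume "(s, t) \<in> null_rel P"
  then have lim: "(\<lambda>n. distance (s n) (t n)) \<longlonglongrightarrow> 0" by (simp add: null_rel_iff)
  show "limit_fun s = limit_fun t"
  proof (rule limit_fun_eqI[OF s])
    fix x :: real assume x: "x \<in> {0..1}"
    have "(\<lambda>n. J (s n) x - J (t n) x) \<longlonglongrightarrow> 0"
      by (rule Lim_null_comparison[OF always_eventually lim])
        (use s t x in \<open>simp add: abs_embed_diff_le_distance cauchy_seqs_points\<close>)
    from tendsto_add[OF this tendsto_limit_fun[OF t x]]
    show "(\<lambda>n. J (s n) x) \<longlonglongrightarrow> limit_fun t x" by simp
  qed simp
next
  assume limits_eq: "limit_fun s = limit_fun t"
  have "uniform_limit {0..1} (\<lambda>n x. J (s n) x - J (t n) x)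
      (\<lambda>x. limit_fun s x - limit_fun t x) sequentially"
    by (intro uniform_limit_minus uniform_limit_limit_fun s t)
  then have "(\<lambda>n. distance (s n) (t n)) \<longlonglongrightarrow> 0"
  proof (intro tendstoI)
    fix \<epsilon> :: real assume \<epsilon>: "\<epsilon> > 0"
    assume "uniform_limit {0..1} (\<lambda>n x. J (s n) x - J (t n) x)
        (\<lambda>x. limit_fun s x - limit_fun t x) sequentially"
    from uniform_limitD[OF this, of "\<epsilon> / 2"] \<epsilon>
    have "\<forall>\<^sub>F n in sequentially. \<forall>x\<in>{0..1}. \<bar>J (s n) x - J (t n) x\<bar> < \<epsilon> / 2"
      by (simp add: limits_eq dist_real_def)
    then show "\<forall>\<^sub>F n in sequentially. dist (distance (s n) (t n)) 0 < \<epsilon>"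
    proof eventually_elim
      case (elim n)
      then have "distance (s n) (t n) \<le> \<epsilon> / 2"
        using s t by (metis distance_le_iff less_imp_le cauchy_seqs_points)
      with \<epsilon> s t show ?case by (simp add: distance_nonneg cauchy_seqs_points)
    qed
  qed
  with s t show "(s, t) \<in> null_rel P" by (simp add: null_rel_iff)
qed

lemma lim_norm_le_iff:
  assumes s: "s \<in> cauchy_seqs P"
  shows "lim (\<lambda>n. pnorm P (s n)) \<le> c \<longleftrightarrow> (\<forall>t\<in>{0..1}. \<bar>limit_fun s t\<bar> \<le> c)"
proof
  note lim = tendsto_norm_cauchy_seqs[OF s]
  assume bounded: "lim (\<lambda>n. pnorm P (s n)) \<le> c"
  show "\<forall>t\<in>{0..1}. \<bar>limit_fun s t\<bar> \<le> c"
  proof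
    fix t :: real assume t: "t \<in> {0..1}"
    have "\<bar>J (s n) t\<bar> \<le> pnorm P (s n)" for n
      using norm_le_iff[OF cauchy_seqs_points[OF s]] t by blast
    then have "\<bar>limit_fun s t\<bar> \<le> lim (\<lambda>n. pnorm P (s n))"
      by (intro LIMSEQ_le[OF tendsto_rabs[OF tendsto_limit_fun[OF s t]] lim]) blast
    with bounded show "\<bar>limit_fun s t\<bar> \<le> c" by simp
  qed
next
  assume bounded: "\<forall>t\<in>{0..1}. \<bar>limit_fun s t\<bar> \<le> c"
  show "lim (\<lambda>n. pnorm P (s n)) \<le> c"
  proof (rule field_le_epsilon)
    fix \<epsilon> :: real assume "\<epsilon> > 0"
    with uniform_limit_limit_fun[OF s]
    have "\<forall>\<^sub>F n in sequentially. \<forall>t\<in>{0..1}. dist (J (s n) t) (limit_fun s t) < \<epsilon>"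
      by (rule uniform_limitD)
    then have "\<forall>\<^sub>F n in sequentially. pnorm P (s n) \<le> c + \<epsilon>"
    proof eventually_elim
      case (elim n)
      have "\<bar>J (s n) t\<bar> \<le> c + \<epsilon>" if "t \<in> {0..1}" for t
        using elim bounded that unfolding dist_real_def by fastforce
      then show ?case using norm_le_iff[OF cauchy_seqs_points[OF s]] by blast
    qed
    then show "lim (\<lambda>n. pnorm P (s n)) \<le> c + \<epsilon>"
      by (intro tendsto_upperbound[OF tendsto_norm_cauchy_seqs[OF s]]) simp_all
  qed
qed

lemma limit_fun_surj:
  assumes f: "f \<in> extensional {0..1}" "continuous_on {0..1} f"
  obtains s where "s \<in> cauchy_seqs P" "limit_fun s = f"
proof -
  have "\<exists>x\<in>points P. \<forall>t\<in>{0..1}. \<bar>J x t - f t\<bar> < inverse (real (Suc n))" for n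
    using embed_dense[OF f(2), of "inverse (real (Suc n))"] by simp
  then obtain s where s: "\<And>n. s n \<in> points P"
    and near: "\<And>n t. t \<in> {0..1} \<Longrightarrow> \<bar>J (s n) t - f t\<bar> < inverse (real (Suc n))"
    by metis
  have lim: "uniform_limit {0..1} (\<lambda>n. J (s n)) f sequentially"
  proof (rule uniform_limitI)
    fix \<epsilon> :: real assume "\<epsilon> > 0"
    then have "\<forall>\<^sub>F n in sequentially. inverse (real (Suc n)) < \<epsilon>"
      by (rule order_tendstoD[OF LIMSEQ_inverse_real_of_nat])
    then show "\<forall>\<^sub>F n in sequentially. \<forall>t\<in>{0..1}. dist (J (s n) t) (f t) < \<epsilon>"
    proof eventually_elim
      case (elim n)
      have "\<bar>J (s n) t - f t\<bar> < \<epsilon>" if "t \<in> {0..1}" for t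
        using near[OF that, of n] elim by linarith
      then show ?case by (simp add: dist_real_def)
    qed
  qed
  then have "s \<in> cauchy_seqs P"
    using s uniformly_convergent_Cauchy
    unfolding cauchy_seqs_iff_uniformly_Cauchy uniformly_convergent_on_def by blast
  moreover from this have "limit_fun s = f"
    using f(1) tendsto_uniform_limitI[OF lim] by (intro limit_fun_eqI)
  ultimately show ?thesis by (rule that)
qed

lemma limit_fun_add:
  assumes s: "s \<in> cauchy_seqs P" and t: "t \<in> cauchy_seqs P"
  shows "limit_fun (\<lambda>n. padd P (s n) (t n)) = (\<lambda>x\<in>{0..1}. limit_fun s x + limit_fun t x)"
proof (rule limit_fun_eqI[OF cauchy_seqs_add[OF s t]])
  fix x :: real assume x: "x \<in> {0..1}"
  have "(\<lambda>n. J (s n) x + J (t n) x) \<longlonglongrightarrow> limit_fun s x + limit_fun t x"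
    by (intro tendsto_add tendsto_limit_fun s t x)
  then show "(\<lambda>n. J (padd P (s n) (t n)) x) \<longlonglongrightarrow> (\<lambda>x\<in>{0..1}. limit_fun s x + limit_fun t x) x"
    using x s t by (simp add: embed_add cauchy_seqs_points)
qed simp

lemma limit_fun_scale:
  assumes s: "s \<in> cauchy_seqs P" and q: "(\<lambda>n. real_of_rat (q n)) \<longlonglongrightarrow> r"
  shows "limit_fun (\<lambda>n. pscale P (q n) (s n)) = (\<lambda>x\<in>{0..1}. r * limit_fun s x)"
proof (rule limit_fun_eqI[OF cauchy_seqs_scale[OF s q]])
  fix x :: real assume x: "x \<in> {0..1}"
  have "(\<lambda>n. of_rat (q n) * J (s n) x) \<longlonglongrightarrow> r * limit_fun s x"
    by (intro tendsto_mult q tendsto_limit_fun s x)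
  then show "(\<lambda>n. J (pscale P (q n) (s n)) x) \<longlonglongrightarrow> (\<lambda>x\<in>{0..1}. r * limit_fun s x) x"
    using x s by (simp add: embed_scale cauchy_seqs_points)
qed simp

definition completion_map :: "(nat \<Rightarrow> nat) set \<Rightarrow> real \<Rightarrow> real" where
  "completion_map X = limit_fun (SOME s. s \<in> X)"

lemma completion_map_limit_class:
  assumes "s \<in> cauchy_seqs P"
  shows "completion_map (limit_class s) = limit_fun s"
  using limit_fun_eq_iff someI_limit_class[OF assms] assms
  unfolding completion_map_def by (metis null_rel_iff)

lemma bij_betw_completion_map:
  "bij_betw completion_map (ncarrier (banach_completion P)) (ncarrier C01)"
  unfolding bij_betw_def
proof
  show "inj_on completion_map (ncarrier (banach_completion P))"
    by (rule inj_onI, elim completionE)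
      (metis completion_map_limit_class limit_fun_eq_iff limit_class_eqI)
  show "completion_map ` ncarrier (banach_completion P) = ncarrier C01"
  proof (intro equalityI subsetI)
    fix f assume "f \<in> completion_map ` ncarrier (banach_completion P)"
    then obtain s where "s \<in> cauchy_seqs P" "f = completion_map (limit_class s)"
      by (auto elim: completionE)
    then show "f \<in> ncarrier C01"
      by (simp add: completion_map_limit_class continuous_on_limit_fun C01_def)
  next
    fix f assume "f \<in> ncarrier C01"
    then obtain s where "s \<in> cauchy_seqs P" "limit_fun s = f"
      using limit_fun_surj[of f] by (auto simp: C01_def)
    then show "f \<in> completion_map ` ncarrier (banach_completion P)"
      by (metis completion_map_limit_class limit_class_in_completion imageI)
  qed
qed

lemma completion_iso_C01: "isometrically_isomorphic (banach_completion P) C01"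
  unfolding isometrically_isomorphic_def
proof (intro exI[of _ completion_map] conjI ballI allI)
  fix X assume "X \<in> ncarrier (banach_completion P)"
  then obtain s where s: "s \<in> cauchy_seqs P" "X = limit_class s" by (rule completionE)
  have "(SUP t\<in>{0..1}. \<bar>limit_fun s t\<bar>) = lim (\<lambda>n. pnorm P (s n))"
    using SUP_abs_le_iff[OF continuous_on_limit_fun[OF s(1)]] lim_norm_le_iff[OF s(1)]
    by (metis antisym order_refl)
  with s show "nnorm C01 (completion_map X) = nnorm (banach_completion P) X"
    by (simp add: completion_map_limit_class nnorm_limit_class C01_def)
  show "completion_map (nscale (banach_completion P) r X) = nscale C01 r (completion_map X)" for r
  proof -
    obtain q where "(\<lambda>n. real_of_rat (q n)) \<longlonglongrightarrow> r" using ex_rat_seq_tendsto by blast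
    with s show ?thesis
      by (simp add: nscale_limit_class completion_map_limit_class cauchy_seqs_scale
        limit_fun_scale C01_def)
  qed
  fix Y assume "Y \<in> ncarrier (banach_completion P)"
  then obtain t where "t \<in> cauchy_seqs P" "Y = limit_class t" by (rule completionE)
  with s show "completion_map (nadd (banach_completion P) X Y)
      = nadd C01 (completion_map X) (completion_map Y)"
    by (simp add: nadd_limit_class completion_map_limit_class cauchy_seqs_add limit_fun_add C01_def)
qed (rule bij_betw_completion_map)

end

lemma completion_iso_C01_iff_dense_embedding:
  assumes "rat_normed_space (points P) (padd P) (pscale P) zero (pnorm P)"
  shows "isometrically_isomorphic (banach_completion P) C01 \<longleftrightarrow>
    (\<exists>J. dense_embedding (points P) (padd P) (pscale P) zero (pnorm P) {0..1::real} J)"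
proof
  assume "isometrically_isomorphic (banach_completion P) C01"
  then show "\<exists>J. dense_embedding (points P) (padd P) (pscale P) zero (pnorm P) {0..1::real} J"
    by (rule presented_space.dense_embedding_if_completion_iso[OF presented_space.intro[OF assms]])
next
  assume "\<exists>J. dense_embedding (points P) (padd P) (pscale P) zero (pnorm P) {0..1::real} J"
  then show "isometrically_isomorphic (banach_completion P) C01"
    using presented_embedding.completion_iso_C01[OF presented_embedding.intro] by blast
qed

section \<open>Definable points of the interval\<close>

locale frame =
  fixes V :: "'a set" and add :: "'a \<Rightarrow> 'a \<Rightarrow> 'a" and scale :: "rat \<Rightarrow> 'a \<Rightarrow> 'a" and nrm :: "'a \<Rightarrow> real"
    and e l r :: 'a
begin

abbreviation sub :: "'a \<Rightarrow> 'a \<Rightarrow> 'a" where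
  "sub f g \<equiv> add f (scale (-1) g)"

text \<open>
  In \<open>C[0,1]\<close>, with \<open>e > 0\<close> and with \<open>{l > 0}\<close> to the left of \<open>{r > 0}\<close>, the following say in turn:
  \<open>\<bar>f\<bar> \<ge> \<delta>\<close>; \<open>f > 0\<close>; \<open>f > g\<close>; the sets \<open>{u > 0}\<close> and \<open>{v > 0}\<close> meet; all zeros of \<open>k\<close> lie in
  \<open>{u > 0}\<close>; some point of \<open>{u > 0}\<close> lies between points of \<open>{v > 0}\<close> and \<open>{w > 0}\<close>; some point of
  \<open>{v > 0}\<close> is less than some point of \<open>{u > 0}\<close>.
\<close>

definition bounded_away :: "rat \<Rightarrow> 'a \<Rightarrow> bool" where
  "bounded_away \<delta> f \<longleftrightarrow> (\<forall>y\<in>V. nrm y + of_rat \<delta> \<le> max (nrm (add f y)) (nrm (sub f y)))"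

definition positive :: "'a \<Rightarrow> bool" where
  "positive f \<longleftrightarrow> (\<exists>\<delta>>0. \<forall>c\<ge>0. bounded_away \<delta> (add f (scale c e)))"

definition above :: "'a \<Rightarrow> 'a \<Rightarrow> bool" where
  "above f g \<longleftrightarrow> positive (sub f g)"

definition meets :: "'a \<Rightarrow> 'a \<Rightarrow> bool" where
  "meets u v \<longleftrightarrow> (\<exists>w\<in>V. \<exists>c>0. above u w \<and> above v w \<and> \<not> above (scale c e) w)"

definition zeros_inside :: "'a \<Rightarrow> 'a \<Rightarrow> bool" where
  "zeros_inside k u \<longleftrightarrow>
    (\<exists>c>0. \<forall>z\<in>V. above z k \<and> above z (scale (-1) k) \<and> above z u \<longrightarrow> above z (scale c e))"

definition between :: "'a \<Rightarrow> 'a \<Rightarrow> 'a \<Rightarrow> bool" where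
  "between u v w \<longleftrightarrow> (\<exists>k\<in>V. meets k v \<and> meets (scale (-1) k) w \<and> zeros_inside k u)"

text \<open>
  \<open>between r l u\<close> holds iff \<open>{u > 0}\<close> reaches to the right of some point of \<open>{r > 0}\<close>, and
  \<open>between l v r\<close> iff \<open>{v > 0}\<close> reaches to the left of some point of \<open>{l > 0}\<close>.
\<close>

definition before :: "'a \<Rightarrow> 'a \<Rightarrow> bool" where
  "before v u \<longleftrightarrow> (\<exists>v'\<in>V. \<exists>u'\<in>V. above v v' \<and> above u u' \<and>
    (\<not> between r l u' \<and> between u' v' r \<or>
     \<not> between l v' r \<and> between v' l u' \<or>
     between l v' r \<and> between r l u'))"

text \<open>
  A bump \<open>u\<close> names the point \<open>sup {u > 0}\<close>.  In \<open>C[0,1]\<close>, \<open>bump_le\<close> compares these points,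
  \<open>bump_value f u\<close> is the value of \<open>f / e\<close> there, and \<open>bump_weight u\<close> the value of \<open>1 / e\<close>.
\<close>

definition bumps :: "'a set" where
  "bumps = {u \<in> V. meets u u}"

definition bump_le :: "'a \<Rightarrow> 'a \<Rightarrow> bool" where
  "bump_le x y \<longleftrightarrow> (\<forall>w\<in>bumps. before w x \<longrightarrow> before w y)"

definition exceeds_left_of :: "'a \<Rightarrow> 'a \<Rightarrow> rat \<Rightarrow> bool" where
  "exceeds_left_of u f c \<longleftrightarrow> (\<exists>w\<in>bumps. \<not> bump_le u w \<and>
    (\<forall>v\<in>bumps. \<not> bump_le v w \<and> bump_le v u \<longrightarrow> meets v (sub f (scale c e))))"

definition bump_value :: "'a \<Rightarrow> 'a \<Rightarrow> real" where
  "bump_value f u = rat_sup {c. exceeds_left_of u f c}"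

definition bump_weight :: "'a \<Rightarrow> real" where
  "bump_weight u = rat_sup {c. \<exists>f\<in>V. nrm f < 1 \<and> of_rat c \<le> bump_value f u}"

end

lemma compact_positive_lower_bound:
  fixes f :: "'a::topological_space \<Rightarrow> real"
  assumes "compact S" "continuous_on S f" "\<And>t. t \<in> S \<Longrightarrow> 0 < f t"
  obtains m where "0 < m" "\<And>t. t \<in> S \<Longrightarrow> m \<le> f t"
proof (cases "S = {}")
  case True
  then show ?thesis using that[of 1] by simp
next
  case False
  then obtain t0 where "t0 \<in> S" "\<And>t. t \<in> S \<Longrightarrow> f t0 \<le> f t"
    using continuous_attains_inf[of S f] assms(1,2) by auto
  then show ?thesis using that[of "f t0"] assms(3) by blast
qed

lemma compact_abs_upper_bound:
  fixes f :: "'a::topological_space \<Rightarrow> real"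
  assumes "compact S" "continuous_on S f"
  obtains b where "0 < b" "\<And>t. t \<in> S \<Longrightarrow> \<bar>f t\<bar> \<le> b"
proof -
  have "bounded (f ` S)" using assms by (intro compact_imp_bounded compact_continuous_image)
  then show ?thesis using that by (auto simp: bounded_pos)
qed

lemma continuous_on_near:
  fixes f :: "real \<Rightarrow> real"
  assumes "continuous_on S f" "t0 \<in> S" "0 < \<epsilon>"
  obtains \<rho> where "0 < \<rho>" "\<And>t. t \<in> S \<Longrightarrow> \<bar>t - t0\<bar> < \<rho> \<Longrightarrow> \<bar>f t - f t0\<bar> < \<epsilon>"
  using assms unfolding continuous_on_iff dist_real_def by blast

lemma ex_peak:
  fixes f :: "real \<Rightarrow> real"
  assumes f: "continuous_on {0..1} f" and t0: "t0 \<in> {0..1}" and "0 < \<eta>"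
    and f_le: "\<And>t. t \<in> {0..1} \<Longrightarrow> \<bar>f t\<bar> \<le> M"
  obtains peak where "continuous_on {0..1} peak" "\<And>t. 0 \<le> peak t" "peak t0 = M"
    "\<And>t. t \<in> {0..1} \<Longrightarrow> \<bar>f t\<bar> + peak t \<le> M + \<bar>f t0\<bar> + \<eta>"
proof -
  obtain \<rho> where \<rho>: "0 < \<rho>" "\<And>t. t \<in> {0..1} \<Longrightarrow> \<bar>t - t0\<bar> < \<rho> \<Longrightarrow> \<bar>f t - f t0\<bar> < \<eta>"
    using continuous_on_near[OF f t0 \<open>0 < \<eta>\<close>] by blast
  define peak where "peak = (\<lambda>t. M * max 0 (1 - \<bar>t - t0\<bar> / \<rho>))"
  have "0 \<le> M" using f_le[OF t0] by linarith
  then have peak: "0 \<le> peak t" "peak t \<le> M" for t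
    unfolding peak_def using \<rho>(1) by (simp, intro mult_left_le) auto
  have "\<bar>f t\<bar> + peak t \<le> M + \<bar>f t0\<bar> + \<eta>" if t: "t \<in> {0..1}" for t
  proof (cases "\<bar>t - t0\<bar> < \<rho>")
    case True
    with \<rho>(2)[OF t] peak(2)[of t] show ?thesis by fastforce
  next
    case False
    then have "peak t = 0" using \<rho>(1) by (simp add: peak_def)
    with f_le[OF t] \<open>0 < \<eta>\<close> show ?thesis by linarith
  qed
  moreover have "continuous_on {0..1} peak"
    unfolding peak_def using \<rho>(1) by (intro continuous_intros) auto
  moreover have "peak t0 = M" by (simp add: peak_def)
  ultimately show ?thesis using that peak(1) by blast
qed

context dense_embedding
begin

lemma embed_approx:
  assumes "continuous_on K F" "0 < \<epsilon>"
  obtains x where "x \<in> V" "\<And>t. t \<in> K \<Longrightarrow> \<bar>J x t - F t\<bar> < \<epsilon>"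
  using embed_dense[OF assms] by auto

lemma abs_embed_le_norm: "x \<in> V \<Longrightarrow> t \<in> K \<Longrightarrow> \<bar>J x t\<bar> \<le> nrm x"
  using norm_le_iff[of x "nrm x"] by blast

lemma norm_attained:
  assumes x: "x \<in> V" and K: "compact K" "K \<noteq> {}"
  obtains t where "t \<in> K" "\<bar>J x t\<bar> = nrm x"
proof -
  have "continuous_on K (\<lambda>t. \<bar>J x t\<bar>)" by (intro continuous_intros embed_continuous x)
  then obtain t where t: "t \<in> K" "\<And>s. s \<in> K \<Longrightarrow> \<bar>J x s\<bar> \<le> \<bar>J x t\<bar>"
    using continuous_attains_sup[OF K] by blast
  then have "nrm x \<le> \<bar>J x t\<bar>" using norm_le_iff[OF x] by blast
  then show ?thesis using that t(1) abs_embed_le_norm[OF x t(1)] by simp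
qed

lemma norm_less_iff:
  assumes "x \<in> V" "compact K" "K \<noteq> {}"
  shows "nrm x < c \<longleftrightarrow> (\<forall>t\<in>K. \<bar>J x t\<bar> < c)"
  using norm_attained[OF assms] abs_embed_le_norm[OF assms(1)] by (metis le_less_trans)

end

locale C01_frame =
  dense_embedding V add scale zero nrm "{0..1::real}" J + frame V add scale nrm e l r
  for V :: "'a set" and add scale zero nrm J e l r +
  assumes e_in [simp]: "e \<in> V" and l_in [simp]: "l \<in> V" and r_in [simp]: "r \<in> V"
    and e_pos: "t \<in> {0..1} \<Longrightarrow> 0 < J e t"
    and l_pos_ex: "\<exists>t\<in>{0..1}. 0 < J l t" and r_pos_ex: "\<exists>t\<in>{0..1}. 0 < J r t"
    and l_left_of_r: "s \<in> {0..1} \<Longrightarrow> t \<in> {0..1} \<Longrightarrow> 0 < J l s \<Longrightarrow> 0 < J r t \<Longrightarrow> s < t"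
begin

lemma not_bounded_away_if_small:
  assumes f: "f \<in> V" and t0: "t0 \<in> {0..1}" and small: "\<bar>J f t0\<bar> < of_rat \<delta>"
  shows "\<not> bounded_away \<delta> f"
proof -
  define \<eta> where "\<eta> = (of_rat \<delta> - \<bar>J f t0\<bar>) / 4"
  have \<eta>: "0 < \<eta>" using small by (simp add: \<eta>_def)
  obtain peak where peak: "continuous_on {0..1} peak" "\<And>t. 0 \<le> peak t" "peak t0 = nrm f"
    "\<And>t. t \<in> {0..1} \<Longrightarrow> \<bar>J f t\<bar> + peak t \<le> nrm f + \<bar>J f t0\<bar> + \<eta>"
    using ex_peak[OF embed_continuous[OF f] t0 \<eta> abs_embed_le_norm[OF f]] by blast
  from embed_approx[OF peak(1) \<eta>] obtain y where
    y: "y \<in> V" "\<And>t. t \<in> {0..1} \<Longrightarrow> \<bar>J y t - peak t\<bar> < \<eta>" by blast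
  have "\<bar>J f t + J y t\<bar> \<le> nrm f + \<bar>J f t0\<bar> + 2 * \<eta>" "\<bar>J f t - J y t\<bar> \<le> nrm f + \<bar>J f t0\<bar> + 2 * \<eta>"
    if t: "t \<in> {0..1}" for t
    using peak(4)[OF t] y(2)[OF t] peak(2)[of t] by linarith+
  then have "nrm (add f y) \<le> nrm f + \<bar>J f t0\<bar> + 2 * \<eta>" "nrm (sub f y) \<le> nrm f + \<bar>J f t0\<bar> + 2 * \<eta>"
    using f y(1) by (simp_all add: norm_le_iff embed_add embed_scale)
  moreover have "nrm f - \<eta> \<le> nrm y"
    using y(2)[OF t0] peak(3) abs_embed_le_norm[OF y(1) t0] by linarith
  moreover have "of_rat \<delta> = \<bar>J f t0\<bar> + 4 * \<eta>" by (simp add: \<eta>_def field_simps)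
  ultimately have "\<not> nrm y + of_rat \<delta> \<le> max (nrm (add f y)) (nrm (sub f y))"
    using \<eta> by linarith
  with y(1) show ?thesis unfolding bounded_away_def by blast
qed

lemma bounded_away_iff:
  assumes f: "f \<in> V"
  shows "bounded_away \<delta> f \<longleftrightarrow> (\<forall>t\<in>{0..1}. of_rat \<delta> \<le> \<bar>J f t\<bar>)"
proof
  assume "bounded_away \<delta> f"
  then show "\<forall>t\<in>{0..1}. of_rat \<delta> \<le> \<bar>J f t\<bar>" using not_bounded_away_if_small[OF f] not_le by blast
next
  assume large: "\<forall>t\<in>{0..1}. of_rat \<delta> \<le> \<bar>J f t\<bar>"
  show "bounded_away \<delta> f" unfolding bounded_away_def
  proof
    fix y assume y: "y \<in> V"
    obtain t where t: "t \<in> {0..1}" "\<bar>J y t\<bar> = nrm y" using norm_attained[OF y] by auto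
    have "\<bar>J f t + J y t\<bar> \<le> nrm (add f y)" "\<bar>J f t - J y t\<bar> \<le> nrm (sub f y)"
      using abs_embed_le_norm[of "add f y" t] abs_embed_le_norm[of "sub f y" t] f y t(1)
      by (simp_all add: embed_add embed_scale)
    moreover have "of_rat \<delta> \<le> \<bar>J f t\<bar>" using large t(1) by blast
    ultimately show "nrm y + of_rat \<delta> \<le> max (nrm (add f y)) (nrm (sub f y))"
      using t(2) by linarith
  qed
qed

lemma positive_iff:
  assumes f: "f \<in> V"
  shows "positive f \<longleftrightarrow> (\<forall>t\<in>{0..1}. 0 < J f t)"
proof
  assume pos: "\<forall>t\<in>{0..1}. 0 < J f t"
  obtain m where lower: "0 < m" "\<And>t. t \<in> {0..1} \<Longrightarrow> m \<le> J f t"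
    using compact_positive_lower_bound[OF compact_Icc embed_continuous[OF f]] pos by blast
  obtain \<delta> where \<delta>: "0 < real_of_rat \<delta>" "of_rat \<delta> < m" using of_rat_dense[OF lower(1)] by blast
  have "bounded_away \<delta> (add f (scale c e))" if "0 \<le> c" for c
  proof -
    have "of_rat \<delta> \<le> \<bar>J f t + of_rat c * J e t\<bar>" if t: "t \<in> {0..1}" for t
    proof -
      have "0 \<le> of_rat c * J e t" using \<open>0 \<le> c\<close> e_pos[OF t] by simp
      with lower(2)[OF t] \<delta>(2) show ?thesis by linarith
    qed
    then show ?thesis using f by (simp add: bounded_away_iff embed_add embed_scale)
  qed
  then show "positive f" unfolding positive_def using \<delta>(1) by (intro exI[of _ \<delta>]) auto
next
  assume "positive f"
  then obtain \<delta> where \<delta>: "0 < \<delta>" "\<And>c. 0 \<le> c \<Longrightarrow> bounded_away \<delta> (add f (scale c e))"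
    unfolding positive_def by blast
  show "\<forall>t\<in>{0..1}. 0 < J f t"
  proof (rule ccontr)
    assume "\<not> ?thesis"
    then obtain t where t: "t \<in> {0..1}" "J f t \<le> 0" by force
    note e = e_pos[OF t(1)]
    have "- J f t / J e t < (of_rat \<delta> - J f t) / J e t"
      using e \<delta>(1) by (intro divide_strict_right_mono) auto
    then obtain c where c_bounds: "- J f t / J e t < of_rat c"
      "of_rat c < (of_rat \<delta> - J f t) / J e t"
      using of_rat_dense by blast
    have "0 \<le> - J f t / J e t" using t(2) e by (simp add: divide_nonpos_pos)
    with c_bounds(1) have "0 < real_of_rat c" by linarith
    then have "0 \<le> c" by simp
    then have "of_rat \<delta> \<le> \<bar>J f t + of_rat c * J e t\<bar>"
      using \<delta>(2) t(1) f by (auto simp: bounded_away_iff embed_add embed_scale)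
    then show False using c_bounds e by (simp add: field_simps)
  qed
qed

lemma above_iff: "f \<in> V \<Longrightarrow> g \<in> V \<Longrightarrow> above f g \<longleftrightarrow> (\<forall>t\<in>{0..1}. J g t < J f t)"
  by (simp add: above_def positive_iff embed_diff)

definition pos_set :: "'a \<Rightarrow> real set" where
  "pos_set f = {t \<in> {0..1}. 0 < J f t}"

lemma pos_set_mono: "f \<in> V \<Longrightarrow> g \<in> V \<Longrightarrow> above f g \<Longrightarrow> pos_set g \<subseteq> pos_set f"
  by (force simp: above_iff pos_set_def)

lemma pos_set_near:
  assumes "f \<in> V" "t \<in> pos_set f"
  obtains \<rho> where "0 < \<rho>" "\<And>s. s \<in> {0..1} \<Longrightarrow> \<bar>s - t\<bar> < \<rho> \<Longrightarrow> s \<in> pos_set f"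
proof -
  have "t \<in> {0..1}" "0 < J f t" using assms(2) by (auto simp: pos_set_def)
  from continuous_on_near[OF embed_continuous[OF assms(1)] this]
  obtain \<rho> where "0 < \<rho>" "\<And>s. s \<in> {0..1} \<Longrightarrow> \<bar>s - t\<bar> < \<rho> \<Longrightarrow> \<bar>J f s - J f t\<bar> < J f t" by blast
  then show ?thesis by (intro that[of \<rho>]) (force simp: pos_set_def)+
qed

lemma ex_smaller_in_pos_set:
  assumes "f \<in> V" "y \<in> pos_set f" "0 \<le> x" "x < y"
  obtains y' where "y' \<in> pos_set f" "x < y'" "y' < y"
proof -
  obtain \<rho> where \<rho>: "0 < \<rho>" "\<And>s. s \<in> {0..1} \<Longrightarrow> \<bar>s - y\<bar> < \<rho> \<Longrightarrow> s \<in> pos_set f"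
    using pos_set_near[OF assms(1,2)] by blast
  obtain y' where y': "max x (y - \<rho>) < y'" "y' < y"
    using dense[of "max x (y - \<rho>)" y] assms(4) \<rho>(1) by auto
  moreover have "y' \<in> pos_set f" using y' assms(2,3) by (intro \<rho>(2)) (auto simp: pos_set_def)
  ultimately show ?thesis using that by simp
qed

lemma ex_larger_in_pos_set:
  assumes "f \<in> V" "x \<in> pos_set f" "x < y" "y \<le> 1"
  obtains x' where "x' \<in> pos_set f" "x < x'" "x' < y"
proof -
  obtain \<rho> where \<rho>: "0 < \<rho>" "\<And>s. s \<in> {0..1} \<Longrightarrow> \<bar>s - x\<bar> < \<rho> \<Longrightarrow> s \<in> pos_set f"
    using pos_set_near[OF assms(1,2)] by blast
  obtain x' where x': "x < x'" "x' < min y (x + \<rho>)"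
    using dense[of x "min y (x + \<rho>)"] assms(3) \<rho>(1) by auto
  moreover have "x' \<in> pos_set f" using x' assms(2,4) by (intro \<rho>(2)) (auto simp: pos_set_def)
  ultimately show ?thesis using that by simp
qed

lemma ex_below_min:
  assumes f: "f \<in> V" and G: "continuous_on {0..1} G" and t: "t \<in> {0..1}" "0 < J f t" "0 < G t"
  obtains f' where "f' \<in> V" "above f f'" "\<And>s. s \<in> {0..1} \<Longrightarrow> J f' s < G s"
    "min (J f t) (G t) / 2 < J f' t"
proof -
  define m where "m = min (J f t) (G t)"
  have m_pos: "0 < m" using t by (simp add: m_def)
  have cont: "continuous_on {0..1} (\<lambda>t. min (J f t) (G t) - m / 4)"
    by (intro continuous_intros embed_continuous f G)
  have "0 < m / 8" using m_pos by simp
  from embed_approx[OF cont this] obtain f' where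
    f': "f' \<in> V" "\<And>s. s \<in> {0..1} \<Longrightarrow> \<bar>J f' s - (min (J f s) (G s) - m / 4)\<bar> < m / 8" by blast
  have below: "J f' s < min (J f s) (G s)" if "s \<in> {0..1}" for s
    using f'(2)[OF that] m_pos by linarith
  show ?thesis
  proof (rule that[OF f'(1)])
    show "above f f'" using below f f'(1) by (simp add: above_iff)
    show "min (J f t) (G t) / 2 < J f' t" using f'(2)[OF t(1)] m_pos by (fold m_def) linarith
  qed (use below in auto)
qed

lemma ex_above_supported:
  fixes G :: "real \<Rightarrow> real"
  assumes "f \<in> V" "t \<in> pos_set f" "continuous_on {0..1} G" "0 < G t"
  obtains f' where "f' \<in> V" "above f f'" "t \<in> pos_set f'" "\<And>s. s \<in> pos_set f' \<Longrightarrow> 0 < G s"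
proof -
  have t: "t \<in> {0..1}" "0 < J f t" using assms(2) by (auto simp: pos_set_def)
  obtain f' where f': "f' \<in> V" "above f f'" "\<And>s. s \<in> {0..1} \<Longrightarrow> J f' s < G s"
    "min (J f t) (G t) / 2 < J f' t"
    using ex_below_min[OF assms(1,3) t assms(4)] by blast
  show ?thesis
  proof (rule that[OF f'(1,2)])
    show "t \<in> pos_set f'" using f'(4) t assms(4) by (auto simp: pos_set_def)
    show "0 < G s" if "s \<in> pos_set f'" for s using f'(3)[of s] that by (auto simp: pos_set_def)
  qed
qed

lemma meets_iff:
  assumes u: "u \<in> V" and v: "v \<in> V"
  shows "meets u v \<longleftrightarrow> pos_set u \<inter> pos_set v \<noteq> {}"
proof
  assume "meets u v"
  then obtain w c where w: "w \<in> V" "0 < c" "above u w" "above v w" "\<not> above (scale c e) w"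
    unfolding meets_def by blast
  then obtain t where t: "t \<in> {0..1}" "of_rat c * J e t \<le> J w t"
    by (auto simp: above_iff embed_scale not_less)
  have "0 < of_rat c * J e t" using w(2) e_pos[OF t(1)] by simp
  moreover have "J w t < J u t" "J w t < J v t" using w t u v by (auto simp: above_iff)
  ultimately have "t \<in> pos_set u \<inter> pos_set v" using t by (simp add: pos_set_def)
  then show "pos_set u \<inter> pos_set v \<noteq> {}" by blast
next
  assume "pos_set u \<inter> pos_set v \<noteq> {}"
  then obtain t where t: "t \<in> {0..1}" "0 < J u t" "0 < J v t" by (auto simp: pos_set_def)
  obtain w where w: "w \<in> V" "above u w" "\<And>s. s \<in> {0..1} \<Longrightarrow> J w s < J v s"
    "min (J u t) (J v t) / 2 < J w t"
    using ex_below_min[OF u embed_continuous[OF v] t] by blast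
  have "0 < J w t / J e t" using w(4) t e_pos[OF t(1)] by simp
  then obtain c where c_bounds: "0 < real_of_rat c" "of_rat c < J w t / J e t"
    using of_rat_dense by blast
  then have "of_rat c * J e t < J w t" using e_pos[OF t(1)] by (simp add: pos_less_divide_eq)
  then have "\<not> above (scale c e) w" using w(1) t(1) by (force simp: above_iff embed_scale)
  moreover have "above v w" using w(1,3) v by (simp add: above_iff)
  ultimately show "meets u v" unfolding meets_def using w(1,2) c_bounds(1) by auto
qed

lemma above_abs_max_iff:
  assumes "z \<in> V" "k \<in> V" "u \<in> V"
  shows "above z k \<and> above z (scale (-1) k) \<and> above z u \<longleftrightarrow>
    (\<forall>t\<in>{0..1}. max \<bar>J k t\<bar> (J u t) < J z t)"
  using assms by (auto simp: above_iff embed_scale abs_less_iff of_rat_minus)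

lemma pos_set_if_zeros_inside:
  assumes k: "k \<in> V" and u: "u \<in> V" and zeros: "zeros_inside k u" and t: "t \<in> {0..1}" "J k t = 0"
  shows "t \<in> pos_set u"
proof (rule ccontr)
  let ?m = "\<lambda>t. max \<bar>J k t\<bar> (J u t)"
  assume "t \<notin> pos_set u"
  then have "?m t = 0" using t by (auto simp: pos_set_def)
  obtain c where threshold: "0 < c" "\<And>z. z \<in> V \<Longrightarrow> \<forall>t\<in>{0..1}. ?m t < J z t \<Longrightarrow> above z (scale c e)"
    using zeros above_abs_max_iff[OF _ k u] unfolding zeros_inside_def by blast
  define \<eta> where "\<eta> = of_rat c * J e t / 2"
  have \<eta>: "0 < \<eta>" using threshold(1) e_pos[OF t(1)] by (simp add: \<eta>_def)
  have "continuous_on {0..1} (\<lambda>t. ?m t + \<eta>)" by (intro continuous_intros embed_continuous k u)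
  from embed_approx[OF this \<eta>] obtain z where
    z: "z \<in> V" "\<And>t. t \<in> {0..1} \<Longrightarrow> \<bar>J z t - (?m t + \<eta>)\<bar> < \<eta>" by blast
  have "?m s < J z s" if "s \<in> {0..1}" for s using z(2)[OF that] by linarith
  then have "above z (scale c e)" using threshold(2) z(1) by blast
  then have "of_rat c * J e t < J z t" using z(1) t(1) by (simp add: above_iff embed_scale)
  moreover have "J z t < 2 * \<eta>" using z(2)[OF t(1)] \<open>?m t = 0\<close> by linarith
  ultimately show False by (simp add: \<eta>_def)
qed

lemma zeros_insideI:
  assumes k: "k \<in> V" and u: "u \<in> V" and zeros: "\<And>t. t \<in> {0..1} \<Longrightarrow> J k t = 0 \<Longrightarrow> t \<in> pos_set u"
  shows "zeros_inside k u"
proof -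
  let ?m = "\<lambda>t. max \<bar>J k t\<bar> (J u t)"
  have "continuous_on {0..1} ?m" by (intro continuous_intros embed_continuous k u)
  moreover have "0 < ?m t" if "t \<in> {0..1}" for t
    using zeros[OF that] by (auto simp: pos_set_def less_max_iff_disj)
  ultimately obtain b where b_lower: "0 < b" "\<And>t. t \<in> {0..1} \<Longrightarrow> b \<le> ?m t"
    using compact_positive_lower_bound[OF compact_Icc] by blast
  obtain E where E: "0 < E" "\<And>t. t \<in> {0..1} \<Longrightarrow> \<bar>J e t\<bar> \<le> E"
    using compact_abs_upper_bound[OF compact_Icc embed_continuous[OF e_in]] by blast
  have "0 < b / E" using b_lower E by simp
  then obtain c where c_bounds: "0 < real_of_rat c" "of_rat c < b / E" using of_rat_dense by blast
  have small: "of_rat c * J e t < ?m t" if t: "t \<in> {0..1}" for t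
  proof -
    have "of_rat c * J e t \<le> of_rat c * E"
      using E(2)[OF t] c_bounds(1) by (intro mult_left_mono) auto
    also have "\<dots> < b" using c_bounds(2) E(1) by (simp add: pos_less_divide_eq)
    also have "\<dots> \<le> ?m t" by (rule b_lower(2)[OF t])
    finally show ?thesis .
  qed
  have "above z (scale c e)" if "z \<in> V" and z: "\<forall>t\<in>{0..1}. ?m t < J z t" for z
  proof -
    have "of_rat c * J e t < J z t" if "t \<in> {0..1}" for t
      using small[OF that] bspec[OF z that] by linarith
    with \<open>z \<in> V\<close> show ?thesis by (simp add: above_iff embed_scale)
  qed
  then show ?thesis
    unfolding zeros_inside_def
    using above_abs_max_iff[OF _ k u] c_bounds(1) by (intro exI[of _ c]) auto
qed

end

lemma IVT_zero_between:
  fixes f :: "real \<Rightarrow> real"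
  assumes "continuous_on {a..b} f" "x \<in> {a..b}" "s \<in> {a..b}" "0 < f x" "f s < 0"
  obtains y where "y \<in> {a..b}" "f y = 0" "x < y \<and> y < s \<or> s < y \<and> y < x"
proof (cases "x \<le> s")
  case True
  have "continuous_on {x..s} f" using assms(1) by (rule continuous_on_subset) (use assms in auto)
  then obtain y where "x \<le> y" "y \<le> s" "f y = 0" using IVT2'[of f s 0 x] True assms by auto
  moreover from this have "y \<noteq> x" "y \<noteq> s" using assms by auto
  ultimately show ?thesis using that[of y] assms by auto
next
  case False
  have "continuous_on {s..x} f" using assms(1) by (rule continuous_on_subset) (use assms in auto)
  then obtain y where "s \<le> y" "y \<le> x" "f y = 0" using IVT'[of f s 0 x] False assms by auto
  moreover from this have "y \<noteq> x" "y \<noteq> s" using assms by auto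
  ultimately show ?thesis using that[of y] assms by auto
qed

context C01_frame
begin

lemma betweenI:
  assumes V: "u \<in> V" "v \<in> V" "w \<in> V" and pos: "x \<in> pos_set v" "y \<in> pos_set u" "s \<in> pos_set w"
    and order: "x < y \<and> y < s \<or> s < y \<and> y < x"
  shows "between u v w"
proof -
  have I: "x \<in> {0..1}" "s \<in> {0..1}" using pos by (auto simp: pos_set_def)
  define \<sigma> :: real where "\<sigma> = (if x < y then 1 else -1)"
  have \<sigma>: "0 < \<sigma> * (y - x)" "0 < \<sigma> * (s - y)" "\<bar>\<sigma>\<bar> = 1" using order by (auto simp: \<sigma>_def)
  obtain \<rho> where \<rho>: "0 < \<rho>" "\<And>t. t \<in> {0..1} \<Longrightarrow> \<bar>t - y\<bar> < \<rho> \<Longrightarrow> t \<in> pos_set u"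
    using pos_set_near[OF V(1) pos(2)] by blast
  define \<eta> where "\<eta> = min \<rho> (min (\<sigma> * (y - x)) (\<sigma> * (s - y)))"
  have \<eta>: "0 < \<eta>" "\<eta> \<le> \<rho>" "\<eta> \<le> \<sigma> * (y - x)" "\<eta> \<le> \<sigma> * (s - y)" using \<rho>(1) \<sigma> by (auto simp: \<eta>_def)
  have "continuous_on {0..1} (\<lambda>t. \<sigma> * (y - t))" by (intro continuous_intros)
  from embed_approx[OF this \<eta>(1)] obtain k where
    k: "k \<in> V" "\<And>t. t \<in> {0..1} \<Longrightarrow> \<bar>J k t - \<sigma> * (y - t)\<bar> < \<eta>" by blast
  have "0 < J k x" using k(2)[OF I(1)] \<eta>(3) by linarith
  then have "meets k v" using k(1) V pos(1) I(1) by (auto simp: meets_iff pos_set_def)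
  moreover have "\<sigma> * (y - s) = - (\<sigma> * (s - y))" by (simp add: algebra_simps)
  then have "J k s < 0" using k(2)[OF I(2)] \<eta>(4) by linarith
  then have "meets (scale (-1) k) w"
    using k(1) V pos(3) I(2) by (auto simp: meets_iff pos_set_def embed_scale)
  moreover have "zeros_inside k u"
  proof (rule zeros_insideI[OF k(1) V(1)])
    fix t :: real assume t: "t \<in> {0..1}" "J k t = 0"
    then have "\<bar>\<sigma> * (y - t)\<bar> < \<eta>" using k(2)[OF t(1)] by simp
    then have "\<bar>t - y\<bar> < \<rho>" using \<sigma>(3) \<eta>(2) by (simp add: abs_mult abs_minus_commute)
    with t(1) show "t \<in> pos_set u" by (rule \<rho>(2))
  qed
  ultimately show ?thesis unfolding between_def using k(1) by blast
qed

lemma between_iff: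
  assumes V: "u \<in> V" "v \<in> V" "w \<in> V"
  shows "between u v w \<longleftrightarrow>
    (\<exists>x\<in>pos_set v. \<exists>y\<in>pos_set u. \<exists>s\<in>pos_set w. x < y \<and> y < s \<or> s < y \<and> y < x)"
proof
  assume "between u v w"
  then obtain k where k: "k \<in> V" "meets k v" "meets (scale (-1) k) w" "zeros_inside k u"
    unfolding between_def by blast
  obtain x where x: "x \<in> {0..1}" "0 < J k x" "x \<in> pos_set v"
    using k V by (auto simp: meets_iff pos_set_def)
  obtain s where s: "s \<in> {0..1}" "J k s < 0" "s \<in> pos_set w"
    using k V by (fastforce simp: meets_iff pos_set_def embed_scale)
  obtain y where y: "y \<in> {0..1}" "J k y = 0" "x < y \<and> y < s \<or> s < y \<and> y < x"
    using IVT_zero_between[OF embed_continuous[OF k(1)] x(1) s(1) x(2) s(2)] by blast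
  have "y \<in> pos_set u" using pos_set_if_zeros_inside[OF k(1) V(1) k(4) y(1,2)] .
  with x(3) s(3) y(3)
  show "\<exists>x\<in>pos_set v. \<exists>y\<in>pos_set u. \<exists>s\<in>pos_set w. x < y \<and> y < s \<or> s < y \<and> y < x" by blast
qed (use betweenI[OF V] in blast)

lemma ex_pos_set_l: "\<exists>t. t \<in> pos_set l" and ex_pos_set_r: "\<exists>t. t \<in> pos_set r"
  using l_pos_ex r_pos_ex by (auto simp: pos_set_def)

lemma pos_set_l_less_r: "s \<in> pos_set l \<Longrightarrow> t \<in> pos_set r \<Longrightarrow> s < t"
  using l_left_of_r by (auto simp: pos_set_def)

lemma less_if_left_of_r:
  assumes V: "v \<in> V" "u \<in> V" and not_between: "\<not> between r l u" and "between u v r"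
  shows "\<exists>x\<in>pos_set v. \<exists>y\<in>pos_set u. x < y"
proof -
  obtain l0 where l0: "l0 \<in> pos_set l" using ex_pos_set_l by blast
  obtain x y s where xys: "x \<in> pos_set v" "y \<in> pos_set u" "s \<in> pos_set r"
    "x < y \<and> y < s \<or> s < y \<and> y < x"
    using V \<open>between u v r\<close> by (auto simp: between_iff)
  have "\<not> s < y"
    using not_between pos_set_l_less_r[OF l0 xys(3)] l0 xys V by (auto simp: between_iff)
  then show ?thesis using xys by blast
qed

lemma less_if_right_of_l:
  assumes V: "v \<in> V" "u \<in> V" and not_between: "\<not> between l v r" and "between v l u"
  shows "\<exists>x\<in>pos_set v. \<exists>y\<in>pos_set u. x < y"
proof -
  obtain r0 where r0: "r0 \<in> pos_set r" using ex_pos_set_r by blast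
  obtain x y s where xys: "x \<in> pos_set l" "y \<in> pos_set v" "s \<in> pos_set u"
    "x < y \<and> y < s \<or> s < y \<and> y < x"
    using V \<open>between v l u\<close> by (auto simp: between_iff)
  have "\<not> y < x"
    using not_between pos_set_l_less_r[OF xys(1) r0] r0 xys V by (auto simp: between_iff)
  then show ?thesis using xys by blast
qed

lemma less_if_across:
  assumes V: "v \<in> V" "u \<in> V" and "between l v r" "between r l u"
  shows "\<exists>x\<in>pos_set v. \<exists>y\<in>pos_set u. x < y"
proof -
  obtain x y s where xys: "x \<in> pos_set v" "y \<in> pos_set l" "s \<in> pos_set r"
    "x < y \<and> y < s \<or> s < y \<and> y < x"
    using V \<open>between l v r\<close> by (auto simp: between_iff)
  obtain x' y' s' where xys': "x' \<in> pos_set l" "y' \<in> pos_set r" "s' \<in> pos_set u"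
    "x' < y' \<and> y' < s' \<or> s' < y' \<and> y' < x'"
    using V \<open>between r l u\<close> by (auto simp: between_iff)
  have "x < y" "y < y'" "y' < s'"
    using xys(4) pos_set_l_less_r[OF xys(2,3)] pos_set_l_less_r[OF xys(2) xys'(2)]
      xys'(4) pos_set_l_less_r[OF xys'(1,2)] by auto
  then have "x < s'" by linarith
  then show ?thesis using xys(1) xys'(3) by blast
qed

lemma less_if_before:
  assumes V: "v \<in> V" "u \<in> V" and "before v u"
  shows "\<exists>x\<in>pos_set v. \<exists>y\<in>pos_set u. x < y"
proof -
  obtain v' u' where v': "v' \<in> V" "above v v'" and u': "u' \<in> V" "above u u'"
    and "\<not> between r l u' \<and> between u' v' r \<or> \<not> between l v' r \<and> between v' l u' \<or>
      between l v' r \<and> between r l u'"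
    using \<open>before v u\<close> unfolding before_def by blast
  then have "\<exists>x\<in>pos_set v'. \<exists>y\<in>pos_set u'. x < y"
    using less_if_left_of_r[OF v'(1) u'(1)] less_if_right_of_l[OF v'(1) u'(1)]
      less_if_across[OF v'(1) u'(1)] by argo
  then show ?thesis using pos_set_mono[OF V(1) v'] pos_set_mono[OF V(2) u'] by blast
qed

lemma ex_above_at:
  assumes "f \<in> V" "t \<in> pos_set f"
  obtains f' where "f' \<in> V" "above f f'" "t \<in> pos_set f'"
  using ex_above_supported[OF assms, of "\<lambda>_. 1"] by auto

lemma before_if_left_of_r:
  assumes v: "v \<in> V" "x \<in> pos_set v" and u: "u \<in> V" "y \<in> pos_set u" and "x < y"
    and left: "\<And>s. s \<in> pos_set r \<Longrightarrow> y \<le> s"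
  shows "before v u"
proof -
  obtain r0 where r0: "r0 \<in> pos_set r" using ex_pos_set_r by blast
  obtain v' where v': "v' \<in> V" "above v v'" "x \<in> pos_set v'" using ex_above_at[OF v] by blast
  have "0 \<le> x" using v(2) by (simp add: pos_set_def)
  then obtain y' where y': "y' \<in> pos_set u" "x < y'" "y' < y"
    using ex_smaller_in_pos_set[OF u _ \<open>x < y\<close>] by blast
  have "continuous_on {0..1} (\<lambda>t. y - t)" by (intro continuous_intros)
  then obtain u' where u': "u' \<in> V" "above u u'" "y' \<in> pos_set u'" "\<And>s. s \<in> pos_set u' \<Longrightarrow> 0 < y - s"
    using ex_above_supported[OF u(1) y'(1)] y'(3) by (metis diff_gt_0_iff_gt)
  have "between u' v' r"
    using betweenI[OF u'(1) v'(1) r_in v'(3) u'(3) r0] y' left[OF r0] by simp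
  moreover have "\<not> between r l u'"
  proof
    assume "between r l u'"
    then obtain a b c where points: "a \<in> pos_set l" "b \<in> pos_set r" "c \<in> pos_set u'"
      "a < b \<and> b < c \<or> c < b \<and> b < a"
      using u'(1) by (auto simp: between_iff)
    then show False using pos_set_l_less_r[OF points(1,2)] left[OF points(2)] u'(4)[OF points(3)]
      by auto
  qed
  ultimately show ?thesis unfolding before_def using v' u' by blast
qed

lemma before_if_right_of_l:
  assumes v: "v \<in> V" "x \<in> pos_set v" and u: "u \<in> V" "y \<in> pos_set u" and "x < y"
    and right: "\<And>s. s \<in> pos_set l \<Longrightarrow> s \<le> x"
  shows "before v u"
proof -
  obtain l0 where l0: "l0 \<in> pos_set l" using ex_pos_set_l by blast
  obtain u' where u': "u' \<in> V" "above u u'" "y \<in> pos_set u'" using ex_above_at[OF u] by blast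
  have "y \<le> 1" using u(2) by (simp add: pos_set_def)
  then obtain x' where x': "x' \<in> pos_set v" "x < x'" "x' < y"
    using ex_larger_in_pos_set[OF v \<open>x < y\<close>] by blast
  have "continuous_on {0..1} (\<lambda>t. t - x)" by (intro continuous_intros)
  then obtain v' where v': "v' \<in> V" "above v v'" "x' \<in> pos_set v'" "\<And>s. s \<in> pos_set v' \<Longrightarrow> 0 < s - x"
    using ex_above_supported[OF v(1) x'(1)] x'(2) by (metis diff_gt_0_iff_gt)
  have "between v' l u'"
    using betweenI[OF v'(1) l_in u'(1) l0 v'(3) u'(3)] x' right[OF l0] by simp
  moreover have "\<not> between l v' r"
  proof
    assume "between l v' r"
    then obtain a b c where points: "a \<in> pos_set v'" "b \<in> pos_set l" "c \<in> pos_set r"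
      "a < b \<and> b < c \<or> c < b \<and> b < a"
      using v'(1) by (auto simp: between_iff)
    then show False using pos_set_l_less_r[OF points(2,3)] right[OF points(2)] v'(4)[OF points(1)]
      by auto
  qed
  ultimately show ?thesis unfolding before_def using v' u' by blast
qed

lemma before_iff:
  assumes V: "v \<in> V" "u \<in> V"
  shows "before v u \<longleftrightarrow> (\<exists>x\<in>pos_set v. \<exists>y\<in>pos_set u. x < y)"
proof
  assume "\<exists>x\<in>pos_set v. \<exists>y\<in>pos_set u. x < y"
  then obtain x y where x: "x \<in> pos_set v" and y: "y \<in> pos_set u" and "x < y" by blast
  consider (left_of_r) "\<And>s. s \<in> pos_set r \<Longrightarrow> y \<le> s"
    | (right_of_l) "\<And>s. s \<in> pos_set l \<Longrightarrow> s \<le> x"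
    | (across) s t where "s \<in> pos_set r" "s < y" "t \<in> pos_set l" "x < t"
    using not_le by metis
  then show "before v u"
  proof cases
    case left_of_r
    with V x y \<open>x < y\<close> show ?thesis using before_if_left_of_r by blast
  next
    case right_of_l
    with V x y \<open>x < y\<close> show ?thesis using before_if_right_of_l by blast
  next
    case across
    note st = this
    obtain v' where v': "v' \<in> V" "above v v'" "x \<in> pos_set v'" using ex_above_at[OF V(1) x] by blast
    obtain u' where u': "u' \<in> V" "above u u'" "y \<in> pos_set u'" using ex_above_at[OF V(2) y] by blast
    have "t < s" using st pos_set_l_less_r by blast
    then have "between l v' r" "between r l u'"
      using betweenI[OF l_in v'(1) r_in v'(3) st(3,1)]
        betweenI[OF r_in l_in u'(1) st(3,1) u'(3)] st by auto
    then show ?thesis unfolding before_def using v' u' by blast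
  qed
qed (rule less_if_before[OF V])

lemma bumps_iff: "u \<in> bumps \<longleftrightarrow> u \<in> V \<and> pos_set u \<noteq> {}"
  unfolding bumps_def using meets_iff[of u u] by auto

lemma bump_in_V: "u \<in> bumps \<Longrightarrow> u \<in> V"
  by (simp add: bumps_iff)

definition point :: "'a \<Rightarrow> real" where
  "point u = Sup (pos_set u)"

lemma bdd_above_pos_set: "bdd_above (pos_set u)"
  by (rule bdd_aboveI[of _ 1]) (auto simp: pos_set_def)

lemma le_point: "t \<in> pos_set u \<Longrightarrow> t \<le> point u"
  unfolding point_def by (rule cSup_upper[OF _ bdd_above_pos_set])

lemma less_pointE:
  assumes "u \<in> bumps" "a < point u"
  obtains t where "t \<in> pos_set u" "a < t"
  using assms less_cSup_iff[of "pos_set u" a] bdd_above_pos_set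
  unfolding point_def bumps_iff by auto

lemma point_le: "u \<in> bumps \<Longrightarrow> (\<And>t. t \<in> pos_set u \<Longrightarrow> t \<le> a) \<Longrightarrow> point u \<le> a"
  unfolding point_def by (rule cSup_least) (auto simp: bumps_iff)

lemma point_pos:
  assumes u: "u \<in> bumps"
  shows "0 < point u"
proof -
  obtain t where t: "t \<in> pos_set u" using u by (auto simp: bumps_iff)
  show ?thesis
  proof (cases "t < 1")
    case True
    then obtain t' where "t' \<in> pos_set u" "t < t'"
      using ex_larger_in_pos_set[OF bump_in_V[OF u] t] by blast
    then show ?thesis using le_point[of t' u] t by (auto simp: pos_set_def)
  next
    case False
    then show ?thesis using le_point[OF t] by simp
  qed
qed

lemma point_in: "u \<in> bumps \<Longrightarrow> point u \<in> {0..1}"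
  using point_pos[of u] point_le[of u 1] by (auto simp: pos_set_def)

lemma ex_bump_in:
  assumes "0 \<le> a" "a < b" "b \<le> 1"
  obtains u where "u \<in> bumps" "pos_set u \<subseteq> {a<..<b}" "a < point u" "point u \<le> b"
proof -
  define h where "h = (b - a) / 2"
  have h_pos: "0 < h / 4" using assms by (simp add: h_def)
  have "continuous_on {0..1} (\<lambda>t. min (t - a) (b - t) - h / 4)" by (intro continuous_intros)
  from embed_approx[OF this h_pos] obtain u where
    u: "u \<in> V" "\<And>t. t \<in> {0..1} \<Longrightarrow> \<bar>J u t - (min (t - a) (b - t) - h / 4)\<bar> < h / 4" by blast
  have "0 < min (t - a) (b - t)" if "t \<in> pos_set u" for t
    using u(2)[of t] that unfolding pos_set_def mem_Collect_eq by linarith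
  then have subset: "pos_set u \<subseteq> {a<..<b}" by auto
  let ?t = "(a + b) / 2"
  have t: "?t \<in> {0..1}" using assms by auto
  have "min (?t - a) (b - ?t) = h" by (simp add: h_def field_simps)
  with u(2)[OF t] h_pos have "0 < J u ?t" by linarith
  with t have "?t \<in> pos_set u" by (simp add: pos_set_def)
  then have "u \<in> bumps" "a < point u"
    using u(1) le_point[of ?t u] assms by (auto simp: bumps_iff)
  moreover have "point u \<le> b" using subset by (intro point_le \<open>u \<in> bumps\<close>) auto
  ultimately show ?thesis using that subset by blast
qed

lemma ex_bump_near:
  assumes "t \<in> {0..1}" "0 < \<rho>"
  obtains u where "u \<in> bumps" "\<bar>point u - t\<bar> < \<rho>"
proof -
  define a b where "a = max 0 (t - \<rho> / 2)" and "b = min 1 (t + \<rho> / 2)"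
  have "0 \<le> a" "a < b" "b \<le> 1" using assms by (auto simp: a_def b_def)
  then obtain u where u: "u \<in> bumps" "a < point u" "point u \<le> b" using ex_bump_in by blast
  moreover have "\<bar>point u - t\<bar> < \<rho>" using u(2,3) assms by (auto simp: a_def b_def)
  ultimately show ?thesis using that by blast
qed

lemma bump_le_iff:
  assumes x: "x \<in> bumps" and y: "y \<in> bumps"
  shows "bump_le x y \<longleftrightarrow> point x \<le> point y"
proof
  assume ordered: "bump_le x y"
  show "point x \<le> point y"
  proof (rule ccontr)
    assume "\<not> point x \<le> point y"
    then obtain w where w: "w \<in> bumps" "pos_set w \<subseteq> {point y<..<point x}"
      using ex_bump_in[of "point y" "point x"] point_in[OF x] point_in[OF y] by auto
    then obtain t where "t \<in> pos_set w" by (auto simp: bumps_iff)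
    with w(2) have t: "t \<in> pos_set w" "point y < t" "t < point x" by auto
    obtain s where "s \<in> pos_set x" "t < s" using less_pointE[OF x t(3)] .
    then have "before w x" using t(1) w(1) x by (auto simp: before_iff bump_in_V)
    then have "before w y" using ordered w(1) unfolding bump_le_def by blast
    then obtain t' s where "t' \<in> pos_set w" "s \<in> pos_set y" "t' < s"
      using w(1) y by (auto simp: before_iff bump_in_V)
    then show False using w(2) le_point[of s y] by force
  qed
next
  assume ordered: "point x \<le> point y"
  show "bump_le x y" unfolding bump_le_def
  proof (intro ballI impI)
    fix w assume w: "w \<in> bumps" "before w x"
    then obtain t s where t: "t \<in> pos_set w" "s \<in> pos_set x" "t < s"
      using x by (auto simp: before_iff bump_in_V)
    then have "t < point y" using le_point[of s x] ordered by linarith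
    with less_pointE[OF y] obtain s' where "s' \<in> pos_set y" "t < s'" by blast
    then show "before w y" using t(1) w(1) y by (auto simp: before_iff bump_in_V)
  qed
qed

definition ratio :: "'a \<Rightarrow> real \<Rightarrow> real" where
  "ratio f t = J f t / J e t"

lemma continuous_on_ratio: "f \<in> V \<Longrightarrow> continuous_on {0..1} (ratio f)"
  unfolding ratio_def[abs_def]
  by (intro continuous_on_divide embed_continuous e_in) (auto dest: e_pos)

lemma pos_set_sub_scale:
  "f \<in> V \<Longrightarrow> pos_set (sub f (scale c e)) = {t \<in> {0..1}. of_rat c < ratio f t}"
  using e_pos by (auto simp: pos_set_def ratio_def embed_diff embed_scale pos_less_divide_eq)

lemma exceeds_left_ofI:
  assumes f: "f \<in> V" and u: "u \<in> bumps" and c_less: "of_rat c < ratio f (point u)"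
  shows "exceeds_left_of u f c"
proof -
  define g where "g = sub f (scale c e)"
  have g: "g \<in> V" using f by (simp add: g_def)
  have "point u \<in> pos_set g" using c_less f point_in[OF u] by (simp add: g_def pos_set_sub_scale)
  then obtain \<rho> where \<rho>: "0 < \<rho>" "\<And>s. s \<in> {0..1} \<Longrightarrow> \<bar>s - point u\<bar> < \<rho> \<Longrightarrow> s \<in> pos_set g"
    using pos_set_near[OF g] by blast
  obtain a where a_bounds: "max 0 (point u - \<rho>) < a" "a < point u"
    using dense[of "max 0 (point u - \<rho>)" "point u"] \<rho>(1) point_pos[OF u] by auto
  have "a \<le> 1" using a_bounds(2) point_in[OF u] by simp
  then obtain w where "w \<in> bumps" "max 0 (point u - \<rho>) < point w" "point w \<le> a"
    using ex_bump_in[OF _ a_bounds(1)] by auto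
  then have w: "w \<in> bumps" "point u - \<rho> < point w" "point w < point u" using a_bounds(2) by auto
  have "meets v g" if v: "v \<in> bumps" "point w < point v" "point v \<le> point u" for v
  proof -
    obtain t where t: "t \<in> pos_set v" "point w < t" using less_pointE[OF v(1,2)] by blast
    then have "t \<in> pos_set g"
      using le_point[OF t(1)] v(3) w(2) by (intro \<rho>(2)) (auto simp: pos_set_def)
    with t(1) g v(1) show ?thesis by (auto simp: meets_iff bump_in_V)
  qed
  then show ?thesis unfolding exceeds_left_of_def g_def
    using w u by (intro bexI[of _ w]) (auto simp: bump_le_iff not_le)
qed

lemma exceeds_left_of_imp_le:
  assumes f: "f \<in> V" and u: "u \<in> bumps" and exceeds: "exceeds_left_of u f c"
  shows "of_rat c \<le> ratio f (point u)"
proof (rule ccontr)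
  assume "\<not> ?thesis"
  then have "0 < of_rat c - ratio f (point u)" by simp
  then obtain \<rho> where \<rho>: "0 < \<rho>" "\<And>s. s \<in> {0..1} \<Longrightarrow> \<bar>s - point u\<bar> < \<rho> \<Longrightarrow>
      \<bar>ratio f s - ratio f (point u)\<bar> < of_rat c - ratio f (point u)"
    using continuous_on_near[OF continuous_on_ratio[OF f] point_in[OF u]] by blast
  obtain w where w: "w \<in> bumps" "\<not> bump_le u w"
    "\<And>v. v \<in> bumps \<Longrightarrow> \<not> bump_le v w \<Longrightarrow> bump_le v u \<Longrightarrow> meets v (sub f (scale c e))"
    using exceeds unfolding exceeds_left_of_def by blast
  define a where "a = max (point w) (point u - \<rho>)"
  have a_bounds: "0 \<le> a" "a < point u" "point w \<le> a" "point u - \<rho> \<le> a"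
    using \<rho>(1) w u point_in[OF w(1)] by (auto simp: a_def bump_le_iff not_le)
  obtain v where v: "v \<in> bumps" "pos_set v \<subseteq> {a<..<point u}" "a < point v" "point v \<le> point u"
    using ex_bump_in[OF a_bounds(1,2)] point_in[OF u] by auto
  have "meets v (sub f (scale c e))"
    using v a_bounds w(1) u by (intro w(3)) (auto simp: bump_le_iff not_le)
  then obtain t where t: "t \<in> pos_set v" "of_rat c < ratio f t" "t \<in> {0..1}"
    using v(1) f by (auto simp: meets_iff bump_in_V pos_set_sub_scale)
  then have "\<bar>t - point u\<bar> < \<rho>" using v(2) a_bounds(4) by auto
  from \<rho>(2)[OF t(3) this] t(2) show False by linarith
qed

lemma bump_value_eq: "f \<in> V \<Longrightarrow> u \<in> bumps \<Longrightarrow> bump_value f u = ratio f (point u)"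
  unfolding bump_value_def using exceeds_left_ofI exceeds_left_of_imp_le by (intro rat_sup_eqI) auto

lemma ex_large_in_unit_ball:
  assumes "a < 1"
  obtains f where "f \<in> V" "nrm f < 1" "\<And>t. t \<in> {0..1} \<Longrightarrow> a < J f t"
proof -
  define \<eta> where "\<eta> = min (1 / 2) ((1 - a) / 2)"
  have \<eta>: "0 < \<eta>" "\<eta> \<le> 1 / 2" "\<eta> \<le> (1 - a) / 2"
    unfolding \<eta>_def using assms by (simp, intro min.cobounded1, intro min.cobounded2)
  from embed_approx[OF continuous_on_const \<eta>(1), of "1 - \<eta>"] obtain f where
    f: "f \<in> V" "\<And>t. t \<in> {0..1} \<Longrightarrow> \<bar>J f t - (1 - \<eta>)\<bar> < \<eta>" by blast
  have "\<bar>J f t\<bar> < 1 \<and> a < J f t" if "t \<in> {0..1}" for t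
    using f(2)[OF that] \<eta> by (auto simp: abs_less_iff field_simps)
  with f(1) show ?thesis using that by (auto simp: norm_less_iff)
qed

lemma bump_weight_eq:
  assumes u: "u \<in> bumps"
  shows "bump_weight u = 1 / J e (point u)"
  unfolding bump_weight_def
proof (rule rat_sup_eqI)
  note t = point_in[OF u]
  note e = e_pos[OF t]
  fix q assume "of_rat q < 1 / J e (point u)"
  then have "of_rat q * J e (point u) < 1" using e by (simp add: pos_less_divide_eq)
  then obtain f where f: "f \<in> V" "nrm f < 1" "\<And>t. t \<in> {0..1} \<Longrightarrow> of_rat q * J e (point u) < J f t"
    using ex_large_in_unit_ball by blast
  then have "of_rat q \<le> bump_value f u"
    using f(3)[OF t] e u by (simp add: bump_value_eq ratio_def pos_le_divide_eq)
  with f(1,2) show "q \<in> {c. \<exists>f\<in>V. nrm f < 1 \<and> of_rat c \<le> bump_value f u}" by blast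
next
  note t = point_in[OF u]
  note e = e_pos[OF t]
  fix q assume "q \<in> {c. \<exists>f\<in>V. nrm f < 1 \<and> of_rat c \<le> bump_value f u}"
  then obtain f where f: "f \<in> V" "nrm f < 1" "of_rat q \<le> J f (point u) / J e (point u)"
    using u by (auto simp: bump_value_eq ratio_def)
  moreover have "J f (point u) / J e (point u) \<le> 1 / J e (point u)"
    using abs_embed_le_norm[OF f(1) t] f(2) e by (intro divide_right_mono) auto
  ultimately show "of_rat q \<le> 1 / J e (point u)" by linarith
qed

end

section \<open>Dense embeddings from ordered families of evaluations\<close>

lemma le_if_le_greater_rat:
  assumes "\<And>q. y < real_of_rat q \<Longrightarrow> x \<le> real_of_rat q"
  shows "x \<le> y"
proof (rule ccontr)
  assume "\<not> x \<le> y"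
  then obtain q where "y < real_of_rat q" "real_of_rat q < x" using of_rat_dense[of y x] by auto
  with assms[of q] show False by simp
qed

lemma uniformly_continuous_factorization:
  fixes \<gamma> :: "'u \<Rightarrow> 'a::metric_space" and h :: "'u \<Rightarrow> 'b::complete_space"
  assumes unif: "\<And>\<epsilon>. 0 < \<epsilon> \<Longrightarrow> \<exists>\<eta>>0. \<forall>x\<in>U. \<forall>y\<in>U. dist (\<gamma> x) (\<gamma> y) < \<eta> \<longrightarrow> dist (h x) (h y) < \<epsilon>"
  obtains g where "continuous_on (closure (\<gamma> ` U)) g" "\<And>u. u \<in> U \<Longrightarrow> g (\<gamma> u) = h u"
proof -
  define k where "k = (\<lambda>t. h (inv_into U \<gamma> t))"
  have k_eq: "k (\<gamma> u) = h u" if "u \<in> U" for u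
  proof (rule dist_eq_0_iff[THEN iffD1], rule antisym)
    have "inv_into U \<gamma> (\<gamma> u) \<in> U" "\<gamma> (inv_into U \<gamma> (\<gamma> u)) = \<gamma> u"
      using that by (auto intro: inv_into_into f_inv_into_f)
    then have "dist (k (\<gamma> u)) (h u) < \<epsilon>" if "0 < \<epsilon>" for \<epsilon>
      using unif[OF that] \<open>u \<in> U\<close> unfolding k_def by (metis dist_self)
    then show "dist (k (\<gamma> u)) (h u) \<le> 0" by (meson dual_order.irrefl not_le)
  qed simp
  have "uniformly_continuous_on (\<gamma> ` U) k"
    unfolding uniformly_continuous_on_def using unif k_eq by (simp add: dist_commute)
  then obtain g where "uniformly_continuous_on (closure (\<gamma> ` U)) g" "\<And>t. t \<in> \<gamma> ` U \<Longrightarrow> k t = g t"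
    using uniformly_continuous_on_extension_on_closure by metis
  with k_eq show ?thesis by (intro that[of g] uniformly_continuous_imp_continuous) auto
qed

text \<open>
  The assumptions are first-order over the rationals apart from arithmetical real-valued functions,
  so that being an instance is an arithmetical property.
\<close>

locale evaluations = rat_normed_space V add scale zero nrm
  for V :: "nat set" and add scale zero nrm +
  fixes e :: nat
    and U :: "'u set" and le :: "'u \<Rightarrow> 'u \<Rightarrow> bool" and val :: "nat \<Rightarrow> 'u \<Rightarrow> real" and wt :: "'u \<Rightarrow> real"
  assumes e_in: "e \<in> V"
    and le_total: "x \<in> U \<Longrightarrow> y \<in> U \<Longrightarrow> le x y \<or> le y x"
    and le_trans: "x \<in> U \<Longrightarrow> y \<in> U \<Longrightarrow> z \<in> U \<Longrightarrow> le x y \<Longrightarrow> le y z \<Longrightarrow> le x z"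
    and le_nontrivial: "\<exists>x\<in>U. \<exists>y\<in>U. \<not> le y x"
    and val_bounded: "f \<in> V \<Longrightarrow> \<exists>b. \<forall>u\<in>U. \<bar>val f u\<bar> \<le> real_of_rat b"
    and val_add: "f \<in> V \<Longrightarrow> g \<in> V \<Longrightarrow> u \<in> U \<Longrightarrow> val (add f g) u = val f u + val g u"
    and val_scale: "f \<in> V \<Longrightarrow> u \<in> U \<Longrightarrow> val (scale q f) u = of_rat q * val f u"
    and val_e: "u \<in> U \<Longrightarrow> val e u = 1"
    and val_controlled: "f \<in> V \<Longrightarrow> 0 < \<epsilon> \<Longrightarrow> \<exists>p\<in>V.
      (\<forall>x\<in>U. \<forall>y\<in>U. le x y \<longrightarrow> val p x \<le> val p y + 1) \<and>
      (\<forall>x\<in>U. \<forall>y\<in>U. \<bar>val p x - val p y\<bar> \<le> 3 \<longrightarrow> \<bar>val f x - val f y\<bar> \<le> real_of_rat \<epsilon>)"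
    and val_intermediate: "f \<in> V \<Longrightarrow> x \<in> U \<Longrightarrow> y \<in> U \<Longrightarrow> a < b \<Longrightarrow>
      val f x < of_rat a \<Longrightarrow> of_rat b < val f y \<Longrightarrow> \<exists>z\<in>U. of_rat a < val f z \<and> val f z < of_rat b"
    and val_separates: "x \<in> U \<Longrightarrow> y \<in> U \<Longrightarrow> \<not> le y x \<Longrightarrow>
      \<exists>f\<in>V. \<forall>u\<in>U. (le u x \<longrightarrow> val f u \<le> 0) \<and> (le y u \<longrightarrow> 1 \<le> val f u)"
    and val_mult: "f \<in> V \<Longrightarrow> g \<in> V \<Longrightarrow> 0 < \<epsilon> \<Longrightarrow>
      \<exists>k\<in>V. \<forall>u\<in>U. \<bar>val k u - val f u * val g u\<bar> \<le> real_of_rat \<epsilon>"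
    and wt_lower_bound: "\<exists>\<delta>>0. \<forall>u\<in>U. real_of_rat \<delta> \<le> wt u"
    and wt_approx: "0 < \<epsilon> \<Longrightarrow> \<exists>h\<in>V. \<forall>u\<in>U. \<bar>val h u - wt u\<bar> \<le> real_of_rat \<epsilon>"
    and norm_le_rat_iff: "f \<in> V \<Longrightarrow> nrm f \<le> of_rat q \<longleftrightarrow> (\<forall>u\<in>U. \<bar>val f u\<bar> \<le> of_rat q * wt u)"
begin

lemma le_refl: "u \<in> U \<Longrightarrow> le u u"
  using le_total by blast

lemma U_nonempty: "U \<noteq> {}"
  using le_nontrivial by blast

subsection \<open>The position of an evaluation\<close>

definition bound :: "nat \<Rightarrow> real" where
  "bound f = (SUP u\<in>U. \<bar>val f u\<bar>)"

definition run :: "nat \<Rightarrow> 'u \<Rightarrow> real" where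
  "run f u = (SUP v\<in>{v \<in> U. le v u}. val f v)"

definition coefficient :: "nat \<Rightarrow> real" where
  "coefficient f = (1 / 2) ^ f / (1 + bound f)"

definition summand :: "nat \<Rightarrow> 'u \<Rightarrow> real" where
  "summand f u = (if f \<in> V then coefficient f * run f u else 0)"

definition position :: "'u \<Rightarrow> real" where
  "position u = (\<Sum>f. summand f u)"

lemma abs_val_le_bound: "f \<in> V \<Longrightarrow> u \<in> U \<Longrightarrow> \<bar>val f u\<bar> \<le> bound f"
  unfolding bound_def using val_bounded[of f] by (auto intro!: cSUP_upper bdd_aboveI2)

lemma bound_nonneg: "f \<in> V \<Longrightarrow> 0 \<le> bound f"
  using U_nonempty abs_val_le_bound[of f] by fastforce

lemma coefficient_pos: "f \<in> V \<Longrightarrow> 0 < coefficient f"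
  using bound_nonneg[of f] by (simp add: coefficient_def)

lemma bdd_val:
  assumes "p \<in> V" "A \<subseteq> U"
  shows "bdd_above (val p ` A)" "bdd_below (val p ` A)"
  using abs_val_le_bound[OF assms(1)] assms(2)
  by (force intro: bdd_aboveI2[of _ _ "bound p"] bdd_belowI2[of _ "- bound p"])+

lemma val_le_run: "f \<in> V \<Longrightarrow> v \<in> U \<Longrightarrow> le v u \<Longrightarrow> val f v \<le> run f u"
  unfolding run_def by (rule cSUP_upper) (auto intro: bdd_val)

lemma run_leI:
  assumes "u \<in> U" "\<And>v. v \<in> U \<Longrightarrow> le v u \<Longrightarrow> val f v \<le> c"
  shows "run f u \<le> c"
  unfolding run_def by (rule cSUP_least) (use assms le_refl in auto)

lemma run_mono:
  assumes "f \<in> V" "x \<in> U" "y \<in> U" "le x y"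
  shows "run f x \<le> run f y"
  by (rule run_leI[OF assms(2)]) (use assms le_trans val_le_run in blast)

lemma abs_run_le_bound:
  assumes f: "f \<in> V" and u: "u \<in> U"
  shows "\<bar>run f u\<bar> \<le> bound f"
proof -
  have "run f u \<le> bound f" by (rule run_leI[OF u]) (use abs_val_le_bound[OF f] in force)
  moreover have "val f u \<le> run f u" using val_le_run[OF f u] le_refl[OF u] .
  ultimately show ?thesis using abs_val_le_bound[OF f u] by linarith
qed

lemma summand_mono: "x \<in> U \<Longrightarrow> y \<in> U \<Longrightarrow> le x y \<Longrightarrow> summand f x \<le> summand f y"
  using run_mono[of f x y] coefficient_pos[of f] by (simp add: summand_def)

lemma abs_summand_le: "u \<in> U \<Longrightarrow> \<bar>summand f u\<bar> \<le> (1 / 2) ^ f"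
proof (cases "f \<in> V")
  case True
  assume u: "u \<in> U"
  have "\<bar>summand f u\<bar> = coefficient f * \<bar>run f u\<bar>"
    using True coefficient_pos[OF True] by (simp add: summand_def abs_mult)
  also have "\<dots> \<le> coefficient f * (1 + bound f)"
    using abs_run_le_bound[OF True u] coefficient_pos[OF True] by simp
  also have "\<dots> = (1 / 2) ^ f" using bound_nonneg[OF True] by (simp add: coefficient_def)
  finally show ?thesis .
qed (simp add: summand_def)

lemma summable_half_power: "summable (\<lambda>n. (1 / 2 :: real) ^ n)"
  by (rule summable_geometric) simp

lemma summable_summand: "u \<in> U \<Longrightarrow> summable (\<lambda>f. summand f u)"
  by (rule summable_comparison_test'[OF summable_half_power, of 0]) (simp add: abs_summand_le)

lemma position_diff:
  "x \<in> U \<Longrightarrow> y \<in> U \<Longrightarrow> position y - position x = (\<Sum>f. summand f y - summand f x)"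
  unfolding position_def by (intro suminf_diff summable_summand)

lemma summand_diff_le_position_diff:
  assumes "x \<in> U" "y \<in> U" "le x y"
  shows "summand f y - summand f x \<le> position y - position x"
  using sum_le_suminf[OF summable_diff[OF summable_summand[OF assms(2)]
    summable_summand[OF assms(1)]], of "{f}"]
    summand_mono[OF assms] by (simp add: position_diff[OF assms(1,2)])

lemma position_mono: "x \<in> U \<Longrightarrow> y \<in> U \<Longrightarrow> le x y \<Longrightarrow> position x \<le> position y"
  using summand_diff_le_position_diff[of x y undefined] summand_mono[of x y undefined] by linarith

lemma le_if_position_less: "x \<in> U \<Longrightarrow> y \<in> U \<Longrightarrow> position x < position y \<Longrightarrow> le x y"
  using position_mono[of y x] le_total[of x y] by fastforce

lemma position_gap:
  assumes f: "f \<in> V" and c_pos: "0 < c"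
  obtains \<eta> where "0 < \<eta>"
    "\<And>x y. x \<in> U \<Longrightarrow> y \<in> U \<Longrightarrow> le x y \<Longrightarrow> c \<le> run f y - run f x \<Longrightarrow> \<eta> \<le> position y - position x"
proof (rule that)
  show "0 < coefficient f * c" using coefficient_pos[OF f] c_pos by simp
  fix x y assume xy: "x \<in> U" "y \<in> U" "le x y" "c \<le> run f y - run f x"
  have "coefficient f * c \<le> coefficient f * (run f y - run f x)"
    using coefficient_pos[OF f] xy(4) by simp
  also have "\<dots> = summand f y - summand f x" using f by (simp add: summand_def right_diff_distrib)
  also have "\<dots> \<le> position y - position x" by (rule summand_diff_le_position_diff[OF xy(1-3)])
  finally show "coefficient f * c \<le> position y - position x" .
qed

lemma position_strict:
  assumes xy: "x \<in> U" "y \<in> U" "\<not> le y x"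
  shows "position x < position y"
proof -
  obtain f where f: "f \<in> V" "\<forall>u\<in>U. (le u x \<longrightarrow> val f u \<le> 0) \<and> (le y u \<longrightarrow> 1 \<le> val f u)"
    using val_separates[OF xy] by blast
  obtain \<eta> where \<eta>: "0 < \<eta>"
    "\<And>x y. x \<in> U \<Longrightarrow> y \<in> U \<Longrightarrow> le x y \<Longrightarrow> 1 \<le> run f y - run f x \<Longrightarrow> \<eta> \<le> position y - position x"
    using position_gap[OF f(1) zero_less_one] by blast
  have "run f x \<le> 0" by (rule run_leI[OF xy(1)]) (use f(2) in blast)
  moreover have "1 \<le> run f y"
    using f(2) xy(2) le_refl[OF xy(2)] val_le_run[OF f(1) xy(2), of y] by force
  moreover have "le x y" using le_total[OF xy(1,2)] xy(3) by blast
  ultimately show ?thesis using \<eta>(1) \<eta>(2)[OF xy(1,2)] by linarith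
qed

lemma val_controlled_real:
  assumes f: "f \<in> V" and "0 < \<epsilon>"
  obtains p where "p \<in> V"
    "\<And>x y. x \<in> U \<Longrightarrow> y \<in> U \<Longrightarrow> le x y \<Longrightarrow> val p x \<le> val p y + 1"
    "\<And>x y. x \<in> U \<Longrightarrow> y \<in> U \<Longrightarrow> \<bar>val p x - val p y\<bar> \<le> 3 \<Longrightarrow> \<bar>val f x - val f y\<bar> < \<epsilon>"
proof -
  obtain q where q_bounds: "0 < real_of_rat q" "of_rat q < \<epsilon>"
    using of_rat_dense[OF \<open>0 < \<epsilon>\<close>] by blast
  then have "0 < q" by simp
  from val_controlled[OF f this] obtain p where "p \<in> V"
    "\<forall>x\<in>U. \<forall>y\<in>U. le x y \<longrightarrow> val p x \<le> val p y + 1"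
    "\<forall>x\<in>U. \<forall>y\<in>U. \<bar>val p x - val p y\<bar> \<le> 3 \<longrightarrow> \<bar>val f x - val f y\<bar> \<le> real_of_rat q"
    by blast
  with q_bounds(2) show ?thesis by (intro that[of p]) (force intro: le_less_trans)+
qed

lemma val_uniformly_continuous:
  assumes f: "f \<in> V" and \<epsilon>: "0 < \<epsilon>"
  shows "\<exists>\<eta>>0. \<forall>x\<in>U. \<forall>y\<in>U. \<bar>position x - position y\<bar> < \<eta> \<longrightarrow> \<bar>val f x - val f y\<bar> < \<epsilon>"
proof -
  obtain p where p: "p \<in> V"
    and almost_mono: "\<And>x y. x \<in> U \<Longrightarrow> y \<in> U \<Longrightarrow> le x y \<Longrightarrow> val p x \<le> val p y + 1"
    and control: "\<And>x y. x \<in> U \<Longrightarrow> y \<in> U \<Longrightarrow> \<bar>val p x - val p y\<bar> \<le> 3 \<Longrightarrow> \<bar>val f x - val f y\<bar> < \<epsilon>"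
    using val_controlled_real[OF f \<epsilon>] by blast
  obtain \<eta> where \<eta>: "0 < \<eta>"
    "\<And>x y. x \<in> U \<Longrightarrow> y \<in> U \<Longrightarrow> le x y \<Longrightarrow> 2 \<le> run p y - run p x \<Longrightarrow> \<eta> \<le> position y - position x"
    using position_gap[OF p, of 2] by auto
  have near: "\<bar>val p x - val p y\<bar> \<le> 3"
    if xy: "x \<in> U" "y \<in> U" "le x y" "position y - position x < \<eta>" for x y
  proof -
    have "run p x \<le> val p x + 1" by (rule run_leI[OF xy(1)]) (use almost_mono xy(1) in blast)
    moreover have "val p y \<le> run p y" using val_le_run[OF p xy(2)] le_refl[OF xy(2)] .
    moreover have "run p y - run p x < 2" using \<eta>(2)[OF xy(1-3)] xy(4) by linarith
    ultimately show ?thesis using almost_mono[OF xy(1-3)] by linarith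
  qed
  have "\<bar>val f x - val f y\<bar> < \<epsilon>" if xy: "x \<in> U" "y \<in> U" "\<bar>position x - position y\<bar> < \<eta>" for x y
    using le_total[OF xy(1,2)]
  proof
    assume "le x y"
    with near[OF xy(1,2)] control[OF xy(1,2)] xy(3) show ?thesis by fastforce
  next
    assume "le y x"
    with near[OF xy(2,1)] control[OF xy(2,1)] xy(3)
    show ?thesis by (fastforce simp: abs_minus_commute)
  qed
  with \<eta>(1) show ?thesis by blast
qed

subsection \<open>The positions are dense in an interval\<close>

text \<open>
  At a Dedekind cut of \<open>U\<close> the almost monotone function \<open>p\<close> that controls \<open>f\<close> cannot jump, by the
  intermediate value property.
\<close>

lemma INF_val_le_SUP_val_at_cut:
  assumes A: "A \<subseteq> U" "A \<noteq> {}" and B: "B \<subseteq> U" "B \<noteq> {}" and AB: "U \<subseteq> A \<union> B" and p: "p \<in> V"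
  shows "(INF b\<in>B. val p b) \<le> (SUP a\<in>A. val p a)"
proof (rule ccontr)
  assume "\<not> ?thesis"
  then obtain q where q_bounds: "(SUP a\<in>A. val p a) < of_rat q" "real_of_rat q < (INF b\<in>B. val p b)"
    using of_rat_dense by (meson not_le)
  then obtain r where r_bounds: "real_of_rat q < of_rat r" "real_of_rat r < (INF b\<in>B. val p b)"
    using of_rat_dense by blast
  have upper: "val p x < of_rat q" if "x \<in> A" for x
    using cSUP_upper[OF that bdd_val(1)[OF p A(1)]] q_bounds(1) by linarith
  have lower: "of_rat r < val p y" if "y \<in> B" for y
    using cINF_lower[OF bdd_val(2)[OF p B(1)] that] r_bounds(2) by linarith
  obtain x y where xy: "x \<in> A" "y \<in> B" using A(2) B(2) by blast
  then have "x \<in> U" "y \<in> U" "q < r" using A(1) B(1) r_bounds(1) by (auto simp: of_rat_less)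
  then obtain z where "z \<in> U" "of_rat q < val p z" "val p z < of_rat r"
    using val_intermediate[OF p] upper[OF xy(1)] lower[OF xy(2)] by blast
  then show False using AB upper[of z] lower[of z] by fastforce
qed

lemma oscillation_at_cut:
  assumes A: "A \<subseteq> U" "A \<noteq> {}" and B: "B \<subseteq> U" "B \<noteq> {}" and AB: "U \<subseteq> A \<union> B"
    and f: "f \<in> V" and \<epsilon>: "0 < \<epsilon>"
  obtains x y where "x \<in> A" "y \<in> B"
    "\<And>v. v \<in> U \<Longrightarrow> le x v \<Longrightarrow> le v y \<Longrightarrow> \<bar>val f v - val f x\<bar> < \<epsilon>"
proof -
  obtain p where p: "p \<in> V"
    and almost_mono: "\<And>x y. x \<in> U \<Longrightarrow> y \<in> U \<Longrightarrow> le x y \<Longrightarrow> val p x \<le> val p y + 1"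
    and control: "\<And>x y. x \<in> U \<Longrightarrow> y \<in> U \<Longrightarrow> \<bar>val p x - val p y\<bar> \<le> 3 \<Longrightarrow> \<bar>val f x - val f y\<bar> < \<epsilon>"
    using val_controlled_real[OF f \<epsilon>] by blast
  define s i where "s = (SUP a\<in>A. val p a)" and "i = (INF b\<in>B. val p b)"
  have "i \<le> s" unfolding s_def i_def by (rule INF_val_le_SUP_val_at_cut[OF A B AB p])
  obtain x where x: "x \<in> A" "s - 1 < val p x"
    using less_cSUP_iff[OF A(2) bdd_val(1)[OF p A(1)], of "s - 1"] by (auto simp: s_def)
  obtain y where y: "y \<in> B" "val p y < i + 1"
    using cINF_less_iff[OF B(2) bdd_val(2)[OF p B(1)], of "i + 1"] by (auto simp: i_def)
  have U: "x \<in> U" "y \<in> U" using x(1) y(1) A(1) B(1) by auto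
  have "val p x \<le> s" unfolding s_def by (rule cSUP_upper[OF x(1) bdd_val(1)[OF p A(1)]])
  show ?thesis
  proof (rule that[OF x(1) y(1)])
    fix v assume v: "v \<in> U" "le x v" "le v y"
    have "val p v \<le> val p y + 1" "val p x \<le> val p v + 1" using almost_mono U v by auto
    then have "\<bar>val p v - val p x\<bar> \<le> 3" using x(2) y(2) \<open>val p x \<le> s\<close> \<open>i \<le> s\<close> by linarith
    then show "\<bar>val f v - val f x\<bar> < \<epsilon>" by (rule control[OF v(1) U(1)])
  qed
qed

lemma run_at_cut:
  assumes A: "A \<subseteq> U" "A \<noteq> {}" and B: "B \<subseteq> U" "B \<noteq> {}" and AB: "U \<subseteq> A \<union> B"
    and cut: "\<And>x y. x \<in> A \<Longrightarrow> y \<in> B \<Longrightarrow> le x y" and f: "f \<in> V" and \<epsilon>: "0 < \<epsilon>"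
  shows "\<exists>x\<in>A. \<exists>y\<in>B. run f y \<le> run f x + \<epsilon>"
proof -
  obtain x y where x: "x \<in> A" and y: "y \<in> B"
    and osc: "\<And>v. v \<in> U \<Longrightarrow> le x v \<Longrightarrow> le v y \<Longrightarrow> \<bar>val f v - val f x\<bar> < \<epsilon>"
    using oscillation_at_cut[OF A B AB f \<epsilon>] by blast
  have U: "x \<in> U" "y \<in> U" using x y A(1) B(1) by auto
  have "run f y \<le> run f x + \<epsilon>"
  proof (rule run_leI[OF U(2)])
    fix v assume v: "v \<in> U" "le v y"
    show "val f v \<le> run f x + \<epsilon>"
      using le_total[OF v(1) U(1)]
    proof
      assume "le v x"
      then show ?thesis using val_le_run[OF f v(1)] \<epsilon> by fastforce
    next
      assume "le x v"
      then show ?thesis using osc[OF v(1) _ v(2)] val_le_run[OF f U(1) le_refl[OF U(1)]]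
        by fastforce
    qed
  qed
  with x y show ?thesis by blast
qed

definition cut_filter :: "'u set \<Rightarrow> 'u set \<Rightarrow> ('u \<times> 'u) filter" where
  "cut_filter A B = (INF p\<in>A \<times> B. principal {q \<in> A \<times> B. le (fst p) (fst q) \<and> le (snd q) (snd p)})"

lemma eventually_cut_filter:
  assumes A: "A \<subseteq> U" "A \<noteq> {}" and B: "B \<subseteq> U" "B \<noteq> {}"
  shows "eventually Q (cut_filter A B) \<longleftrightarrow>
    (\<exists>x\<in>A. \<exists>y\<in>B. \<forall>x'\<in>A. \<forall>y'\<in>B. le x x' \<longrightarrow> le y' y \<longrightarrow> Q (x', y'))"
proof -
  let ?S = "\<lambda>p. {q \<in> A \<times> B. le (fst p) (fst q) \<and> le (snd q) (snd p)}"
  have "eventually Q (cut_filter A B) \<longleftrightarrow> (\<exists>p\<in>A \<times> B. eventually Q (principal (?S p)))"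
    unfolding cut_filter_def
  proof (rule eventually_INF_base)
    fix p p' assume p: "p \<in> A \<times> B" "p' \<in> A \<times> B"
    then have U: "fst p \<in> U" "fst p' \<in> U" "snd p \<in> U" "snd p' \<in> U" using A(1) B(1) by auto
    define q where "q = (if le (fst p) (fst p') then fst p' else fst p,
      if le (snd p) (snd p') then snd p else snd p')"
    have "q \<in> A \<times> B" "le (fst p) (fst q)" "le (fst p') (fst q)" "le (snd q) (snd p)"
      "le (snd q) (snd p')"
      using p le_total[OF U(1,2)] le_total[OF U(3,4)] le_refl U by (auto simp: q_def)
    moreover from this have "?S q \<subseteq> ?S p \<inter> ?S p'"
      using p A(1) B(1) U le_trans[of "fst p" "fst q"] le_trans[of "fst p'" "fst q"]
        le_trans[of _ "snd q" "snd p"] le_trans[of _ "snd q" "snd p'"] by (auto simp: subset_iff)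
    ultimately show "\<exists>q\<in>A \<times> B. principal (?S q) \<le> inf (principal (?S p)) (principal (?S p'))"
      by (intro bexI[of _ q]) (auto simp: inf_principal)
  qed (use A B in auto)
  also have "\<dots> \<longleftrightarrow> (\<exists>x\<in>A. \<exists>y\<in>B. \<forall>x'\<in>A. \<forall>y'\<in>B. le x x' \<longrightarrow> le y' y \<longrightarrow> Q (x', y'))"
    unfolding eventually_principal by fastforce
  finally show ?thesis .
qed

lemma summand_at_cut:
  assumes A: "A \<subseteq> U" "A \<noteq> {}" and B: "B \<subseteq> U" "B \<noteq> {}" and AB: "U \<subseteq> A \<union> B"
    and cut: "\<And>x y. x \<in> A \<Longrightarrow> y \<in> B \<Longrightarrow> le x y" and \<epsilon>: "0 < \<epsilon>"
  shows "\<exists>x\<in>A. \<exists>y\<in>B. summand f y - summand f x < \<epsilon>"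
proof (cases "f \<in> V")
  case True
  have pos: "0 < coefficient f" using coefficient_pos[OF True] .
  then have "0 < \<epsilon> / (2 * coefficient f)" using \<epsilon> by simp
  then obtain x y where xy: "x \<in> A" "y \<in> B" "run f y \<le> run f x + \<epsilon> / (2 * coefficient f)"
    using run_at_cut[OF A B AB cut True] by blast
  from xy(3) have "coefficient f * run f y \<le> coefficient f * (run f x + \<epsilon> / (2 * coefficient f))"
    using pos by simp
  also have "\<dots> = coefficient f * run f x + \<epsilon> / 2" using pos by (simp add: field_simps)
  finally have "summand f y - summand f x < \<epsilon>" using True \<epsilon> by (simp add: summand_def)
  with xy(1,2) show ?thesis by blast
qed (use A B \<epsilon> in \<open>auto simp: summand_def\<close>)

lemma summand_diff_tendsto_at_cut:
  assumes A: "A \<subseteq> U" "A \<noteq> {}" and B: "B \<subseteq> U" "B \<noteq> {}" and AB: "U \<subseteq> A \<union> B"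
    and cut: "\<And>x y. x \<in> A \<Longrightarrow> y \<in> B \<Longrightarrow> le x y"
  shows "((\<lambda>p. summand f (snd p) - summand f (fst p)) \<longlongrightarrow> 0) (cut_filter A B)"
proof (rule tendstoI)
  fix \<epsilon> :: real assume "0 < \<epsilon>"
  then obtain x y where xy: "x \<in> A" "y \<in> B" "summand f y - summand f x < \<epsilon>"
    using summand_at_cut[OF A B AB cut] by blast
  have "dist (summand f y' - summand f x') 0 < \<epsilon>"
    if "x' \<in> A" "y' \<in> B" "le x x'" "le y' y" for x' y'
  proof -
    have U: "x \<in> U" "x' \<in> U" "y \<in> U" "y' \<in> U" using xy that A(1) B(1) by auto
    have "summand f y' - summand f x' < \<epsilon>"
      using summand_mono[OF U(1,2) that(3)] summand_mono[OF U(4,3) that(4)] xy(3)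
      by (meson add_less_cancel_left diff_mono le_less_trans)
    moreover have "summand f x' \<le> summand f y'" by (rule summand_mono[OF U(2,4) cut[OF that(1,2)]])
    ultimately show ?thesis by simp
  qed
  with xy(1,2)
  show "\<forall>\<^sub>F p in cut_filter A B. dist (summand f (snd p) - summand f (fst p)) 0 < \<epsilon>"
    unfolding eventually_cut_filter[OF A B] by force
qed

lemma position_at_cut:
  assumes A: "A \<subseteq> U" "A \<noteq> {}" and B: "B \<subseteq> U" "B \<noteq> {}" and AB: "U \<subseteq> A \<union> B"
    and cut: "\<And>x y. x \<in> A \<Longrightarrow> y \<in> B \<Longrightarrow> le x y" and \<eta>: "0 < \<eta>"
  shows "\<exists>x\<in>A. \<exists>y\<in>B. position y - position x < \<eta>"
proof -
  let ?F = "cut_filter A B"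
  define a where "a = (\<lambda>f p. summand f (snd p) - summand f (fst p))"
  note eventually_F = eventually_cut_filter[OF A B]
  have "\<forall>\<^sub>F (f, p) in at_top \<times>\<^sub>F ?F. norm (a f p) \<le> 2 * (1 / 2) ^ f"
  proof -
    have "\<bar>summand f y - summand f x\<bar> \<le> 2 * (1 / 2) ^ f" if "x \<in> A" "y \<in> B" for f x y
    proof -
      have "\<bar>summand f x\<bar> \<le> (1 / 2) ^ f" "\<bar>summand f y\<bar> \<le> (1 / 2) ^ f"
        using abs_summand_le A(1) B(1) that by blast+
      then show ?thesis by linarith
    qed
    then have "\<forall>\<^sub>F p in ?F. \<forall>f. norm (a f p) \<le> 2 * (1 / 2) ^ f"
      unfolding eventually_F a_def using A(2) B(2) by fastforce
    with always_eventually have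
      "\<forall>\<^sub>F x in at_top \<times>\<^sub>F ?F. True \<and> (\<forall>f. norm (a f (snd x)) \<le> 2 * (1 / 2) ^ f)"
      by (rule eventually_prodI) simp
    then show ?thesis by (rule eventually_mono) auto
  qed
  moreover have "(a f \<longlongrightarrow> 0) ?F" for f
    unfolding a_def by (rule summand_diff_tendsto_at_cut[OF A B AB cut])
  moreover have "summable (\<lambda>f. 2 * (1 / 2 :: real) ^ f)"
    by (intro summable_mult summable_half_power)
  moreover have "?F \<noteq> bot"
    using A B cut by (auto simp: trivial_limit_def eventually_F intro: le_refl)
  ultimately have "((\<lambda>p. \<Sum>f. a f p) \<longlongrightarrow> (\<Sum>f::nat. 0)) ?F"
    using tannerys_theorem[of a "\<lambda>_. 0" ?F "\<lambda>f. 2 * (1 / 2) ^ f"] by simp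
  then have "\<forall>\<^sub>F p in ?F. (\<Sum>f. a f p) < \<eta>" using \<eta> by (intro order_tendstoD) auto
  then obtain x y where xy: "x \<in> A" "y \<in> B" "(\<Sum>f. a f (x, y)) < \<eta>"
    unfolding eventually_F using A(1) B(1) le_refl by blast
  have "position y - position x < \<eta>"
    using position_diff[of x y] xy(3) subsetD[OF A(1) xy(1)] subsetD[OF B(1) xy(2)]
    by (simp add: a_def)
  with xy(1,2) show ?thesis by blast
qed

definition lo :: real where "lo = Inf (position ` U)"
definition hi :: real where "hi = Sup (position ` U)"

lemma abs_position_le: "u \<in> U \<Longrightarrow> \<bar>position u\<bar> \<le> 2"
  using norm_suminf_le[of "\<lambda>f. summand f u", OF _ summable_half_power]
    suminf_geometric[of "1 / 2 :: real"]
  by (simp add: position_def abs_summand_le)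

lemma bdd_position: "bdd_below (position ` U)" "bdd_above (position ` U)"
  using abs_position_le by (force intro: bdd_belowI2[of _ "- 2"] bdd_aboveI2[of _ _ 2])+

lemma position_in: "u \<in> U \<Longrightarrow> position u \<in> {lo..hi}"
  unfolding lo_def hi_def using bdd_position by (auto intro: cInf_lower cSup_upper)

lemma lo_less_hi: "lo < hi"
proof -
  obtain x y where "x \<in> U" "y \<in> U" "\<not> le y x" using le_nontrivial by blast
  then show ?thesis using position_strict[of x y] position_in[of x] position_in[of y] by auto
qed

lemma position_dense:
  assumes s: "s \<in> {lo..hi}" and \<eta>: "0 < \<eta>"
  shows "\<exists>u\<in>U. \<bar>position u - s\<bar> < \<eta>"
proof (rule ccontr)
  assume "\<not> ?thesis"
  then have far: "position u \<le> s - \<eta> \<or> s + \<eta> \<le> position u" if "u \<in> U" for u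
    using that by (fastforce simp: abs_if split: if_splits)
  define A B where "A = {u \<in> U. position u < s}" and "B = {u \<in> U. s < position u}"
  have "A \<noteq> {}"
  proof
    assume "A = {}"
    then have "s + \<eta> \<le> position u" if "u \<in> U" for u using far[OF that] that \<eta> by (auto simp: A_def)
    then have "s + \<eta> \<le> lo" unfolding lo_def using U_nonempty by (intro cINF_greatest)
    with s \<eta> show False by simp
  qed
  moreover have "B \<noteq> {}"
  proof
    assume "B = {}"
    then have "position u \<le> s - \<eta>" if "u \<in> U" for u using far[OF that] that \<eta> by (auto simp: B_def)
    then have "hi \<le> s - \<eta>" unfolding hi_def using U_nonempty by (intro cSUP_least)
    with s \<eta> show False by simp
  qed
  moreover have "U \<subseteq> A \<union> B" using far \<eta> unfolding A_def B_def by force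
  moreover have "le x y" if "x \<in> A" "y \<in> B" for x y
    using that le_if_position_less[of x y] by (auto simp: A_def B_def)
  ultimately obtain x y where "x \<in> A" "y \<in> B" "position y - position x < \<eta>"
    using position_at_cut[of A B \<eta>] \<eta> by (auto simp: A_def B_def)
  then show False using far[of x] far[of y] \<eta> by (auto simp: A_def B_def)
qed

lemma closure_positions: "closure (position ` U) = {lo..hi}"
proof
  show "closure (position ` U) \<subseteq> {lo..hi}" by (rule closure_minimal) (use position_in in auto)
  show "{lo..hi} \<subseteq> closure (position ` U)"
    using position_dense by (auto simp: closure_approachable dist_real_def)
qed

end

context evaluations
begin

subsection \<open>Extension to the interval\<close>

lemma wt_uniformly_continuous:
  assumes "0 < \<epsilon>"
  shows "\<exists>\<eta>>0. \<forall>x\<in>U. \<forall>y\<in>U. \<bar>position x - position y\<bar> < \<eta> \<longrightarrow> \<bar>wt x - wt y\<bar> < \<epsilon>"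
proof -
  obtain q where q_bounds: "0 < real_of_rat q" "of_rat q < \<epsilon> / 3"
    using of_rat_dense[of 0 "\<epsilon> / 3"] assms by auto
  then obtain h where h: "h \<in> V" "\<forall>u\<in>U. \<bar>val h u - wt u\<bar> \<le> of_rat q"
    using wt_approx[of q] by auto
  obtain \<eta> where \<eta>: "0 < \<eta>"
    "\<forall>x\<in>U. \<forall>y\<in>U. \<bar>position x - position y\<bar> < \<eta> \<longrightarrow> \<bar>val h x - val h y\<bar> < \<epsilon> / 3"
    using val_uniformly_continuous[OF h(1), of "\<epsilon> / 3"] assms by auto
  have "\<bar>wt x - wt y\<bar> < \<epsilon>" if xy: "x \<in> U" "y \<in> U" "\<bar>position x - position y\<bar> < \<eta>" for x y
  proof -
    have "\<bar>val h x - val h y\<bar> < \<epsilon> / 3" using \<eta>(2) xy by blast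
    moreover have "\<bar>val h x - wt x\<bar> \<le> of_rat q" "\<bar>val h y - wt y\<bar> \<le> of_rat q" using h(2) xy by auto
    ultimately show ?thesis using q_bounds(2) by linarith
  qed
  with \<eta>(1) show ?thesis by blast
qed

abbreviation interval :: "real set" where
  "interval \<equiv> {lo..hi}"

definition extension :: "('u \<Rightarrow> real) \<Rightarrow> real \<Rightarrow> real" where
  "extension h = (SOME g. continuous_on interval g \<and> (\<forall>u\<in>U. g (position u) = h u))"

lemma
  assumes "\<And>\<epsilon>. 0 < \<epsilon> \<Longrightarrow>
    \<exists>\<eta>>0. \<forall>x\<in>U. \<forall>y\<in>U. \<bar>position x - position y\<bar> < \<eta> \<longrightarrow> \<bar>h x - h y\<bar> < \<epsilon>"
  shows continuous_on_extension: "continuous_on interval (extension h)"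
    and extension_position: "u \<in> U \<Longrightarrow> extension h (position u) = h u"
proof -
  obtain g where "continuous_on (closure (position ` U)) g" "\<And>u. u \<in> U \<Longrightarrow> g (position u) = h u"
    using uniformly_continuous_factorization[of U position h] assms by (auto simp: dist_real_def)
  then have "\<exists>g. continuous_on interval g \<and> (\<forall>u\<in>U. g (position u) = h u)"
    by (auto simp: closure_positions)
  from someI_ex[OF this]
  show "continuous_on interval (extension h)" "u \<in> U \<Longrightarrow> extension h (position u) = h u"
    by (auto simp: extension_def)
qed

abbreviation val_ext :: "nat \<Rightarrow> real \<Rightarrow> real" where
  "val_ext f \<equiv> extension (val f)"

abbreviation wt_ext :: "real \<Rightarrow> real" where
  "wt_ext \<equiv> extension wt"

lemma continuous_on_val_ext: "f \<in> V \<Longrightarrow> continuous_on interval (val_ext f)"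
  by (rule continuous_on_extension[OF val_uniformly_continuous])

lemma val_ext_position: "f \<in> V \<Longrightarrow> u \<in> U \<Longrightarrow> val_ext f (position u) = val f u"
  by (rule extension_position[OF val_uniformly_continuous])

lemma continuous_on_wt_ext: "continuous_on interval wt_ext"
  by (rule continuous_on_extension[OF wt_uniformly_continuous])

lemma wt_ext_position: "u \<in> U \<Longrightarrow> wt_ext (position u) = wt u"
  by (rule extension_position[OF wt_uniformly_continuous])

lemma interval_leI:
  assumes "continuous_on interval g" "continuous_on interval h"
    and "\<And>u. u \<in> U \<Longrightarrow> g (position u) \<le> h (position u)" and "s \<in> interval"
  shows "g s \<le> (h s :: real)"
proof -
  have "g s - h s \<le> 0"
    by (rule continuous_le_on_closure[of "position ` U" "\<lambda>s. g s - h s"])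
      (use assms in \<open>auto simp: closure_positions intro!: continuous_intros\<close>)
  then show ?thesis by simp
qed

lemma interval_eqI:
  assumes "continuous_on interval g" "continuous_on interval h"
    and "\<And>u. u \<in> U \<Longrightarrow> g (position u) = h (position u)" and "s \<in> interval"
  shows "g s = (h s :: real)"
  using interval_leI[of g h s] interval_leI[of h g s] assms by fastforce

lemma interval_le_iff:
  fixes g h :: "real \<Rightarrow> real"
  assumes "continuous_on interval g" "continuous_on interval h"
  shows "(\<forall>s\<in>interval. g s \<le> h s) \<longleftrightarrow> (\<forall>u\<in>U. g (position u) \<le> h (position u))"
  using interval_leI[OF assms] position_in by blast

lemma val_ext_add:
  assumes "f \<in> V" "g \<in> V" "s \<in> interval"
  shows "val_ext (add f g) s = val_ext f s + val_ext g s"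
  by (rule interval_eqI)
    (use assms in \<open>auto intro!: continuous_intros continuous_on_val_ext
      simp: val_ext_position val_add\<close>)

lemma val_ext_scale:
  assumes "f \<in> V" "s \<in> interval"
  shows "val_ext (scale q f) s = of_rat q * val_ext f s"
  by (rule interval_eqI)
    (use assms in \<open>auto intro!: continuous_intros continuous_on_val_ext
      simp: val_ext_position val_scale\<close>)

lemma val_ext_e: "s \<in> interval \<Longrightarrow> val_ext e s = 1"
  by (rule interval_eqI)
    (auto intro!: continuous_intros continuous_on_val_ext e_in simp: val_ext_position e_in val_e)

lemma wt_ext_lower_bound: "\<exists>\<delta>>0. \<forall>s\<in>interval. \<delta> \<le> wt_ext s"
proof -
  obtain \<delta> where \<delta>: "0 < \<delta>" "\<forall>u\<in>U. real_of_rat \<delta> \<le> wt u" using wt_lower_bound by blast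
  then have "\<forall>s\<in>interval. real_of_rat \<delta> \<le> wt_ext s"
    by (subst interval_le_iff)
      (auto intro!: continuous_intros continuous_on_wt_ext simp: wt_ext_position)
  with \<delta>(1) show ?thesis by (intro exI[of _ "of_rat \<delta>"]) simp
qed

lemma norm_le_rat_iff_ext:
  assumes f: "f \<in> V"
  shows "nrm f \<le> of_rat q \<longleftrightarrow> (\<forall>s\<in>interval. \<bar>val_ext f s\<bar> \<le> of_rat q * wt_ext s)"
proof -
  have "(\<forall>s\<in>interval. \<bar>val_ext f s\<bar> \<le> of_rat q * wt_ext s) \<longleftrightarrow> (\<forall>u\<in>U. \<bar>val f u\<bar> \<le> of_rat q * wt u)"
    by (subst interval_le_iff)
      (auto intro!: continuous_intros continuous_on_val_ext continuous_on_wt_ext f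
        simp: val_ext_position wt_ext_position f)
  with norm_le_rat_iff[OF f] show ?thesis by simp
qed

lemma norm_le_iff_ext:
  assumes f: "f \<in> V"
  shows "nrm f \<le> c \<longleftrightarrow> (\<forall>s\<in>interval. \<bar>val_ext f s / wt_ext s\<bar> \<le> c)"
proof -
  have pos: "0 < wt_ext s" if "s \<in> interval" for s using wt_ext_lower_bound that by fastforce
  have rat: "nrm f \<le> of_rat q \<longleftrightarrow> (\<forall>s\<in>interval. \<bar>val_ext f s / wt_ext s\<bar> \<le> of_rat q)" for q
    unfolding norm_le_rat_iff_ext[OF f]
  proof (intro ball_cong refl)
    fix s assume "s \<in> interval"
    note pos[OF this]
    then show "\<bar>val_ext f s\<bar> \<le> of_rat q * wt_ext s \<longleftrightarrow> \<bar>val_ext f s / wt_ext s\<bar> \<le> of_rat q"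
      by (simp add: abs_div_pos[symmetric] pos_divide_le_eq)
  qed
  show ?thesis
  proof (intro iffI ballI)
    fix s assume "nrm f \<le> c" and s: "s \<in> interval"
    then have "nrm f \<le> real_of_rat q" if "c < of_rat q" for q using that by simp
    with rat s show "\<bar>val_ext f s / wt_ext s\<bar> \<le> c" by (blast intro: le_if_le_greater_rat)
  next
    assume quotient_le: "\<forall>s\<in>interval. \<bar>val_ext f s / wt_ext s\<bar> \<le> c"
    have "nrm f \<le> of_rat q" if "c < real_of_rat q" for q
      unfolding rat using quotient_le that by fastforce
    then show "nrm f \<le> c" by (rule le_if_le_greater_rat)
  qed
qed

subsection \<open>The extensions are dense in the continuous functions\<close>

definition approximable :: "(real \<Rightarrow> real) set" where
  "approximable = {g. continuous_on interval g \<and>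
    (\<forall>\<epsilon>>0. \<exists>f\<in>V. \<forall>s\<in>interval. \<bar>val_ext f s - g s\<bar> < \<epsilon>)}"

lemma approximable_uniform_limit:
  assumes "g \<in> approximable"
  obtains x where "\<And>n. x n \<in> V" "uniform_limit interval (\<lambda>n. val_ext (x n)) g sequentially"
proof -
  have "\<exists>f\<in>V. \<forall>s\<in>interval. \<bar>val_ext f s - g s\<bar> < 1 / real (Suc n)" for n
    using assms by (simp add: approximable_def)
  then obtain x where x: "x n \<in> V" "\<forall>s\<in>interval. \<bar>val_ext (x n) s - g s\<bar> < 1 / real (Suc n)" for n
    by metis
  have "uniform_limit interval (\<lambda>n. val_ext (x n)) g sequentially"
    unfolding uniform_limit_iff
  proof (intro allI impI)
    fix \<epsilon> :: real assume "0 < \<epsilon>"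
    from order_tendstoD(2)[OF LIMSEQ_Suc[OF lim_1_over_n] this]
    show "\<forall>\<^sub>F n in sequentially. \<forall>s\<in>interval. dist (val_ext (x n) s) (g s) < \<epsilon>"
      by (rule eventually_mono) (use x(2) in \<open>force simp: dist_real_def intro: less_trans\<close>)
  qed
  with x(1) show ?thesis by (rule that)
qed

lemma approximable_add:
  assumes "g \<in> approximable" "h \<in> approximable"
  shows "(\<lambda>s. g s + h s) \<in> approximable"
proof -
  obtain x where x: "\<And>n. x n \<in> V" "uniform_limit interval (\<lambda>n. val_ext (x n)) g sequentially"
    using approximable_uniform_limit[OF assms(1)] by blast
  obtain y where y: "\<And>n. y n \<in> V" "uniform_limit interval (\<lambda>n. val_ext (y n)) h sequentially"
    using approximable_uniform_limit[OF assms(2)] by blast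
  have "\<exists>f\<in>V. \<forall>s\<in>interval. \<bar>val_ext f s - (g s + h s)\<bar> < \<epsilon>" if "0 < \<epsilon>" for \<epsilon>
  proof -
    have "\<forall>\<^sub>F n in sequentially. \<forall>s\<in>interval.
        dist (val_ext (x n) s + val_ext (y n) s) (g s + h s) < \<epsilon>"
      by (rule uniform_limitD[OF uniform_limit_add[OF x(2) y(2)] that])
    then obtain n where "\<forall>s\<in>interval. dist (val_ext (x n) s + val_ext (y n) s) (g s + h s) < \<epsilon>"
      using eventually_happens by fastforce
    then show ?thesis
      using x(1) y(1) by (intro bexI[of _ "add (x n) (y n)"]) (auto simp: val_ext_add dist_real_def)
  qed
  with assms show ?thesis by (auto simp: approximable_def intro!: continuous_intros)
qed

lemma val_ext_mult:
  assumes "f \<in> V" "g \<in> V" "0 < \<epsilon>"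
  shows "\<exists>k\<in>V. \<forall>s\<in>interval. \<bar>val_ext k s - val_ext f s * val_ext g s\<bar> < \<epsilon>"
proof -
  obtain q where q_bounds: "0 < real_of_rat q" "of_rat q < \<epsilon>"
    using of_rat_dense[OF \<open>0 < \<epsilon>\<close>] by blast
  then obtain k where k: "k \<in> V" "\<forall>u\<in>U. \<bar>val k u - val f u * val g u\<bar> \<le> of_rat q"
    using val_mult[of f g q] assms(1,2) by auto
  have "\<forall>s\<in>interval. \<bar>val_ext k s - val_ext f s * val_ext g s\<bar> \<le> of_rat q"
    by (subst interval_le_iff)
      (auto intro!: continuous_intros continuous_on_val_ext assms k(1)
        simp: val_ext_position assms k)
  with k(1) q_bounds(2) show ?thesis by (meson le_less_trans)
qed

lemma approximable_mult:
  assumes "g \<in> approximable" "h \<in> approximable"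
  shows "(\<lambda>s. g s * h s) \<in> approximable"
proof -
  obtain x where x: "\<And>n. x n \<in> V" "uniform_limit interval (\<lambda>n. val_ext (x n)) g sequentially"
    using approximable_uniform_limit[OF assms(1)] by blast
  obtain y where y: "\<And>n. y n \<in> V" "uniform_limit interval (\<lambda>n. val_ext (y n)) h sequentially"
    using approximable_uniform_limit[OF assms(2)] by blast
  have "bounded (g ` interval)" "bounded (h ` interval)"
    using assms
    by (auto simp: approximable_def intro!: compact_imp_bounded compact_continuous_image)
  note lim = uniform_lim_mult[OF x(2) y(2) this]
  have "\<exists>k\<in>V. \<forall>s\<in>interval. \<bar>val_ext k s - g s * h s\<bar> < \<epsilon>" if \<epsilon>: "0 < \<epsilon>" for \<epsilon>
  proof -
    have "\<forall>\<^sub>F n in sequentially. \<forall>s\<in>interval.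
        dist (val_ext (x n) s * val_ext (y n) s) (g s * h s) < \<epsilon> / 2"
      by (rule uniform_limitD[OF lim]) (use \<epsilon> in simp)
    then obtain n where close: "\<forall>s\<in>interval.
        dist (val_ext (x n) s * val_ext (y n) s) (g s * h s) < \<epsilon> / 2"
      using eventually_happens by fastforce
    obtain k where k: "k \<in> V"
      "\<forall>s\<in>interval. \<bar>val_ext k s - val_ext (x n) s * val_ext (y n) s\<bar> < \<epsilon> / 2"
      using val_ext_mult[OF x(1) y(1), of "\<epsilon> / 2" n n] \<epsilon> by auto
    have "\<bar>val_ext k s - g s * h s\<bar> < \<epsilon>" if "s \<in> interval" for s
      using bspec[OF close that] bspec[OF k(2) that] unfolding dist_real_def by linarith
    with k(1) show ?thesis by blast
  qed
  with assms show ?thesis by (auto simp: approximable_def intro!: continuous_intros)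
qed

lemma approximable_const: "(\<lambda>_. c) \<in> approximable"
proof -
  have "\<exists>f\<in>V. \<forall>s\<in>interval. \<bar>val_ext f s - c\<bar> < \<epsilon>" if \<epsilon>: "0 < \<epsilon>" for \<epsilon>
  proof -
    obtain q where "c < of_rat q" "of_rat q < c + \<epsilon>" using of_rat_dense[of c "c + \<epsilon>"] \<epsilon>
      by auto
    then show ?thesis
      by (intro bexI[of _ "scale q e"]) (auto simp: val_ext_scale val_ext_e e_in scale_closed)
  qed
  then show ?thesis by (simp add: approximable_def)
qed

lemma ex_position_near:
  fixes g :: "real \<Rightarrow> real"
  assumes g: "continuous_on interval g" and s: "s \<in> interval" and \<epsilon>: "0 < \<epsilon>" and \<eta>: "0 < \<eta>"
  obtains u where "u \<in> U" "\<bar>position u - s\<bar> < \<eta>" "\<bar>g (position u) - g s\<bar> < \<epsilon>"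
proof -
  obtain d where modulus: "0 < d" "\<forall>t\<in>interval. dist t s < d \<longrightarrow> dist (g t) (g s) < \<epsilon>"
    using g s \<epsilon> unfolding continuous_on_iff by blast
  obtain u where "u \<in> U" "\<bar>position u - s\<bar> < min d \<eta>"
    using position_dense[OF s, of "min d \<eta>"] modulus(1) \<eta> by auto
  then show ?thesis using modulus(2) position_in[of u]
    by (intro that[of u]) (auto simp: dist_real_def)
qed

lemma val_ext_separates_less:
  assumes st: "s \<in> interval" "t \<in> interval" "s < t"
  shows "\<exists>f\<in>V. val_ext f s \<noteq> val_ext f t"
proof -
  define d where "d = (t - s) / 6"
  have d_pos: "0 < d" using st(3) by (simp add: d_def)
  have "s + 2 * d \<in> interval" "s + 4 * d \<in> interval" using st by (auto simp: d_def field_simps)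
  then obtain x y where xy: "x \<in> U" "\<bar>position x - (s + 2 * d)\<bar> < d"
    "y \<in> U" "\<bar>position y - (s + 4 * d)\<bar> < d"
    using position_dense d_pos by meson
  then have "\<not> le y x" using position_mono[of y x] by linarith
  then obtain f where f: "f \<in> V" "\<forall>u\<in>U. (le u x \<longrightarrow> val f u \<le> 0) \<and> (le y u \<longrightarrow> 1 \<le> val f u)"
    using val_separates xy by blast
  obtain u where u: "u \<in> U" "\<bar>position u - s\<bar> < d" "\<bar>val_ext f (position u) - val_ext f s\<bar> < 1 / 2"
    using ex_position_near[OF continuous_on_val_ext[OF f(1)] st(1) _ d_pos, of "1 / 2"] by auto
  obtain v where v: "v \<in> U" "\<bar>position v - t\<bar> < d" "\<bar>val_ext f (position v) - val_ext f t\<bar> < 1 / 2"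
    using ex_position_near[OF continuous_on_val_ext[OF f(1)] st(2) _ d_pos, of "1 / 2"] by auto
  have "position u < position x" using u(2) xy(2) by linarith
  then have "val f u \<le> 0" using le_if_position_less[of u x] f(2) u(1) xy(1) by blast
  moreover have "t = s + 6 * d" by (simp add: d_def field_simps)
  then have "position y < position v" using v(2) xy(4) by linarith
  then have "1 \<le> val f v" using le_if_position_less[of y v] f(2) v(1) xy(3) by blast
  ultimately have "val_ext f s < val_ext f t"
    using u(3) v(3) unfolding val_ext_position[OF f(1) u(1)] val_ext_position[OF f(1) v(1)]
    by linarith
  with f(1) show ?thesis by force
qed

lemma function_ring_on_approximable: "function_ring_on approximable interval"
proof
  fix s t assume "s \<in> interval" "t \<in> interval" "s \<noteq> t"
  then obtain f where "f \<in> V" "val_ext f s \<noteq> val_ext f t"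
    using val_ext_separates_less[of s t] val_ext_separates_less[of t s] by (metis linorder_neq_iff)
  moreover from this(1) have "val_ext f \<in> approximable"
    using continuous_on_val_ext by (auto simp: approximable_def intro!: bexI[of _ f])
  ultimately show "\<exists>f\<in>approximable. f s \<noteq> f t" by blast
next
  fix g assume "g \<in> approximable"
  then show "continuous_on interval g" by (simp add: approximable_def)
qed (auto intro: approximable_add approximable_mult approximable_const)

lemma val_ext_dense:
  assumes "continuous_on interval F" "0 < \<epsilon>"
  shows "\<exists>f\<in>V. \<forall>s\<in>interval. \<bar>val_ext f s - F s\<bar> < \<epsilon>"
proof -
  obtain g where g: "g \<in> approximable" "\<forall>s\<in>interval. \<bar>F s - g s\<bar> < \<epsilon> / 2"
    using function_ring_on.Stone_Weierstrass_basic[OF function_ring_on_approximable assms(1),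
        of "\<epsilon> / 2"] assms(2) by auto
  then obtain f where f: "f \<in> V" "\<forall>s\<in>interval. \<bar>val_ext f s - g s\<bar> < \<epsilon> / 2"
    using half_gt_zero[OF assms(2)] unfolding approximable_def by blast
  have "\<bar>val_ext f s - F s\<bar> < \<epsilon>" if "s \<in> interval" for s
    using bspec[OF g(2) that] bspec[OF f(2) that] by linarith
  with f(1) show ?thesis by blast
qed

theorem dense_embedding_interval:
  "dense_embedding V add scale zero nrm interval (\<lambda>f s. val_ext f s / wt_ext s)"
proof unfold_locales
  obtain \<delta> where \<delta>: "0 < \<delta>" "\<forall>s\<in>interval. \<delta> \<le> wt_ext s" using wt_ext_lower_bound by blast
  then have pos: "0 < wt_ext s" if "s \<in> interval" for s using that by fastforce
  show "continuous_on interval (\<lambda>s. val_ext f s / wt_ext s)" if "f \<in> V" for f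
    by (intro continuous_on_divide continuous_on_val_ext continuous_on_wt_ext that)
      (use pos in force)
  show "\<exists>f\<in>V. \<forall>s\<in>interval. \<bar>val_ext f s / wt_ext s - F s\<bar> < \<epsilon>"
    if F: "continuous_on interval F" "0 < \<epsilon>" for F \<epsilon>
  proof -
    have "continuous_on interval (\<lambda>s. F s * wt_ext s)"
      by (intro continuous_intros F(1) continuous_on_wt_ext)
    then obtain f where f: "f \<in> V" "\<forall>s\<in>interval. \<bar>val_ext f s - F s * wt_ext s\<bar> < \<epsilon> * \<delta>"
      using val_ext_dense[of _ "\<epsilon> * \<delta>"] F(2) \<delta>(1) by auto
    have "\<bar>val_ext f s / wt_ext s - F s\<bar> < \<epsilon>" if s: "s \<in> interval" for s
    proof -
      have "\<bar>val_ext f s / wt_ext s - F s\<bar> * wt_ext s = \<bar>val_ext f s - F s * wt_ext s\<bar>"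
        using pos[OF s] by (simp add: abs_mult_pos field_simps)
      also have "\<dots> < \<epsilon> * \<delta>" using f(2) s by blast
      also have "\<dots> \<le> \<epsilon> * wt_ext s" using \<delta>(2) s F(2) by simp
      finally show ?thesis using pos[OF s] by simp
    qed
    with f(1) show ?thesis by blast
  qed
qed (simp_all add: val_ext_add val_ext_scale add_divide_distrib norm_le_iff_ext)

corollary ex_dense_embedding_01: "\<exists>J. dense_embedding V add scale zero nrm {0..1::real} J"
proof -
  interpret dense_embedding V add scale zero nrm interval "\<lambda>f s. val_ext f s / wt_ext s"
    using dense_embedding_interval .
  have "{0..1::real} homeomorphic interval"
    using lo_less_hi by (intro homeomorphic_closed_intervals_real) simp_all
  then obtain J where "dense_embedding V add scale zero nrm {0..1::real} J"
    using dense_embedding_homeomorphic by blast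
  then show ?thesis by blast
qed

end

context C01_frame
begin

subsection \<open>The values at bumps satisfy the axioms of evaluations\<close>

lemma ratio_approx:
  assumes F: "continuous_on {0..1} F" and \<epsilon>: "0 < \<epsilon>"
  shows "\<exists>f\<in>V. \<forall>t\<in>{0..1}. \<bar>ratio f t - F t\<bar> < \<epsilon>"
proof -
  obtain m where m_lower: "0 < m" "\<And>t. t \<in> {0..1} \<Longrightarrow> m \<le> J e t"
    using compact_positive_lower_bound[OF compact_Icc embed_continuous[OF e_in] e_pos] by blast
  have "continuous_on {0..1} (\<lambda>t. F t * J e t)" by (intro continuous_intros F embed_continuous e_in)
  moreover have "0 < \<epsilon> * m" using \<epsilon> m_lower(1) by simp
  ultimately obtain f where f: "f \<in> V" "\<And>t. t \<in> {0..1} \<Longrightarrow> \<bar>J f t - F t * J e t\<bar> < \<epsilon> * m"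
    using embed_approx by blast
  have "\<bar>ratio f t - F t\<bar> < \<epsilon>" if t: "t \<in> {0..1}" for t
  proof -
    have "\<bar>ratio f t - F t\<bar> * J e t = \<bar>(ratio f t - F t) * J e t\<bar>"
      using e_pos[OF t] by (simp add: abs_mult)
    also have "\<dots> = \<bar>J f t - F t * J e t\<bar>"
      using e_pos[OF t] by (simp add: ratio_def left_diff_distrib)
    also have "\<dots> < \<epsilon> * m" using f(2)[OF t] .
    also have "\<dots> \<le> \<epsilon> * J e t" using \<epsilon> m_lower(2)[OF t] by simp
    finally show ?thesis using e_pos[OF t] by simp
  qed
  with f(1) show ?thesis by blast
qed

lemma all_bumps_le_iff:
  fixes g h :: "real \<Rightarrow> real"
  assumes "continuous_on {0..1} g" "continuous_on {0..1} h"
  shows "(\<forall>u\<in>bumps. g (point u) \<le> h (point u)) \<longleftrightarrow> (\<forall>t\<in>{0..1}. g t \<le> h t)"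
proof (intro iffI ballI)
  fix t assume le_at_bumps: "\<forall>u\<in>bumps. g (point u) \<le> h (point u)" and t: "t \<in> {0..1::real}"
  let ?d = "\<lambda>t. g t - h t"
  have "closure (point ` bumps) \<subseteq> {0..1}" by (rule closure_minimal) (use point_in in auto)
  moreover have "continuous_on {0..1} ?d" by (intro continuous_intros assms)
  ultimately have "continuous_on (closure (point ` bumps)) ?d" using continuous_on_subset by blast
  moreover have "t \<in> closure (point ` bumps)"
    unfolding closure_approachable dist_real_def using ex_bump_near[OF t] by blast
  ultimately have "?d t \<le> 0" by (rule continuous_le_on_closure) (use le_at_bumps in auto)
  then show "g t \<le> h t" by simp
qed (use point_in in blast)

lemma bump_value_bounded:
  assumes "f \<in> V"
  shows "\<exists>b. \<forall>u\<in>bumps. \<bar>bump_value f u\<bar> \<le> real_of_rat b"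
proof -
  obtain c where c_upper: "\<And>t. t \<in> {0..1} \<Longrightarrow> \<bar>ratio f t\<bar> \<le> c"
    using compact_abs_upper_bound[OF compact_Icc continuous_on_ratio[OF assms]] by blast
  obtain b where b_upper: "c < real_of_rat b" using of_rat_dense[of c "c + 1"] by auto
  have "\<bar>bump_value f u\<bar> \<le> of_rat b" if "u \<in> bumps" for u
    using c_upper[OF point_in[OF that]] b_upper that assms by (simp add: bump_value_eq)
  then show ?thesis by blast
qed

lemma bump_value_controlled:
  assumes f: "f \<in> V" and \<epsilon>: "0 < \<epsilon>"
  shows "\<exists>p\<in>V. (\<forall>x\<in>bumps. \<forall>y\<in>bumps. bump_le x y \<longrightarrow> bump_value p x \<le> bump_value p y + 1) \<and>
    (\<forall>x\<in>bumps. \<forall>y\<in>bumps. \<bar>bump_value p x - bump_value p y\<bar> \<le> 3 \<longrightarrow>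
      \<bar>bump_value f x - bump_value f y\<bar> \<le> \<epsilon>)"
proof -
  have "uniformly_continuous_on {0..1} (ratio f)"
    by (rule compact_uniformly_continuous[OF continuous_on_ratio[OF f] compact_Icc])
  then obtain \<delta> where \<delta>: "0 < \<delta>"
    "\<forall>s\<in>{0..1}. \<forall>t\<in>{0..1}. dist t s < \<delta> \<longrightarrow> dist (ratio f t) (ratio f s) < \<epsilon>"
    using \<epsilon> unfolding uniformly_continuous_on_def by blast
  define N where "N = 5 / \<delta>"
  have N: "0 < N" using \<delta>(1) by (simp add: N_def)
  have "continuous_on {0..1} (\<lambda>t. N * t)" by (intro continuous_intros)
  then obtain p where p: "p \<in> V" "\<forall>t\<in>{0..1}. \<bar>ratio p t - N * t\<bar> < 1 / 2"
    using ratio_approx[of "\<lambda>t. N * t" "1 / 2"] by auto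
  have mono: "ratio p s \<le> ratio p t + 1" if st: "s \<in> {0..1}" "t \<in> {0..1}" "s \<le> t" for s t
  proof -
    have "N * s \<le> N * t" using N st(3) by simp
    with bspec[OF p(2) st(1)] bspec[OF p(2) st(2)] show ?thesis by linarith
  qed
  have control: "\<bar>ratio f s - ratio f t\<bar> \<le> \<epsilon>"
    if st: "s \<in> {0..1}" "t \<in> {0..1}" "\<bar>ratio p s - ratio p t\<bar> \<le> 3" for s t
  proof -
    have "\<bar>N * s - N * t\<bar> < 5"
      using bspec[OF p(2) st(1)] bspec[OF p(2) st(2)] st(3) by linarith
    moreover have "\<bar>N * s - N * t\<bar> = N * \<bar>s - t\<bar>"
      using N by (simp add: abs_mult flip: right_diff_distrib)
    moreover have "N * \<delta> = 5" using \<delta>(1) by (simp add: N_def)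
    ultimately have "N * \<bar>s - t\<bar> < N * \<delta>" by simp
    then have "dist s t < \<delta>" using N by (simp add: dist_real_def)
    then have "dist (ratio f s) (ratio f t) < \<epsilon>" using \<delta>(2) st(1,2) by blast
    then show ?thesis by (simp add: dist_real_def)
  qed
  show ?thesis
    by (intro bexI[of _ p] conjI ballI impI)
      (simp_all add: bump_value_eq bump_le_iff point_in mono control p(1) f del: atLeastAtMost_iff)
qed

lemma bump_value_intermediate:
  assumes f: "f \<in> V" and xy: "x \<in> bumps" "y \<in> bumps"
    and "a < b" "bump_value f x < a" "b < bump_value f y"
  shows "\<exists>z\<in>bumps. a < bump_value f z \<and> bump_value f z < b"
proof -
  define m where "m = (a + b) / 2"
  have m_between: "a < m" "m < b" using \<open>a < b\<close> by (auto simp: m_def)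
  have "continuous_on {0..1} (\<lambda>t. ratio f t - m)"
    by (intro continuous_intros continuous_on_ratio f)
  then obtain t where t: "t \<in> {0..1}" "ratio f t = m"
    using IVT_zero_between[of 0 1 "\<lambda>t. ratio f t - m" "point y" "point x"]
      point_in xy assms(5,6) m_between f
    by (auto simp: bump_value_eq)
  have "0 < m - a" using m_between(1) by simp
  then obtain \<rho> where \<rho>: "0 < \<rho>" "\<And>s. s \<in> {0..1} \<Longrightarrow> \<bar>s - t\<bar> < \<rho> \<Longrightarrow> \<bar>ratio f s - ratio f t\<bar> < m - a"
    using continuous_on_near[OF continuous_on_ratio[OF f] t(1)] by blast
  obtain u where u: "u \<in> bumps" "\<bar>point u - t\<bar> < \<rho>" using ex_bump_near[OF t(1) \<rho>(1)] by blast
  have "m - a = b - m" by (simp add: m_def field_simps)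
  then have "a < ratio f (point u) \<and> ratio f (point u) < b"
    using \<rho>(2)[OF point_in[OF u(1)] u(2)] t(2) by linarith
  with u(1) f show ?thesis by (auto simp: bump_value_eq)
qed

lemma bump_value_separates:
  assumes xy: "x \<in> bumps" "y \<in> bumps" "\<not> bump_le y x"
  shows "\<exists>f\<in>V. \<forall>u\<in>bumps. (bump_le u x \<longrightarrow> bump_value f u \<le> 0) \<and> (bump_le y u \<longrightarrow> 1 \<le> bump_value f u)"
proof -
  define s t where "s = point x" and "t = point y"
  have "s < t" using xy by (simp add: bump_le_iff s_def t_def)
  define F where "F = (\<lambda>c. 2 * ((c - s) / (t - s)) - 1 / 2)"
  have "continuous_on {0..1} F" unfolding F_def using \<open>s < t\<close> by (intro continuous_intros) auto
  then obtain f where f: "f \<in> V" "\<forall>c\<in>{0..1}. \<bar>ratio f c - F c\<bar> < 1 / 2"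
    using ratio_approx[of F "1 / 2"] by auto
  have "(c - s) / (t - s) \<le> 0" if "c \<le> s" for c
    using that \<open>s < t\<close> by (intro divide_nonpos_pos) auto
  then have left: "F c \<le> - 1 / 2" if "c \<le> s" for c using that by (fastforce simp only: F_def)
  have "1 \<le> (c - s) / (t - s)" if "t \<le> c" for c using that \<open>s < t\<close> by simp
  then have right: "3 / 2 \<le> F c" if "t \<le> c" for c using that by (fastforce simp only: F_def)
  show ?thesis
  proof (intro bexI[OF _ f(1)] ballI conjI impI)
    fix u assume u: "u \<in> bumps"
    then have near: "\<bar>bump_value f u - F (point u)\<bar> < 1 / 2"
      using f point_in by (simp add: bump_value_eq)
    show "bump_value f u \<le> 0" if "bump_le u x"
    proof -
      have "F (point u) \<le> - 1 / 2" using left that u xy by (simp add: bump_le_iff s_def)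
      with near show ?thesis by linarith
    qed
    show "1 \<le> bump_value f u" if "bump_le y u"
    proof -
      have "3 / 2 \<le> F (point u)" using right that u xy by (simp add: bump_le_iff t_def)
      with near show ?thesis by linarith
    qed
  qed
qed

lemma bump_value_approx:
  assumes "continuous_on {0..1} F" "0 < \<epsilon>"
  shows "\<exists>f\<in>V. \<forall>u\<in>bumps. \<bar>bump_value f u - F (point u)\<bar> \<le> \<epsilon>"
proof -
  obtain f where "f \<in> V" "\<forall>t\<in>{0..1}. \<bar>ratio f t - F t\<bar> < \<epsilon>" using ratio_approx[OF assms] by blast
  then show ?thesis using point_in by (intro bexI[of _ f]) (simp_all add: bump_value_eq less_imp_le)
qed

lemma bump_value_mult:
  assumes "f \<in> V" "g \<in> V" "0 < \<epsilon>"
  shows "\<exists>k\<in>V. \<forall>u\<in>bumps. \<bar>bump_value k u - bump_value f u * bump_value g u\<bar> \<le> \<epsilon>"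
proof -
  have "continuous_on {0..1} (\<lambda>t. ratio f t * ratio g t)"
    by (intro continuous_intros continuous_on_ratio assms)
  from bump_value_approx[OF this assms(3)] show ?thesis by (simp add: bump_value_eq assms)
qed

lemma bump_weight_approx:
  assumes "0 < \<epsilon>"
  shows "\<exists>h\<in>V. \<forall>u\<in>bumps. \<bar>bump_value h u - bump_weight u\<bar> \<le> \<epsilon>"
proof -
  have "continuous_on {0..1} (\<lambda>t. 1 / J e t)"
    by (intro continuous_on_divide continuous_on_const embed_continuous e_in) (use e_pos in force)
  from bump_value_approx[OF this assms] show ?thesis by (simp add: bump_weight_eq)
qed

lemma bump_weight_lower_bound: "\<exists>\<delta>>0. \<forall>u\<in>bumps. real_of_rat \<delta> \<le> bump_weight u"
proof -
  obtain c where c_upper: "0 < c" "\<And>t. t \<in> {0..1} \<Longrightarrow> \<bar>J e t\<bar> \<le> c"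
    using compact_abs_upper_bound[OF compact_Icc embed_continuous[OF e_in]] by blast
  obtain \<delta> where \<delta>: "0 < real_of_rat \<delta>" "of_rat \<delta> < 1 / c"
    using of_rat_dense[of 0 "1 / c"] c_upper(1) by auto
  have "of_rat \<delta> \<le> 1 / J e t" if t: "t \<in> {0..1}" for t
  proof -
    have "1 / c \<le> 1 / J e t" using c_upper(2)[OF t] e_pos[OF t] by (intro frac_le) auto
    with \<delta>(2) show ?thesis by linarith
  qed
  with \<delta>(1) point_in show ?thesis by (intro exI[of _ \<delta>]) (simp add: bump_weight_eq)
qed

lemma norm_le_iff_bump_value:
  assumes f: "f \<in> V"
  shows "nrm f \<le> c \<longleftrightarrow> (\<forall>u\<in>bumps. \<bar>bump_value f u\<bar> \<le> c * bump_weight u)"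
proof -
  have "(\<forall>u\<in>bumps. \<bar>bump_value f u\<bar> \<le> c * bump_weight u) \<longleftrightarrow> (\<forall>u\<in>bumps. \<bar>J f (point u)\<bar> \<le> c)"
  proof (intro ball_cong refl)
    fix u assume u: "u \<in> bumps"
    then have "0 < J e (point u)" by (intro e_pos point_in)
    then show "\<bar>bump_value f u\<bar> \<le> c * bump_weight u \<longleftrightarrow> \<bar>J f (point u)\<bar> \<le> c"
      using u f by (simp add: bump_value_eq bump_weight_eq ratio_def abs_div_pos[symmetric]
        divide_le_cancel)
  qed
  also have "\<dots> \<longleftrightarrow> (\<forall>t\<in>{0..1}. \<bar>J f t\<bar> \<le> c)"
    using all_bumps_le_iff[of "\<lambda>t. \<bar>J f t\<bar>" "\<lambda>_. c"]
    by (simp add: continuous_intros embed_continuous f)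
  finally show ?thesis using norm_le_iff[OF f] by simp
qed

lemma bump_le_linear: "x \<in> bumps \<Longrightarrow> y \<in> bumps \<Longrightarrow> bump_le x y \<or> bump_le y x"
  by (auto simp: bump_le_iff)

lemma bump_le_trans: "bump_le x y \<Longrightarrow> bump_le y z \<Longrightarrow> bump_le x z"
  by (simp add: bump_le_def)

lemma ex_not_bump_le: "\<exists>x\<in>bumps. \<exists>y\<in>bumps. \<not> bump_le y x"
proof -
  have "(0::real) \<le> 0" "0 < (1 / 2 :: real)" "1 / 2 \<le> (1::real)" by simp_all
  then obtain x where "x \<in> bumps" "point x \<le> 1 / 2" by (rule ex_bump_in)
  moreover have "0 \<le> (1 / 2 :: real)" "1 / 2 < (1::real)" "(1::real) \<le> 1" by simp_all
  then obtain y where "y \<in> bumps" "1 / 2 < point y" by (rule ex_bump_in)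
  moreover from calculation have "\<not> bump_le y x" by (simp add: bump_le_iff)
  ultimately show ?thesis by blast
qed

end

theorem evaluations_bumps:
  fixes V :: "nat set" and add scale zero nrm J e l r
  assumes "C01_frame V add scale zero nrm J e l r"
  shows "evaluations V add scale zero nrm e (frame.bumps V add scale nrm e)
    (frame.bump_le V add scale nrm e l r) (frame.bump_value V add scale nrm e l r)
    (frame.bump_weight V add scale nrm e l r)"
proof -
  interpret C01_frame V add scale zero nrm J e l r by (rule assms)
  show ?thesis
  proof unfold_locales
    show "bump_value (add f g) u = bump_value f u + bump_value g u"
      if "f \<in> V" "g \<in> V" "u \<in> bumps" for f g u
      using that point_in[of u]
      by (simp add: bump_value_eq ratio_def embed_add add_divide_distrib)
    show "bump_value (scale q f) u = of_rat q * bump_value f u" if "f \<in> V" "u \<in> bumps" for f u q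
      using that point_in[of u] by (simp add: bump_value_eq ratio_def embed_scale)
    show "bump_value e u = 1" if "u \<in> bumps" for u
      using e_pos[OF point_in[OF that]] that by (simp add: bump_value_eq ratio_def)
  qed (auto simp: bump_value_bounded bump_value_controlled bump_value_intermediate of_rat_less
      bump_value_separates bump_value_mult bump_weight_lower_bound bump_weight_approx
      norm_le_iff_bump_value ex_not_bump_le
      dest: bump_le_linear intro: bump_le_trans)
qed

theorem ex_C01_frame:
  fixes V add scale zero nrm J
  assumes "dense_embedding V add scale zero nrm {0..1::real} J"
  shows "\<exists>e\<in>V. \<exists>l\<in>V. \<exists>r\<in>V. C01_frame V add scale zero nrm J e l r"
proof -
  interpret dense_embedding V add scale zero nrm "{0..1::real}" J by (rule assms)
  have approx: "\<exists>x\<in>V. \<forall>t\<in>{0..1}. \<bar>J x t - F t\<bar> < 1 / 6" if "continuous_on {0..1} F" for F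
    by (rule embed_dense[OF that]) simp
  obtain e where e: "e \<in> V" "\<forall>t\<in>{0..1}. \<bar>J e t - 1\<bar> < 1 / 6"
    using approx[OF continuous_on_const] by blast
  have "continuous_on {0..1} (\<lambda>t::real. 1 / 3 - t)" by (intro continuous_intros)
  from approx[OF this] obtain l where l: "l \<in> V" "\<forall>t\<in>{0..1}. \<bar>J l t - (1 / 3 - t)\<bar> < 1 / 6" ..
  have "continuous_on {0..1} (\<lambda>t::real. t - 2 / 3)" by (intro continuous_intros)
  from approx[OF this] obtain r where r: "r \<in> V" "\<forall>t\<in>{0..1}. \<bar>J r t - (t - 2 / 3)\<bar> < 1 / 6" ..
  have "C01_frame V add scale zero nrm J e l r"
  proof
    show "0 < J e t" if "t \<in> {0..1}" for t using bspec[OF e(2) that] by linarith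
    have "\<bar>J l 0 - (1 / 3 - 0)\<bar> < 1 / 6" by (rule bspec[OF l(2)]) simp
    then have "0 < J l 0" by linarith
    then show "\<exists>t\<in>{0..1}. 0 < J l t" by force
    have "\<bar>J r 1 - (1 - 2 / 3)\<bar> < 1 / 6" by (rule bspec[OF r(2)]) simp
    then have "0 < J r 1" by linarith
    then show "\<exists>t\<in>{0..1}. 0 < J r t" by force
    show "s < t" if "s \<in> {0..1}" "t \<in> {0..1}" "0 < J l s" "0 < J r t" for s t
      using bspec[OF l(2) that(1)] bspec[OF r(2) that(2)] that(3,4) by linarith
  qed (fact e(1) l(1) r(1))+
  with e(1) l(1) r(1) show ?thesis by blast
qed

theorem ex_dense_embedding_iff_evaluations_bumps:
  fixes V :: "nat set" and add scale zero nrm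
  shows "(\<exists>J. dense_embedding V add scale zero nrm {0..1::real} J) \<longleftrightarrow>
    (\<exists>e\<in>V. \<exists>l\<in>V. \<exists>r\<in>V. evaluations V add scale zero nrm e (frame.bumps V add scale nrm e)
      (frame.bump_le V add scale nrm e l r) (frame.bump_value V add scale nrm e l r)
      (frame.bump_weight V add scale nrm e l r))"
proof
  assume "\<exists>J. dense_embedding V add scale zero nrm {0..1::real} J"
  then obtain J where "dense_embedding V add scale zero nrm {0..1::real} J" ..
  from ex_C01_frame[OF this] obtain e l r where
    "e \<in> V" "l \<in> V" "r \<in> V" "C01_frame V add scale zero nrm J e l r" by blast
  with evaluations_bumps show "\<exists>e\<in>V. \<exists>l\<in>V. \<exists>r\<in>V. evaluations V add scale zero nrm e
      (frame.bumps V add scale nrm e) (frame.bump_le V add scale nrm e l r)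
      (frame.bump_value V add scale nrm e l r) (frame.bump_weight V add scale nrm e l r)" by blast
qed (blast intro: evaluations.ex_dense_embedding_01)

section \<open>Arithmetical families of normed spaces\<close>

locale arith_spaces =
  fixes V :: "nat \<Rightarrow> nat set" and add :: "nat \<Rightarrow> nat \<Rightarrow> nat \<Rightarrow> nat"
    and scale :: "nat \<Rightarrow> rat \<Rightarrow> nat \<Rightarrow> nat" and nrm :: "nat \<Rightarrow> nat \<Rightarrow> real"
  assumes arith_pred_carrier: "arith_fun i \<Longrightarrow> arith_fun x \<Longrightarrow> arith_pred (\<lambda>z. x z \<in> V (i z))"
    and arith_fun_add: "arith_fun i \<Longrightarrow> arith_fun x \<Longrightarrow> arith_fun y \<Longrightarrow>
      arith_fun (\<lambda>z. add (i z) (x z) (y z))"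
    and arith_fun_scale: "arith_fun i \<Longrightarrow> arith_rat q \<Longrightarrow> arith_fun x \<Longrightarrow>
      arith_fun (\<lambda>z. scale (i z) (q z) (x z))"
    and arith_real_norm: "arith_fun i \<Longrightarrow> arith_fun x \<Longrightarrow> arith_real (\<lambda>z. nrm (i z) (x z))"
begin

abbreviation in_space ::
    "(nat set \<Rightarrow> (nat \<Rightarrow> nat \<Rightarrow> nat) \<Rightarrow> (rat \<Rightarrow> nat \<Rightarrow> nat) \<Rightarrow> (nat \<Rightarrow> real) \<Rightarrow> 'b) \<Rightarrow> nat \<Rightarrow> 'b" where
  "in_space F i \<equiv> F (V i) (add i) (scale i) (nrm i)"

lemmas space_intros = arith_intros arith_pred_carrier arith_fun_add arith_fun_scale arith_real_norm

lemma arith_bounded_away: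
  assumes "arith_fun i" "arith_rat \<delta>" "arith_fun f"
  shows "arith_pred (\<lambda>z. in_space frame.bounded_away (i z) (\<delta> z) (f z))"
  unfolding frame.bounded_away_def
  by (intro space_intros assms(1,3)[THEN arith_fun_comp] assms(2)[THEN arith_rat_comp])

lemma arith_positive:
  assumes "arith_fun i" "arith_fun e" "arith_fun f"
  shows "arith_pred (\<lambda>z. in_space frame.positive (i z) (e z) (f z))"
  unfolding frame.positive_def
  by (intro space_intros arith_bounded_away assms[THEN arith_fun_comp])

lemma arith_above:
  assumes "arith_fun i" "arith_fun e" "arith_fun f" "arith_fun g"
  shows "arith_pred (\<lambda>z. in_space frame.above (i z) (e z) (f z) (g z))"
  unfolding frame.above_def by (intro space_intros arith_positive assms)

lemma arith_meets:
  assumes "arith_fun i" "arith_fun e" "arith_fun u" "arith_fun v"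
  shows "arith_pred (\<lambda>z. in_space frame.meets (i z) (e z) (u z) (v z))"
  unfolding frame.meets_def by (intro space_intros arith_above assms[THEN arith_fun_comp])

lemma arith_zeros_inside:
  assumes "arith_fun i" "arith_fun e" "arith_fun k" "arith_fun u"
  shows "arith_pred (\<lambda>z. in_space frame.zeros_inside (i z) (e z) (k z) (u z))"
  unfolding frame.zeros_inside_def by (intro space_intros arith_above assms[THEN arith_fun_comp])

lemma arith_between:
  assumes "arith_fun i" "arith_fun e" "arith_fun u" "arith_fun v" "arith_fun w"
  shows "arith_pred (\<lambda>z. in_space frame.between (i z) (e z) (u z) (v z) (w z))"
  unfolding frame.between_def
  by (intro space_intros arith_meets arith_zeros_inside assms[THEN arith_fun_comp])

lemma arith_before:
  assumes "arith_fun i" "arith_fun e" "arith_fun l" "arith_fun r" "arith_fun v" "arith_fun u"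
  shows "arith_pred (\<lambda>z. in_space frame.before (i z) (e z) (l z) (r z) (v z) (u z))"
  unfolding frame.before_def
  by (intro space_intros arith_above arith_between assms[THEN arith_fun_comp])

lemma arith_bumps:
  assumes "arith_fun i" "arith_fun e" "arith_fun u"
  shows "arith_pred (\<lambda>z. u z \<in> in_space frame.bumps (i z) (e z))"
  unfolding frame.bumps_def mem_Collect_eq by (intro space_intros arith_meets assms)

lemma arith_bump_le:
  assumes "arith_fun i" "arith_fun e" "arith_fun l" "arith_fun r" "arith_fun x" "arith_fun y"
  shows "arith_pred (\<lambda>z. in_space frame.bump_le (i z) (e z) (l z) (r z) (x z) (y z))"
  unfolding frame.bump_le_def
  by (intro space_intros arith_bumps arith_before assms[THEN arith_fun_comp])

lemma arith_exceeds_left_of: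
  assumes "arith_fun i" "arith_fun e" "arith_fun l" "arith_fun r" "arith_fun u" "arith_fun f"
    "arith_rat c"
  shows "arith_pred (\<lambda>z. in_space frame.exceeds_left_of (i z) (e z) (l z) (r z) (u z) (f z) (c z))"
  unfolding frame.exceeds_left_of_def
  by (intro space_intros arith_bumps arith_bump_le arith_meets assms(1-6)[THEN arith_fun_comp]
      assms(7)[THEN arith_rat_comp])

lemma arith_bump_value:
  assumes "arith_fun i" "arith_fun e" "arith_fun l" "arith_fun r" "arith_fun f" "arith_fun u"
  shows "arith_real (\<lambda>z. in_space frame.bump_value (i z) (e z) (l z) (r z) (f z) (u z))"
  unfolding frame.bump_value_def
  by (intro space_intros arith_exceeds_left_of assms[THEN arith_fun_comp])

lemma arith_bump_weight:
  assumes "arith_fun i" "arith_fun e" "arith_fun l" "arith_fun r" "arith_fun u"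
  shows "arith_real (\<lambda>z. in_space frame.bump_weight (i z) (e z) (l z) (r z) (u z))"
  unfolding frame.bump_weight_def
  by (intro space_intros arith_bump_value assms[THEN arith_fun_comp])

lemma arith_rat_normed_space:
  assumes "arith_fun i" "arith_fun zero"
  shows "arith_pred (\<lambda>z. rat_normed_space (V (i z)) (add (i z)) (scale (i z)) (zero z) (nrm (i z)))"
  unfolding rat_normed_space_def rat_normed_space_axioms_def rat_vector_space_def
  by (intro space_intros assms[THEN arith_fun_comp])

lemma arith_evaluations:
  assumes "arith_fun i" "arith_fun zero" "arith_fun e" "arith_fun l" "arith_fun r"
  shows "arith_pred (\<lambda>z. evaluations (V (i z)) (add (i z)) (scale (i z)) (zero z) (nrm (i z)) (e z)
    (in_space frame.bumps (i z) (e z))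
    (in_space frame.bump_le (i z) (e z) (l z) (r z))
    (in_space frame.bump_value (i z) (e z) (l z) (r z))
    (in_space frame.bump_weight (i z) (e z) (l z) (r z)))"
  unfolding evaluations_def evaluations_axioms_def
  by (intro space_intros arith_rat_normed_space arith_bumps arith_bump_le arith_bump_value
      arith_bump_weight assms[THEN arith_fun_comp])

end

section \<open>Uniformly computable presentations\<close>

lemma rat_of_code_Least: "rat_of_code (LEAST c. rat_of_code c = q) = q"
  by (rule LeastI_ex[OF ex_rat_of_code])

text \<open>
  On total presentations these agree with \<^const>\<open>pscale\<close> and \<^const>\<open>pnorm\<close>.  Unlike those, which pick
  a code by Hilbert choice and take a limit that need not exist, they are arithmetical for every
  presentation.
\<close>

definition scale_by :: "presentation \<Rightarrow> rat \<Rightarrow> nat \<Rightarrow> nat" where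
  "scale_by P q x = the (scale_fun P (LEAST c. rat_of_code c = q) x)"

definition norm_of :: "presentation \<Rightarrow> nat \<Rightarrow> real" where
  "norm_of P x = rat_sup {q. \<exists>n. q + 1 / 2 ^ n \<le> rat_of_code (the (norm_fun P x n))}"

lemma scale_by_eq: "ops_total P \<Longrightarrow> x \<in> points P \<Longrightarrow> scale_by P q x = pscale P q x"
  by (simp add: ops_total_def scale_by_def rat_of_code_Least)

lemma ops_total_iff:
  "ops_total P \<longleftrightarrow>
    (\<forall>x. dom_char P x = Some 0 \<or> dom_char P x = Some 1) \<and>
    (\<forall>x\<in>points P. \<forall>y\<in>points P. \<exists>v. add_fun P x y = Some v) \<and>
    (\<forall>c. \<forall>x\<in>points P. scale_fun P c x = Some (scale_by P (rat_of_code c) x))"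
    (is "_ \<longleftrightarrow> ?dom \<and> ?add \<and> ?scale")
proof
  assume "ops_total P"
  then show "?dom \<and> ?add \<and> ?scale" by (simp add: scale_by_eq) (simp add: ops_total_def)
next
  assume total: "?dom \<and> ?add \<and> ?scale"
  have "pscale P q x = scale_by P q x" if "x \<in> points P" for q x
    unfolding pscale_def using total that by (simp add: surj_f_inv_f surj_nat_to_rat_surj)
  with total show "ops_total P" by (simp add: ops_total_def)
qed

lemma rat_sup_approximations:
  assumes approx: "\<And>n. \<bar>real_of_rat (a n) - x\<bar> \<le> 1 / 2 ^ n"
  shows "rat_sup {q. \<exists>n. q + 1 / 2 ^ n \<le> a n} = x"
proof (rule rat_sup_eqI)
  fix q assume "of_rat q < x"
  then obtain n where "(1 / 2) ^ n < (x - of_rat q) / 2"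
    using real_arch_pow_inv[of "(x - of_rat q) / 2" "1 / 2"] by auto
  then have "2 * (1 / 2 ^ n) < x - of_rat q" by (simp add: power_one_over)
  moreover have "x - of_rat (a n) \<le> 1 / 2 ^ n" using abs_le_D2[OF approx[of n]] by simp
  ultimately have "of_rat q + 1 / 2 ^ n \<le> real_of_rat (a n)" by argo
  then have "real_of_rat (q + 1 / 2 ^ n) \<le> of_rat (a n)"
    by (simp add: of_rat_add of_rat_divide of_rat_power)
  then show "q \<in> {q. \<exists>n. q + 1 / 2 ^ n \<le> a n}" by (auto simp: of_rat_less_eq)
next
  fix q assume "q \<in> {q. \<exists>n. q + 1 / 2 ^ n \<le> a n}"
  then obtain n where "real_of_rat (q + 1 / 2 ^ n) \<le> of_rat (a n)" by (auto simp: of_rat_less_eq)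
  then show "of_rat q \<le> x"
    using approx[of n] by (simp add: of_rat_add of_rat_divide of_rat_power)
qed

lemma lim_approximations:
  fixes a :: "nat \<Rightarrow> real"
  assumes "\<And>n. \<bar>a n - x\<bar> \<le> 1 / 2 ^ n"
  shows "lim a = x"
proof (rule limI, rule LIM_zero_cancel, rule Lim_null_comparison)
  show "(\<lambda>n. (1 / 2) ^ n :: real) \<longlonglongrightarrow> 0" by (rule LIMSEQ_realpow_zero) simp_all
  show "\<forall>\<^sub>F n in sequentially. norm (a n - x) \<le> (1 / 2) ^ n"
    using assms by (simp add: power_one_over)
qed

lemma norm_of_eq:
  assumes "norm_total P" "x \<in> points P"
  shows "norm_of P x = pnorm P x"
  unfolding norm_of_def
proof (rule rat_sup_approximations)
  fix n
  obtain c where "norm_fun P x n = Some c" "\<bar>of_rat (rat_of_code c) - pnorm P x\<bar> \<le> 1 / 2 ^ n"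
    using assms unfolding norm_total_def by blast
  then show "\<bar>of_rat (rat_of_code (the (norm_fun P x n))) - pnorm P x\<bar> \<le> 1 / 2 ^ n" by simp
qed

lemma norm_total_iff:
  "norm_total P \<longleftrightarrow> (\<forall>x\<in>points P. \<forall>n. \<exists>c. norm_fun P x n = Some c \<and>
    \<bar>of_rat (rat_of_code c) - norm_of P x\<bar> \<le> of_rat (1 / 2 ^ n))"
proof -
  have power: "real_of_rat (1 / 2 ^ n) = 1 / 2 ^ n" for n by (simp add: of_rat_divide of_rat_power)
  show ?thesis
  proof
    assume "norm_total P"
    then show "\<forall>x\<in>points P. \<forall>n. \<exists>c. norm_fun P x n = Some c \<and>
        \<bar>of_rat (rat_of_code c) - norm_of P x\<bar> \<le> of_rat (1 / 2 ^ n)"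
      unfolding power by (simp add: norm_of_eq) (simp add: norm_total_def)
  next
    assume approx: "\<forall>x\<in>points P. \<forall>n. \<exists>c. norm_fun P x n = Some c \<and>
        \<bar>of_rat (rat_of_code c) - norm_of P x\<bar> \<le> of_rat (1 / 2 ^ n)"
    have "pnorm P x = norm_of P x" if x: "x \<in> points P" for x
      unfolding pnorm_def
    proof (rule lim_approximations)
      fix n
      obtain c where "norm_fun P x n = Some c" "\<bar>of_rat (rat_of_code c) - norm_of P x\<bar> \<le> 1 / 2 ^ n"
        using approx x unfolding power by blast
      then show "\<bar>of_rat (rat_of_code (the (norm_fun P x n))) - norm_of P x\<bar> \<le> 1 / 2 ^ n" by simp
    qed
    with approx show "norm_total P" unfolding norm_total_def power by simp
  qed
qed

lemma arith_pred_partrec2: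
  assumes "partrec2 F" "arith_fun x" "arith_fun y" "arith_fun v"
  shows "arith_pred (\<lambda>z. F (x z) (y z) = Some (v z))"
proof -
  obtain G where "partrec 2 G" "\<And>x y. G [x, y] = F x y" using assms(1) by (auto simp: partrec2_def)
  then show ?thesis
    using arith_graphD[OF arith_graph_partrec, of 2 G "[x, y]" "[]" "\<lambda>z. z" v] assms(2-4)
    by (simp add: arith_fun_id)
qed

lemma arith_pred_partrec3:
  assumes "partrec3 F" "arith_fun x" "arith_fun y" "arith_fun w" "arith_fun v"
  shows "arith_pred (\<lambda>z. F (x z) (y z) (w z) = Some (v z))"
proof -
  obtain G where "partrec 3 G" "\<And>x y z. G [x, y, z] = F x y z"
    using assms(1) by (auto simp: partrec3_def)
  then show ?thesis
    using arith_graphD[OF arith_graph_partrec, of 3 G "[x, y, w]" "[]" "\<lambda>z. z" v] assms(2-5)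
    by (simp add: arith_fun_id)
qed

locale computable_presentations =
  fixes B :: "nat \<Rightarrow> presentation"
  assumes uniformly_computable: "uniformly_computable B"
begin

lemma
  assumes i: "arith_fun i" and x: "arith_fun x"
  shows arith_dom_char: "arith_fun v \<Longrightarrow> arith_pred (\<lambda>z. dom_char (B (i z)) (x z) = Some (v z))"
    and arith_add_fun: "arith_fun y \<Longrightarrow> arith_fun v \<Longrightarrow>
      arith_pred (\<lambda>z. add_fun (B (i z)) (x z) (y z) = Some (v z))"
    and arith_scale_fun: "arith_fun c \<Longrightarrow> arith_fun v \<Longrightarrow>
      arith_pred (\<lambda>z. scale_fun (B (i z)) (c z) (x z) = Some (v z))"
    and arith_norm_fun: "arith_fun n \<Longrightarrow> arith_fun v \<Longrightarrow>
      arith_pred (\<lambda>z. norm_fun (B (i z)) (x z) (n z) = Some (v z))"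
  using uniformly_computable i x arith_pred_partrec2[of "\<lambda>i. dom_char (B i)"]
    arith_pred_partrec3[of "\<lambda>i. add_fun (B i)"] arith_pred_partrec3[of "\<lambda>i. scale_fun (B i)"]
    arith_pred_partrec3[of "\<lambda>i. norm_fun (B i)"]
  by (simp_all add: uniformly_computable_def)

lemma arith_spaces:
  "arith_spaces (\<lambda>i. points (B i)) (\<lambda>i. padd (B i)) (\<lambda>i. scale_by (B i)) (\<lambda>i. norm_of (B i))"
proof
  fix i x y :: "nat \<Rightarrow> nat" and q :: "nat \<Rightarrow> rat"
  assume i: "arith_fun i" and x: "arith_fun x"
  show "arith_pred (\<lambda>z. x z \<in> points (B (i z)))"
    unfolding points_def mem_Collect_eq by (intro arith_dom_char arith_intros i x)
  show "arith_fun (\<lambda>z. padd (B (i z)) (x z) (y z))" if "arith_fun y"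
    unfolding padd_def
    by (intro arith_fun_the arith_add_fun arith_intros i[THEN arith_fun_comp] x[THEN arith_fun_comp]
        that[THEN arith_fun_comp])
  show "arith_fun (\<lambda>z. scale_by (B (i z)) (q z) (x z))" if "arith_rat q"
  proof -
    have "arith_fun (\<lambda>z. LEAST c. rat_of_code c = q z)"
      by (intro arith_fun_Least arith_intros that[THEN arith_rat_comp] ex_rat_of_code)
    note code = this[THEN arith_fun_comp]
    show ?thesis
      unfolding scale_by_def
      by (intro arith_fun_the arith_scale_fun arith_intros i[THEN arith_fun_comp]
          x[THEN arith_fun_comp] code)
  qed
  show "arith_real (\<lambda>z. norm_of (B (i z)) (x z))"
    unfolding norm_of_def
    by (intro arith_real_rat_sup arith_pred_ex arith_pred_rat_le arith_rat_rat_of_code arith_fun_the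
        arith_norm_fun arith_intros i[THEN arith_fun_comp] x[THEN arith_fun_comp])
qed

sublocale arith_spaces "\<lambda>i. points (B i)" "\<lambda>i. padd (B i)" "\<lambda>i. scale_by (B i)" "\<lambda>i. norm_of (B i)"
  by (rule arith_spaces)

lemma arith_ops_total: "arith_pred (\<lambda>i. ops_total (B i))"
  unfolding ops_total_iff
  by (intro space_intros arith_dom_char arith_add_fun arith_scale_fun)

lemma arith_norm_total: "arith_pred (\<lambda>i. norm_total (B i))"
  unfolding norm_total_iff by (intro space_intros arith_norm_fun)

end

definition C01_formula :: "presentation \<Rightarrow> bool" where
  "C01_formula P \<longleftrightarrow> (\<exists>zero. \<exists>e\<in>points P. \<exists>l\<in>points P. \<exists>r\<in>points P.
    evaluations (points P) (padd P) (scale_by P) zero (norm_of P) e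
      (frame.bumps (points P) (padd P) (scale_by P) (norm_of P) e)
      (frame.bump_le (points P) (padd P) (scale_by P) (norm_of P) e l r)
      (frame.bump_value (points P) (padd P) (scale_by P) (norm_of P) e l r)
      (frame.bump_weight (points P) (padd P) (scale_by P) (norm_of P) e l r))"

lemma (in computable_presentations) arith_C01_formula: "arith_pred (\<lambda>i. C01_formula (B i))"
  unfolding C01_formula_def by (intro space_intros arith_evaluations)

lemma C01_formula_iff_dense_embedding:
  assumes "ops_total P" "norm_total P"
  shows "C01_formula P \<longleftrightarrow>
    (\<exists>zero J. dense_embedding (points P) (padd P) (pscale P) zero (pnorm P) {0..1::real} J)"
proof -
  have "dense_embedding (points P) (padd P) (scale_by P) zero (norm_of P) {0..1::real} J \<longleftrightarrow>
      dense_embedding (points P) (padd P) (pscale P) zero (pnorm P) {0..1} J" for zero J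
    by (rule iffI; erule dense_embedding.dense_embedding_cong)
      (simp_all add: scale_by_eq norm_of_eq assms)
  then show ?thesis by (simp add: C01_formula_def flip: ex_dense_embedding_iff_evaluations_bumps)
qed

theorem presents_C01_iff:
  "presents_normed_space P \<and> isometrically_isomorphic (banach_completion P) C01 \<longleftrightarrow>
    ops_total P \<and> norm_total P \<and> C01_formula P"
proof (cases "ops_total P \<and> norm_total P")
  case True
  let ?space = "\<lambda>zero. rat_normed_space (points P) (padd P) (pscale P) zero (pnorm P)"
  let ?embeds = "\<lambda>zero. \<exists>J.
      dense_embedding (points P) (padd P) (pscale P) zero (pnorm P) {0..1::real} J"
  have "?space zero \<and> isometrically_isomorphic (banach_completion P) C01 \<longleftrightarrow> ?embeds zero" for zero
  proof (cases "?space zero")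
    case True
    then show ?thesis by (simp add: completion_iso_C01_iff_dense_embedding)
  next
    case False
    then show ?thesis using dense_embedding.axioms(1)[of "points P"] by fast
  qed
  then have "Ex ?space \<and> isometrically_isomorphic (banach_completion P) C01 \<longleftrightarrow> Ex ?embeds" by meson
  with True show ?thesis by (simp add: presents_normed_space_def C01_formula_iff_dense_embedding)
qed (auto simp: presents_normed_space_def)

theorem theorem1p4:
  fixes B :: "nat \<Rightarrow> presentation"
  assumes "uniformly_computable B"
    and "enumerates_all B"
  shows "arithmetical
    {i. presents_normed_space (B i) \<and> isometrically_isomorphic (banach_completion (B i)) C01}"
proof -
  interpret computable_presentations B by unfold_locales (rule assms(1))
  have "arith_pred (\<lambda>i. ops_total (B i) \<and> norm_total (B i) \<and> C01_formula (B i))"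
    by (intro arith_intros arith_ops_total arith_norm_total arith_C01_formula)
  then show ?thesis unfolding presents_C01_iff by (intro arithmetical_if_arith_pred) simp
qed

end
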